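(* Let $\Delta \subset \mathbb{R}^d$ be any $d$-simplex such that $\overline{\mathbb{B}}_{2,d} \subseteq \Delta$ and each vertex of $\Delta$ lies on $d \cdot \partial \overline{\mathbb{B}}_{2,d}$. Then $\Delta \in \operatorname{md}(\overline{\mathbb{B}}_{2,d})$.
   Context: $\overline{\mathbb{B}}_{2,d}$ is the closed Euclidean unit ball of $\mathbb{R}^d$ and $\partial\overline{\mathbb{B}}_{2,d}$ the unit sphere. A $d$-simplex is the convex hull of $d+1$ affinely independent points. $(M_n)^d_{sa}$ denotes $d$-tuples of self-adjoint complex $n\times n$ matrices. For a $d$-tuple $A$ of bounded operators on a Hilbert space, $\mathcal{W}_1(A)=\{(\varphi(A_1),\dots,\varphi(A_d)) : \varphi \text{ a state on the unital } C^*\text{-algebra generated by } A\}$. A tuple $N$ on $H_2$ is a dilation of a tuple $X$ on $H_1$ ($X\prec N$) if there is an isometry $V:H_1\to H_2$ with $X_i=V^*N_iV$ for all $i$. A normal tuple is a tuple of commuting normal bounded operators; $\sigma(N)$ is its joint spectrum. For a closed convex set $K\subseteq\mathbb{R}^d$: $\mathcal{W}^{\max}_n(K)=\{X\in(M_n)^d_{sa}:\mathcal{W}_1(X)\subseteq K\}$, $\mathcal{W}^{\min}_n(K)=\{X\in(M_n)^d_{sa}: \text{there is a normal tuple } N \text{ on some Hilbert space with } X\prec N,\ \sigma(N)\subseteq K\}$, $\mathcal{W}^{\max}(K)=\bigcup_n\mathcal{W}^{\max}_n(K)$, $\mathcal{W}^{\min}(K)=\bigcup_n\mathcal{W}^{\min}_n(K)$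 (containment is levelwise). For compact convex $K\subseteq\mathbb{R}^d$, $\mathcal{E}(K)=\{L\supseteq K : L\subseteq\mathbb{R}^d \text{ compact and convex},\ \mathcal{W}^{\max}(K)\subseteq\mathcal{W}^{\min}(L)\}$ (dilation hulls of $K$), and $\operatorname{md}(K)$ is the set of elements of $\mathcal{E}(K)$ that are minimal with respect to inclusion (minimal dilation hulls). *)

theory Defs
  imports "HOL-Analysis.Analysis" "HOL-Library.Infinite_Typeclass"
    "Jordan_Normal_Form.Schur_Decomposition"
begin

text \<open>
  Both HOL-Analysis and the matrix library use the infix dollar sign, so components of
  vectors of \<open>real ^ 'd\<close> are written with \<^const>\<open>vec_nth\<close> below.
  Points of \<open>d\<close>-space are vectors indexed by a finite type \<open>'d\<close> with \<open>CARD('d) = d\<close>, and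
  \<open>d\<close>-tuples of matrices or operators are functions on \<open>'d\<close>.
\<close>

section \<open>Hilbert spaces and bounded operators\<close>

text \<open>
  Complex Hilbert spaces are modelled as the spaces of square-summable families \<open>I \<rightarrow> \<complex>\<close>,
  for an arbitrary index set \<open>I\<close>: up to unitary equivalence (choose an orthonormal basis)
  every Hilbert space is of this form.
  In particular \<open>\<complex>\<^sup>n\<close> is the space with index set \<open>{..<n}\<close>.
  Families are total functions vanishing outside \<open>I\<close>.
\<close>

definition ell2 :: "'i set \<Rightarrow> ('i \<Rightarrow> complex) set" where
  "ell2 I = {x. (\<forall>i. i \<notin> I \<longrightarrow> x i = 0) \<and> (\<lambda>i. (cmod (x i))\<^sup>2) summable_on I}"

definition ell2_inner :: "('i \<Rightarrow> complex) \<Rightarrow> ('i \<Rightarrow> complex) \<Rightarrow> complex" where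
  "ell2_inner x y = infsum (\<lambda>i. x i * cnj (y i)) UNIV"

definition ell2_norm :: "('i \<Rightarrow> complex) \<Rightarrow> real" where
  "ell2_norm x = sqrt (infsum (\<lambda>i. (cmod (x i))\<^sup>2) UNIV)"

type_synonym ('i, 'j) oper = "('i \<Rightarrow> complex) \<Rightarrow> ('j \<Rightarrow> complex)"

definition op_add :: "('i, 'j) oper \<Rightarrow> ('i, 'j) oper \<Rightarrow> ('i, 'j) oper" where
  "op_add S T = (\<lambda>x j. S x j + T x j)"

definition op_scale :: "complex \<Rightarrow> ('i, 'j) oper \<Rightarrow> ('i, 'j) oper" where
  "op_scale c T = (\<lambda>x j. c * T x j)"

definition op_id :: "'i set \<Rightarrow> ('i, 'i) oper" where
  "op_id I = (\<lambda>x. if x \<in> ell2 I then x else (\<lambda>_. 0))"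

text \<open>
  The junk value \<open>0\<close> is prescribed outside \<open>ell2 I\<close>, so that
  equality of operators as HOL functions is equality as maps \<open>ell2 I \<rightarrow> ell2 J\<close>.
\<close>

definition bounded_ops :: "'i set \<Rightarrow> 'j set \<Rightarrow> ('i, 'j) oper set" where
  "bounded_ops I J = {T.
     (\<forall>x \<in> ell2 I. T x \<in> ell2 J) \<and>
     (\<forall>x. x \<notin> ell2 I \<longrightarrow> T x = (\<lambda>_. 0)) \<and>
     (\<forall>x \<in> ell2 I. \<forall>y \<in> ell2 I. T (\<lambda>i. x i + y i) = (\<lambda>j. T x j + T y j)) \<and>
     (\<forall>c. \<forall>x \<in> ell2 I. T (\<lambda>i. c * x i) = (\<lambda>j. c * T x j)) \<and>
     (\<exists>C. \<forall>x \<in> ell2 I. ell2_norm (T x) \<le> C * ell2_norm x)}"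

definition op_adj :: "'i set \<Rightarrow> 'j set \<Rightarrow> ('i, 'j) oper \<Rightarrow> ('j, 'i) oper" where
  "op_adj I J T = (THE S. S \<in> bounded_ops J I \<and>
     (\<forall>x \<in> ell2 I. \<forall>y \<in> ell2 J. ell2_inner (T x) y = ell2_inner x (S y)))"

definition op_isometry :: "'i set \<Rightarrow> 'j set \<Rightarrow> ('i, 'j) oper \<Rightarrow> bool" where
  "op_isometry I J V \<longleftrightarrow>
     V \<in> bounded_ops I J \<and> (\<forall>x \<in> ell2 I. ell2_norm (V x) = ell2_norm x)"


section \<open>Generated C*-algebras, states, characters\<close>

definition unital_cstar_subalgebra :: "'i set \<Rightarrow> ('i, 'i) oper set \<Rightarrow> bool" where
  "unital_cstar_subalgebra I \<A> \<longleftrightarrow>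
     \<A> \<subseteq> bounded_ops I I \<and>
     op_id I \<in> \<A> \<and>
     (\<forall>S \<in> \<A>. \<forall>T \<in> \<A>. op_add S T \<in> \<A>) \<and>
     (\<forall>c. \<forall>T \<in> \<A>. op_scale c T \<in> \<A>) \<and>
     (\<forall>S \<in> \<A>. \<forall>T \<in> \<A>. S \<circ> T \<in> \<A>) \<and>
     (\<forall>T \<in> \<A>. op_adj I I T \<in> \<A>) \<and>
     \<comment> \<open>closed in the operator norm\<close>
     (\<forall>T \<in> bounded_ops I I.
        (\<forall>e>0. \<exists>S \<in> \<A>. \<forall>x \<in> ell2 I. ell2_norm (\<lambda>i. S x i - T x i) \<le> e * ell2_norm x)
        \<longrightarrow> T \<in> \<A>)"

definition cstar_gen :: "'i set \<Rightarrow> ('d \<Rightarrow> ('i, 'i) oper) \<Rightarrow> ('i, 'i) oper set" where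
  "cstar_gen I A = \<Inter> {\<A>. unital_cstar_subalgebra I \<A> \<and> range A \<subseteq> \<A>}"

definition linear_functional_on :: "('i, 'i) oper set \<Rightarrow> (('i, 'i) oper \<Rightarrow> complex) \<Rightarrow> bool" where
  "linear_functional_on \<A> \<phi> \<longleftrightarrow>
     (\<forall>S \<in> \<A>. \<forall>T \<in> \<A>. \<phi> (op_add S T) = \<phi> S + \<phi> T) \<and>
     (\<forall>c. \<forall>T \<in> \<A>. \<phi> (op_scale c T) = c * \<phi> T)"

definition state_on :: "'i set \<Rightarrow> ('i, 'i) oper set \<Rightarrow> (('i, 'i) oper \<Rightarrow> complex) \<Rightarrow> bool" where
  "state_on I \<A> \<phi> \<longleftrightarrow>
     linear_functional_on \<A> \<phi> \<and>
     (\<forall>T \<in> \<A>. \<phi> (op_adj I I T \<circ> T) \<in> \<real>\<^sub>\<ge>\<^sub>0) \<and>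
     \<phi> (op_id I) = 1"

definition character_on :: "'i set \<Rightarrow> ('i, 'i) oper set \<Rightarrow> (('i, 'i) oper \<Rightarrow> complex) \<Rightarrow> bool" where
  "character_on I \<A> \<omega> \<longleftrightarrow>
     linear_functional_on \<A> \<omega> \<and>
     (\<forall>S \<in> \<A>. \<forall>T \<in> \<A>. \<omega> (S \<circ> T) = \<omega> S * \<omega> T) \<and>
     \<omega> (op_id I) = 1"

definition W1 :: "'i set \<Rightarrow> ('d::finite \<Rightarrow> ('i, 'i) oper) \<Rightarrow> (complex ^ 'd) set" where
  "W1 I A = {(\<chi> k. \<phi> (A k)) | \<phi>. state_on I (cstar_gen I A) \<phi>}"


section \<open>Normal tuples and dilations\<close>

definition normal_tuple :: "'i set \<Rightarrow> ('d \<Rightarrow> ('i, 'i) oper) \<Rightarrow> bool" where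
  "normal_tuple I N \<longleftrightarrow>
     (\<forall>k. N k \<in> bounded_ops I I \<and> op_adj I I (N k) \<circ> N k = N k \<circ> op_adj I I (N k)) \<and>
     (\<forall>k l. N k \<circ> N l = N l \<circ> N k)"

text \<open>
  The joint spectrum of a normal tuple, as the Gelfand spectrum of the commutative unital
  C*-algebra it generates, evaluated at the generators.
\<close>

definition joint_spectrum :: "'i set \<Rightarrow> ('d::finite \<Rightarrow> ('i, 'i) oper) \<Rightarrow> (complex ^ 'd) set" where
  "joint_spectrum I N = {(\<chi> k. \<phi> (N k)) | \<phi>. character_on I (cstar_gen I N) \<phi>}"

definition dilates_to ::
  "'i set \<Rightarrow> ('d \<Rightarrow> ('i, 'i) oper) \<Rightarrow> 'j set \<Rightarrow> ('d \<Rightarrow> ('j, 'j) oper) \<Rightarrow> bool" where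
  "dilates_to I X J N \<longleftrightarrow>
     (\<exists>V. op_isometry I J V \<and> (\<forall>k. X k = op_adj I J V \<circ> N k \<circ> V))"


section \<open>Matrix ranges and dilation hulls\<close>

definition mat_op :: "nat \<Rightarrow> complex mat \<Rightarrow> (nat, nat) oper" where
  "mat_op n A = (\<lambda>x. if x \<in> ell2 {..<n}
     then (\<lambda>i. if i < n then (\<Sum>j<n. A $$ (i, j) * x j) else 0) else (\<lambda>_. 0))"

definition sa_tuples :: "nat \<Rightarrow> ('d \<Rightarrow> complex mat) set" where
  "sa_tuples n = {X. \<forall>k. X k \<in> carrier_mat n n \<and> mat_adjoint (X k) = X k}"

definition real_points :: "(real ^ 'd::finite) set \<Rightarrow> (complex ^ 'd) set" where
  "real_points K = (\<lambda>x. \<chi> k. complex_of_real (vec_nth x k)) ` K"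

definition Wmax_level :: "nat \<Rightarrow> (real ^ 'd::finite) set \<Rightarrow> ('d \<Rightarrow> complex mat) set" where
  "Wmax_level n K =
     {X \<in> sa_tuples n. W1 {..<n} (\<lambda>k. mat_op n (X k)) \<subseteq> real_points K}"

text \<open>
  HOL cannot quantify over all Hilbert spaces inside a formula, so the type \<open>'i\<close> providing the
  index sets (equivalently, an infinite bound on the Hilbert space dimension) is a parameter.
  The set defined does not depend on the choice of the infinite type \<open>'i\<close>:
  for a matrix tuple, a normal dilation can always be cut down
  to a separable reducing subspace without enlarging its joint spectrum.
\<close>

definition Wmin_level ::
  "'i::infinite itself \<Rightarrow> nat \<Rightarrow> (real ^ 'd::finite) set \<Rightarrow> ('d \<Rightarrow> complex mat) set" where
  "Wmin_level _ n K =
     {X \<in> sa_tuples n. \<exists>(J :: 'i set) N.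
        normal_tuple J N \<and> dilates_to {..<n} (\<lambda>k. mat_op n (X k)) J N \<and>
        joint_spectrum J N \<subseteq> real_points K}"

text \<open>
  A matrix tuple determines its level \<open>n\<close>, so inclusion of the unions over \<open>n\<close> is
  levelwise inclusion.
\<close>

definition Wmax :: "(real ^ 'd::finite) set \<Rightarrow> ('d \<Rightarrow> complex mat) set" where
  "Wmax K = (\<Union>n\<in>{1..}. Wmax_level n K)"

definition Wmin ::
  "'i::infinite itself \<Rightarrow> (real ^ 'd::finite) set \<Rightarrow> ('d \<Rightarrow> complex mat) set" where
  "Wmin TI K = (\<Union>n\<in>{1..}. Wmin_level TI n K)"

definition dilation_hulls ::
  "'i::infinite itself \<Rightarrow> (real ^ 'd::finite) set \<Rightarrow> (real ^ 'd) set set" where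
  "dilation_hulls TI K = {L. K \<subseteq> L \<and> compact L \<and> convex L \<and> Wmax K \<subseteq> Wmin TI L}"

definition minimal_dilation_hulls ::
  "'i::infinite itself \<Rightarrow> (real ^ 'd::finite) set \<Rightarrow> (real ^ 'd) set set" where
  "minimal_dilation_hulls TI K =
     {L \<in> dilation_hulls TI K. \<forall>L' \<in> dilation_hulls TI K. L' \<subseteq> L \<longrightarrow> L' = L}"

end

theory Submission
  imports Defs
begin

text \<open>
  Let \<open>l\<^sub>v\<close> be the barycentric coordinates of \<open>\<Delta>\<close>, extended to affine functions. If the matrix
  range of \<open>X\<close> lies in \<open>\<Delta>\<close>, then the matrices \<open>l\<^sub>v(X)\<close> are positive semidefinite with sum \<open>1\<close>,
  hence \<open>l\<^sub>v(X) = R\<^sub>v\<^sup>* R\<^sub>v\<close>, and stacking the \<open>R\<^sub>v\<close> dilates \<open>X\<close> to a diagonal tuple whose joint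
  spectrum consists of vertices. So \<open>\<Delta>\<close> is a dilation hull of the ball.

  For minimality, let \<open>X\<close> be a tuple of \<open>d\<close> anticommuting self-adjoint unitary \<open>n \<times> n\<close> matrices
  without diagonal entries; it belongs to \<open>\<W>\<^sup>m\<^sup>a\<^sup>x\<close> of the ball. If \<open>V\<close> dilates \<open>X\<close> to a commuting
  self-adjoint tuple \<open>N\<close> and \<open>W = \<Sum>\<^sub>k N\<^sub>k V X\<^sub>k\<close>, then \<open>\<langle>W, V\<rangle> = d n\<close> for the Hilbert-Schmidt inner
  product, while anticommutation cancels the mixed terms of \<open>\<parallel>W\<parallel>\<^sup>2\<close>, leaving
  \<open>\<Sum>\<^sub>k \<parallel>N\<^sub>k V\<parallel>\<^sup>2\<close>; Cauchy-Schwarz gives \<open>\<Sum>\<^sub>k \<parallel>N\<^sub>k V\<parallel>\<^sup>2 \<ge> d\<^sup>2 n\<close>. If \<open>L \<subseteq> \<Delta>\<close> is compact and convex and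
  misses a vertex of \<open>\<Delta>\<close>, there are \<open>\<rho> < d\<^sup>2\<close> and \<open>p\<close> with \<open>\<bar>x\<bar>\<^sup>2 \<le> \<rho> + p \<bullet> x\<close> on \<open>L\<close>.
  When \<open>N\<close> has joint spectrum in \<open>L\<close>, this inequality passes to \<open>N\<close>, and taking traces against \<open>V\<close>
  (where the linear term vanishes) gives \<open>\<Sum>\<^sub>k \<parallel>N\<^sub>k V\<parallel>\<^sup>2 \<le> \<rho> n\<close>, a contradiction.

  The inequality passes to \<open>N\<close>, and \<open>N\<close> is self-adjoint, because a violation would produce joint
  approximate eigenvectors of \<open>N\<close>; these define characters of the generated C*-algebra, that is,
  points of the joint spectrum, outside \<open>L\<close>.
\<close>

section \<open>Square-summable families and bounded operators\<close>

text \<open>The radius \<open>d\<close> is where the two halves meet. For the hull property only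
  \<open>cball 0 1 \<subseteq> \<Delta>\<close> matters. For minimality, the anticommuting tuple
  forces mean square \<open>d\<^sup>2\<close> on every dilation, and every vertex has norm exactly
  \<open>d\<close>. Removing one vertex \<open>v\<close> need not lower the maximum of
  \<open>|x|^2\<close>, since the other vertices may stay in \<open>L\<close>; what it buys is an
  affine improvement \<open>|x|^2 \<le> d^2 - c l_v(x)\<close>, where \<open>l_v\<close> is the
  barycentric coordinate of \<open>v\<close>. The linear part of \<open>l_v\<close> averages to 0
  because the matrices have zero diagonal, so only the constant \<open>l_v(0)\<close> counts, and it
  is positive because the unit ball lies in the simplex. The joint spectrum is given by characters
  of the generated algebra, so an inequality on \<open>L\<close> has to be turned into an operator
  inequality. This is done variationally: the top of a quadratic form yields an approximate
  eigenvalue, and a seminorm \<open>q\<close> records the approximate eigenvalue equations already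
  secured, so that operators can be treated one at a time without losing the earlier ones.\<close>

lemma ell2_iff: "x \<in> ell2 I \<longleftrightarrow> (\<forall>i. i \<notin> I \<longrightarrow> x i = 0) \<and> x \<in> ell2 UNIV"
proof -
  have "(\<lambda>i. (cmod (x i))\<^sup>2) summable_on I \<longleftrightarrow> (\<lambda>i. (cmod (x i))\<^sup>2) summable_on UNIV"
    if "\<forall>i. i \<notin> I \<longrightarrow> x i = 0"
    using that by (intro summable_on_cong_neutral) auto
  then show ?thesis unfolding ell2_def by auto
qed

text \<open>Inner products and norms sum over the whole index type, so their algebra is stated for
  \<open>ell2 UNIV\<close>; members of \<open>ell2 I\<close> enter it through this rule.\<close>

lemma ell2_UNIV: "x \<in> ell2 I \<Longrightarrow> x \<in> ell2 UNIV"
  by (simp add: ell2_iff[of x I])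

lemma ell2_zero [simp]: "(\<lambda>_. 0) \<in> ell2 I"
  by (simp add: ell2_def)

lemma ell2_add [simp]:
  assumes "x \<in> ell2 I" "y \<in> ell2 I"
  shows "(\<lambda>i. x i + y i) \<in> ell2 I"
proof -
  have le: "(cmod (x i + y i))\<^sup>2 \<le> 2 * (cmod (x i))\<^sup>2 + 2 * (cmod (y i))\<^sup>2" for i
  proof -
    have "(cmod (x i + y i))\<^sup>2 \<le> (cmod (x i) + cmod (y i))\<^sup>2"
      by (intro power_mono norm_triangle_ineq) simp
    also have "\<dots> \<le> 2 * (cmod (x i))\<^sup>2 + 2 * (cmod (y i))\<^sup>2"
      using sum_squares_bound[of "cmod (x i)" "cmod (y i)"] by (simp add: power2_sum)
    finally show ?thesis .
  qed
  have "(\<lambda>i. 2 * (cmod (x i))\<^sup>2 + 2 * (cmod (y i))\<^sup>2) summable_on I"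
    using assms by (intro summable_on_add summable_on_cmult_right) (auto simp: ell2_def)
  then have "(\<lambda>i. (cmod (x i + y i))\<^sup>2) summable_on I"
    by (rule summable_on_comparison_test) (use le in auto)
  then show ?thesis using assms by (auto simp: ell2_def)
qed

lemma ell2_scale [simp]: "x \<in> ell2 I \<Longrightarrow> (\<lambda>i. c * x i) \<in> ell2 I"
  by (auto simp: ell2_def norm_mult power_mult_distrib intro!: summable_on_cmult_right)

lemma ell2_uminus [simp]: "x \<in> ell2 I \<Longrightarrow> (\<lambda>i. - x i) \<in> ell2 I"
  using ell2_scale[of x I "-1"] by simp

lemma ell2_diff [simp]:
  assumes "x \<in> ell2 I" "y \<in> ell2 I"
  shows "(\<lambda>i. x i - y i) \<in> ell2 I"
  using ell2_add[OF assms(1) ell2_uminus[OF assms(2)]] by simp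

lemma ell2_sum [simp]:
  "(\<And>k. k \<in> S \<Longrightarrow> f k \<in> ell2 I) \<Longrightarrow> (\<lambda>i. \<Sum>k\<in>S. f k i) \<in> ell2 I"
  by (induction S rule: infinite_finite_induct) auto

lemma ell2_finite_support:
  assumes "finite F" "F \<subseteq> I" "\<And>i. i \<notin> F \<Longrightarrow> x i = 0"
  shows "x \<in> ell2 I"
proof -
  have "(\<lambda>i. (cmod (x i))\<^sup>2) summable_on F \<longleftrightarrow> (\<lambda>i. (cmod (x i))\<^sup>2) summable_on I"
    using assms by (intro summable_on_cong_neutral) auto
  then show ?thesis using assms by (auto simp: ell2_def)
qed

lemma ell2_inner_summable:
  assumes "x \<in> ell2 UNIV" "y \<in> ell2 UNIV"
  shows "(\<lambda>i. x i * cnj (y i)) summable_on UNIV"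
proof -
  have sum: "(\<lambda>i. (cmod (x i))\<^sup>2 + (cmod (y i))\<^sup>2) summable_on UNIV"
    using assms by (intro summable_on_add) (auto simp: ell2_def)
  have le: "norm (x i * cnj (y i)) \<le> (cmod (x i))\<^sup>2 + (cmod (y i))\<^sup>2" for i
  proof -
    have "2 * cmod (x i) * cmod (y i) \<le> (cmod (x i))\<^sup>2 + (cmod (y i))\<^sup>2"
      by (rule sum_squares_bound)
    moreover have "0 \<le> cmod (x i) * cmod (y i)" by simp
    ultimately have "cmod (x i) * cmod (y i) \<le> (cmod (x i))\<^sup>2 + (cmod (y i))\<^sup>2" by linarith
    then show ?thesis by (simp add: norm_mult)
  qed
  have "(\<lambda>i. norm (x i * cnj (y i))) summable_on UNIV"
    by (rule summable_on_comparison_test[OF sum le norm_ge_zero])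
  then show ?thesis by (rule Infinite_Sum.abs_summable_summable)
qed

lemma ell2_inner_add_left [simp]:
  assumes "x \<in> ell2 UNIV" "y \<in> ell2 UNIV" "z \<in> ell2 UNIV"
  shows "ell2_inner (\<lambda>i. x i + y i) z = ell2_inner x z + ell2_inner y z"
  using infsum_add[OF ell2_inner_summable[OF assms(1,3)] ell2_inner_summable[OF assms(2,3)]]
  by (simp add: ell2_inner_def algebra_simps)

lemma ell2_inner_scale_left [simp]: "ell2_inner (\<lambda>i. c * x i) z = c * ell2_inner x z"
  using infsum_cmult_right'[of c "\<lambda>i. x i * cnj (z i)" UNIV]
  by (simp add: ell2_inner_def algebra_simps)

lemma ell2_inner_commute: "ell2_inner y x = cnj (ell2_inner x y)"
  using infsum_cnj[of "\<lambda>i. x i * cnj (y i)" UNIV]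
  by (simp add: ell2_inner_def mult.commute)

lemma ell2_inner_zero [simp]: "ell2_inner (\<lambda>_. 0) z = 0" "ell2_inner z (\<lambda>_. 0) = 0"
  by (simp_all add: ell2_inner_def)

lemma ell2_inner_uminus_left [simp]: "ell2_inner (\<lambda>i. - x i) z = - ell2_inner x z"
  using ell2_inner_scale_left[of "-1"] by simp

lemma ell2_inner_diff_left [simp]:
  assumes "x \<in> ell2 UNIV" "y \<in> ell2 UNIV" "z \<in> ell2 UNIV"
  shows "ell2_inner (\<lambda>i. x i - y i) z = ell2_inner x z - ell2_inner y z"
  using ell2_inner_add_left[OF assms(1) ell2_uminus[OF assms(2)] assms(3)] by simp

lemma ell2_inner_add_right [simp]:
  assumes "x \<in> ell2 UNIV" "y \<in> ell2 UNIV" "z \<in> ell2 UNIV"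
  shows "ell2_inner z (\<lambda>i. x i + y i) = ell2_inner z x + ell2_inner z y"
  using ell2_inner_add_left[OF assms]
  by (subst (1 2 3) ell2_inner_commute) simp

lemma ell2_inner_scale_right [simp]: "ell2_inner z (\<lambda>i. c * x i) = cnj c * ell2_inner z x"
  by (subst (1 2) ell2_inner_commute) simp

lemma ell2_inner_diff_right [simp]:
  assumes "x \<in> ell2 UNIV" "y \<in> ell2 UNIV" "z \<in> ell2 UNIV"
  shows "ell2_inner z (\<lambda>i. x i - y i) = ell2_inner z x - ell2_inner z y"
  using ell2_inner_diff_left[OF assms]
  by (subst (1 2 3) ell2_inner_commute) simp

lemma ell2_inner_sum_left:
  "(\<And>k. k \<in> S \<Longrightarrow> f k \<in> ell2 UNIV) \<Longrightarrow> z \<in> ell2 UNIV \<Longrightarrow>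
     ell2_inner (\<lambda>i. \<Sum>k\<in>S. f k i) z = (\<Sum>k\<in>S. ell2_inner (f k) z)"
  by (induction S rule: infinite_finite_induct) auto

lemma ell2_inner_sum_right:
  "(\<And>k. k \<in> S \<Longrightarrow> f k \<in> ell2 UNIV) \<Longrightarrow> z \<in> ell2 UNIV \<Longrightarrow>
     ell2_inner z (\<lambda>i. \<Sum>k\<in>S. f k i) = (\<Sum>k\<in>S. ell2_inner z (f k))"
  by (induction S rule: infinite_finite_induct) auto

lemma ell2_norm_nonneg [simp]: "0 \<le> ell2_norm x"
  by (simp add: ell2_norm_def infsum_nonneg)

lemma ell2_norm_power2: "(ell2_norm x)\<^sup>2 = infsum (\<lambda>i. (cmod (x i))\<^sup>2) UNIV"
  by (simp add: ell2_norm_def infsum_nonneg)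

lemma ell2_inner_self: "ell2_inner x x = of_real ((ell2_norm x)\<^sup>2)"
proof -
  have "ell2_inner x x = infsum (\<lambda>i. of_real ((cmod (x i))\<^sup>2)) UNIV"
    unfolding ell2_inner_def by (simp only: complex_norm_square)
  also have "\<dots> = of_real ((ell2_norm x)\<^sup>2)"
  proof (cases "(\<lambda>i. (cmod (x i))\<^sup>2) summable_on UNIV")
    case True
    show ?thesis unfolding ell2_norm_power2
      by (rule infsumI, rule has_sum_of_real, rule has_sum_infsum, rule True)
  next
    \<comment> \<open>Neither family is summable here, and \<open>infsum\<close> then has the
      default value 0 on both sides.\<close>
    case False
    then have "\<not> (\<lambda>i. complex_of_real ((cmod (x i))\<^sup>2)) summable_on UNIV"
      using summable_on_Re by fastforce
    then show ?thesis using False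
      by (simp add: ell2_norm_power2 infsum_not_exists)
  qed
  finally show ?thesis .
qed

lemma ell2_norm_zero_iff: "x \<in> ell2 UNIV \<Longrightarrow> ell2_norm x = 0 \<longleftrightarrow> x = (\<lambda>_. 0)"
proof
  assume x: "x \<in> ell2 UNIV" and "ell2_norm x = 0"
  then have "infsum (\<lambda>i. (cmod (x i))\<^sup>2) UNIV = 0"
    by (simp flip: ell2_norm_power2)
  then have "(cmod (x i))\<^sup>2 = 0" for i
    by (intro nonneg_infsum_le_0D[where f="\<lambda>i. (cmod (x i))\<^sup>2" and A=UNIV])
       (use x in \<open>auto simp: ell2_def\<close>)
  then show "x = (\<lambda>_. 0)" by auto
qed (simp add: ell2_norm_def)

lemma ell2_norm_zero [simp]: "ell2_norm (\<lambda>_. 0) = 0"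
  by (simp add: ell2_norm_def)

lemma ell2_norm_scale [simp]: "ell2_norm (\<lambda>i. c * x i) = cmod c * ell2_norm x"
  by (simp add: ell2_norm_def norm_mult power_mult_distrib infsum_cmult_right' real_sqrt_mult)

lemma ell2_cauchy_schwarz:
  assumes "x \<in> ell2 UNIV" "y \<in> ell2 UNIV"
  shows "cmod (ell2_inner x y) \<le> ell2_norm x * ell2_norm y"
proof (cases "ell2_norm y = 0")
  case True
  then show ?thesis using ell2_norm_zero_iff[OF assms(2)] by simp
next
  case False
  define t where "t = ell2_inner x y"
  define n where "n = (ell2_norm y)\<^sup>2"
  have n: "n > 0" using False by (simp add: n_def)
  \<comment> \<open>\<open>z\<close> is \<open>|y|^2\<close> times the component of \<open>x\<close>
    orthogonal to \<open>y\<close>; clearing the denominator keeps the expansion free of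
    division.\<close>
  define z where "z = (\<lambda>i. of_real n * x i - t * y i)"
  have "ell2_inner z z = of_real n * of_real n * ell2_inner x x - of_real n * (cnj t * t)
      - t * of_real n * cnj t + t * cnj t * ell2_inner y y"
    unfolding z_def t_def using assms ell2_inner_commute[of y x]
    by (simp, simp add: algebra_simps)
  also have "\<dots> = of_real (n * (n * (ell2_norm x)\<^sup>2 - (cmod t)\<^sup>2))"
    unfolding ell2_inner_self n_def[symmetric] of_real_diff of_real_mult complex_norm_square
    by (simp add: algebra_simps)
  finally have "(ell2_norm z)\<^sup>2 = n * (n * (ell2_norm x)\<^sup>2 - (cmod t)\<^sup>2)"
    by (simp only: ell2_inner_self of_real_eq_iff)
  then have "0 \<le> n * (n * (ell2_norm x)\<^sup>2 - (cmod t)\<^sup>2)" by (metis zero_le_power2)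
  then have "(cmod t)\<^sup>2 \<le> n * (ell2_norm x)\<^sup>2" using n by (simp add: zero_le_mult_iff)
  then have "(cmod t)\<^sup>2 \<le> (ell2_norm x * ell2_norm y)\<^sup>2"
    by (simp add: n_def power_mult_distrib mult.commute)
  then show ?thesis unfolding t_def by (rule power2_le_imp_le) simp
qed

lemma ell2_norm_add_power2:
  assumes "x \<in> ell2 UNIV" "y \<in> ell2 UNIV"
  shows "(ell2_norm (\<lambda>i. x i + y i))\<^sup>2 = (ell2_norm x)\<^sup>2 + 2 * Re (ell2_inner x y) + (ell2_norm y)\<^sup>2"
proof -
  have "Re (ell2_inner (\<lambda>i. x i + y i) (\<lambda>i. x i + y i))
     = Re (ell2_inner x x) + 2 * Re (ell2_inner x y) + Re (ell2_inner y y)"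
    using assms ell2_inner_commute[of y x] by simp
  then show ?thesis by (simp add: ell2_inner_self)
qed

lemma ell2_norm_uminus [simp]: "ell2_norm (\<lambda>i. - x i) = ell2_norm x"
  by (simp add: ell2_norm_def)

lemma ell2_norm_diff_power2:
  assumes "x \<in> ell2 UNIV" "y \<in> ell2 UNIV"
  shows "(ell2_norm (\<lambda>i. x i - y i))\<^sup>2 = (ell2_norm x)\<^sup>2 - 2 * Re (ell2_inner x y) + (ell2_norm y)\<^sup>2"
proof -
  have "Re (ell2_inner (\<lambda>i. x i - y i) (\<lambda>i. x i - y i))
     = Re (ell2_inner x x) - 2 * Re (ell2_inner x y) + Re (ell2_inner y y)"
    using assms ell2_inner_commute[of y x] by simp
  then show ?thesis by (simp add: ell2_inner_self)
qed

lemma ell2_norm_triangle: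
  assumes "x \<in> ell2 UNIV" "y \<in> ell2 UNIV"
  shows "ell2_norm (\<lambda>i. x i + y i) \<le> ell2_norm x + ell2_norm y"
proof -
  have "Re (ell2_inner x y) \<le> ell2_norm x * ell2_norm y"
    using ell2_cauchy_schwarz[OF assms] complex_Re_le_cmod order_trans by blast
  then have "(ell2_norm (\<lambda>i. x i + y i))\<^sup>2 \<le> (ell2_norm x + ell2_norm y)\<^sup>2"
    by (simp add: ell2_norm_add_power2[OF assms] power2_sum)
  then show ?thesis by (rule power2_le_imp_le) simp
qed

lemma ell2_norm_triangle_diff:
  assumes "x \<in> ell2 UNIV" "y \<in> ell2 UNIV"
  shows "ell2_norm (\<lambda>i. x i - y i) \<le> ell2_norm x + ell2_norm y"
  using ell2_norm_triangle[OF assms(1) ell2_uminus[OF assms(2)]] by simp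

section \<open>Bounded operators between spaces of square-summable families\<close>

lemma bounded_opsD:
  assumes "T \<in> bounded_ops I J"
  shows op_maps: "x \<in> ell2 I \<Longrightarrow> T x \<in> ell2 J"
    and bounded_ops_outside: "x \<notin> ell2 I \<Longrightarrow> T x = (\<lambda>_. 0)"
    and bounded_ops_add: "x \<in> ell2 I \<Longrightarrow> y \<in> ell2 I \<Longrightarrow> T (\<lambda>i. x i + y i) = (\<lambda>j. T x j + T y j)"
    and bounded_ops_scale: "x \<in> ell2 I \<Longrightarrow> T (\<lambda>i. c * x i) = (\<lambda>j. c * T x j)"
  using assms unfolding bounded_ops_def by blast+

lemma bounded_ops_bound:
  assumes "T \<in> bounded_ops I J"
  obtains C where "C > 0" "\<And>x. x \<in> ell2 I \<Longrightarrow> ell2_norm (T x) \<le> C * ell2_norm x"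
proof -
  obtain C where C: "\<forall>x\<in>ell2 I. ell2_norm (T x) \<le> C * ell2_norm x"
    using assms unfolding bounded_ops_def by blast
  have "ell2_norm (T x) \<le> (\<bar>C\<bar> + 1) * ell2_norm x" if "x \<in> ell2 I" for x
  proof -
    have "C * ell2_norm x \<le> (\<bar>C\<bar> + 1) * ell2_norm x" by (intro mult_right_mono) auto
    then show ?thesis using C that by (meson order_trans)
  qed
  then show ?thesis by (intro that[of "\<bar>C\<bar> + 1"]) auto
qed

lemma bounded_ops_zero: "T \<in> bounded_ops I J \<Longrightarrow> T (\<lambda>_. 0) = (\<lambda>_. 0)"
  using bounded_ops_scale[of T I J "\<lambda>_. 0" 0] by simp

lemma bounded_ops_diff:
  assumes "T \<in> bounded_ops I J" "x \<in> ell2 I" "y \<in> ell2 I"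
  shows "T (\<lambda>i. x i - y i) = (\<lambda>j. T x j - T y j)"
  using bounded_ops_add[OF assms(1,2) ell2_scale[OF assms(3), of "-1"]]
    bounded_ops_scale[OF assms(1,3), of "-1"] by simp

lemma bounded_ops_sum:
  assumes T: "T \<in> bounded_ops I J"
  shows "(\<And>k. k \<in> S \<Longrightarrow> f k \<in> ell2 I) \<Longrightarrow> T (\<lambda>i. \<Sum>k\<in>S. f k i) = (\<lambda>j. \<Sum>k\<in>S. T (f k) j)"
  by (induction S rule: infinite_finite_induct)
     (auto simp: bounded_ops_zero[OF T] bounded_ops_add[OF T])

section \<open>Adjoints and generated C*-algebras\<close>

definition ell2_trunc :: "'i set \<Rightarrow> ('i \<Rightarrow> complex) \<Rightarrow> ('i \<Rightarrow> complex)" where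
  "ell2_trunc F x = (\<lambda>i. if i \<in> F then x i else 0)"

lemma ell2_trunc_mem: "finite F \<Longrightarrow> F \<subseteq> I \<Longrightarrow> ell2_trunc F x \<in> ell2 I"
  by (rule ell2_finite_support[of F]) (auto simp: ell2_trunc_def)

lemma ell2_inner_trunc: "finite F \<Longrightarrow> ell2_inner (ell2_trunc F x) y = (\<Sum>i\<in>F. x i * cnj (y i))"
proof -
  assume "finite F"
  have "ell2_inner (ell2_trunc F x) y = infsum (\<lambda>i. x i * cnj (y i)) F"
    unfolding ell2_inner_def by (rule infsum_cong_neutral) (auto simp: ell2_trunc_def)
  then show ?thesis using \<open>finite F\<close> by simp
qed

lemma ell2_norm_trunc: "finite F \<Longrightarrow> (ell2_norm (ell2_trunc F x))\<^sup>2 = (\<Sum>i\<in>F. (cmod (x i))\<^sup>2)"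
proof -
  assume "finite F"
  have "(ell2_norm (ell2_trunc F x))\<^sup>2 = infsum (\<lambda>i. (cmod (x i))\<^sup>2) F"
    unfolding ell2_norm_power2 by (rule infsum_cong_neutral) (auto simp: ell2_trunc_def)
  then show ?thesis using \<open>finite F\<close> by simp
qed

lemma ell2_trunc_approx:
  assumes "x \<in> ell2 I" "e > 0"
  obtains F where "finite F" "F \<subseteq> I" "ell2_norm (\<lambda>i. x i - ell2_trunc F x i) \<le> e"
proof -
  have "(\<lambda>i. (cmod (x i))\<^sup>2) summable_on I" using assms(1) by (simp add: ell2_def)
  from infsum_finite_approximation[OF this, of "e\<^sup>2"] \<open>e > 0\<close>
  obtain F where F: "finite F" "F \<subseteq> I"
    and d: "dist (\<Sum>i\<in>F. (cmod (x i))\<^sup>2) (infsum (\<lambda>i. (cmod (x i))\<^sup>2) I) \<le> e\<^sup>2"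
    by auto
  have *: "infsum (\<lambda>i. (cmod (x i))\<^sup>2) I = (ell2_norm x)\<^sup>2"
    unfolding ell2_norm_power2
    using assms(1) by (intro infsum_cong_neutral) (auto simp: ell2_def)
  define z where "z = (\<lambda>i. x i - ell2_trunc F x i)"
  have zz: "z \<in> ell2 UNIV" "ell2_trunc F x \<in> ell2 UNIV"
    unfolding z_def by (intro ell2_UNIV[of _ I] ell2_diff assms(1) ell2_trunc_mem F)+
  have "ell2_inner (ell2_trunc F x) z = 0"
    unfolding ell2_inner_trunc[OF F(1)] by (simp add: z_def ell2_trunc_def)
  moreover have "(\<lambda>i. ell2_trunc F x i + z i) = x" by (simp add: z_def)
  ultimately have "(ell2_norm x)\<^sup>2 = (ell2_norm (ell2_trunc F x))\<^sup>2 + (ell2_norm z)\<^sup>2"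
    using ell2_norm_add_power2[OF zz(2,1)] by simp
  then have "(ell2_norm z)\<^sup>2 \<le> e\<^sup>2"
    using d by (simp add: * ell2_norm_trunc[OF F(1)] dist_real_def)
  then have "ell2_norm z \<le> e" using \<open>e > 0\<close> power2_le_imp_le[of "ell2_norm z" e] by auto
  then show ?thesis using that F by (simp add: z_def)
qed

lemma bounded_opsI:
  assumes "\<And>x. x \<in> ell2 I \<Longrightarrow> T x \<in> ell2 J"
    and "\<And>x. x \<notin> ell2 I \<Longrightarrow> T x = (\<lambda>_. 0)"
    and "\<And>x y. x \<in> ell2 I \<Longrightarrow> y \<in> ell2 I \<Longrightarrow> T (\<lambda>i. x i + y i) = (\<lambda>j. T x j + T y j)"
    and "\<And>c x. x \<in> ell2 I \<Longrightarrow> T (\<lambda>i. c * x i) = (\<lambda>j. c * T x j)"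
    and "\<And>x. x \<in> ell2 I \<Longrightarrow> ell2_norm (T x) \<le> C * ell2_norm x"
  shows "T \<in> bounded_ops I J"
  using assms unfolding bounded_ops_def by blast

text \<open>The adjoint is built from its coordinates, the conjugates of \<open><T e_i, y>\<close>.
  On finite truncations the pairing follows from linearity; boundedness of \<open>T\<close> then
  bounds all finite square sums of \<open>S y\<close> uniformly, so \<open>S y\<close> is
  square-summable, and density of truncations extends the pairing.\<close>

lemma bounded_ops_adjoint_exists:
  assumes T: "T \<in> bounded_ops I J"
  shows "\<exists>S \<in> bounded_ops J I. \<forall>x\<in>ell2 I. \<forall>y\<in>ell2 J. ell2_inner (T x) y = ell2_inner x (S y)"
proof -
  obtain C where C: "C > 0" "\<And>x. x \<in> ell2 I \<Longrightarrow> ell2_norm (T x) \<le> C * ell2_norm x"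
    using bounded_ops_bound[OF T] by blast
  define e :: "'a \<Rightarrow> 'a \<Rightarrow> complex" where "e i = (\<lambda>j. if j = i then 1 else 0)" for i
  have e: "e i \<in> ell2 I" if "i \<in> I" for i
    by (rule ell2_finite_support[of "{i}"]) (use that in \<open>auto simp: e_def\<close>)
  define S where "S y = (if y \<in> ell2 J then (\<lambda>i. if i \<in> I then cnj (ell2_inner (T (e i)) y) else 0)
    else (\<lambda>_. 0))" for y
  have fin: "ell2_inner (T (ell2_trunc F x)) y = ell2_inner (ell2_trunc F x) (S y)"
    if F: "finite F" "F \<subseteq> I" and y: "y \<in> ell2 J" for F x y
  proof -
    have tr: "ell2_trunc F x = (\<lambda>j. \<Sum>i\<in>F. x i * e i j)"
      using F(1) by (auto simp: ell2_trunc_def e_def fun_eq_iff if_distrib[of "\<lambda>z. _ * z"] cong: if_cong)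
    have "T (ell2_trunc F x) = (\<lambda>j. \<Sum>i\<in>F. x i * T (e i) j)"
      unfolding tr using F e by (subst bounded_ops_sum[OF T]) (auto simp: subset_iff bounded_ops_scale[OF T])
    then have "ell2_inner (T (ell2_trunc F x)) y = (\<Sum>i\<in>F. x i * ell2_inner (T (e i)) y)"
      using F e y op_maps[OF T] by (subst \<open>T _ = _\<close>, subst ell2_inner_sum_left) (auto simp: subset_iff ell2_UNIV[of _ J])
    also have "\<dots> = ell2_inner (ell2_trunc F x) (S y)"
      using F y by (subst ell2_inner_trunc) (auto simp: S_def intro!: sum.cong)
    finally show ?thesis .
  qed
  have bound: "(\<Sum>i\<in>F. (cmod (S y i))\<^sup>2) \<le> (C * ell2_norm y)\<^sup>2"
    if F: "finite F" "F \<subseteq> I" and y: "y \<in> ell2 J" for F y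
  proof -
    \<comment> \<open>Testing with the truncation of \<open>S y\<close> itself gives
      \<open>|z|^2 = |<T z, y>| \<le> C |z| |y|\<close>, and one factor \<open>|z|\<close>
      cancels.\<close>
    define z where "z = ell2_trunc F (S y)"
    have z: "z \<in> ell2 I" unfolding z_def by (rule ell2_trunc_mem[OF F])
    have "ell2_inner z (S y) = of_real ((ell2_norm z)\<^sup>2)"
      unfolding z_def by (simp only: ell2_inner_trunc[OF F(1)] ell2_norm_trunc[OF F(1)] of_real_sum complex_norm_square)
    then have "of_real ((ell2_norm z)\<^sup>2) = ell2_inner (T z) y"
      unfolding z_def fin[OF F y] by simp
    then have "(ell2_norm z)\<^sup>2 = cmod (ell2_inner (T z) y)"
      by (metis abs_of_nonneg norm_of_real zero_le_power2)
    also have "\<dots> \<le> ell2_norm (T z) * ell2_norm y"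
      using z y op_maps[OF T z] by (intro ell2_cauchy_schwarz) (auto intro: ell2_UNIV[of _ I] ell2_UNIV[of _ J])
    also have "\<dots> \<le> C * ell2_norm z * ell2_norm y"
      by (intro mult_right_mono C z) simp
    finally have "ell2_norm z * ell2_norm z \<le> ell2_norm z * (C * ell2_norm y)"
      by (simp add: power2_eq_square mult_ac)
    then have "ell2_norm z \<le> C * ell2_norm y"
      using C(1)
      by (metis ell2_norm_nonneg less_imp_le mult_left_le_imp_le mult_nonneg_nonneg order_le_less)
    then have "(ell2_norm z)\<^sup>2 \<le> (C * ell2_norm y)\<^sup>2" by (intro power_mono) auto
    then show ?thesis by (simp add: z_def ell2_norm_trunc[OF F(1)])
  qed
  have summ: "(\<lambda>i. (cmod (S y i))\<^sup>2) summable_on I" if "y \<in> ell2 J" for y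
    by (rule nonneg_bdd_above_summable_on, simp, rule bdd_aboveI2[where M="(C * ell2_norm y)\<^sup>2"])
       (use bound[OF _ _ that] in blast)
  have mem: "S y \<in> ell2 I" if "y \<in> ell2 J" for y
    using summ[OF that] by (auto simp: ell2_def S_def)
  have norm: "ell2_norm (S y) \<le> C * ell2_norm y" if y: "y \<in> ell2 J" for y
  proof -
    have "(ell2_norm (S y))\<^sup>2 = infsum (\<lambda>i. (cmod (S y i))\<^sup>2) I"
      unfolding ell2_norm_power2
      using mem[OF y] by (intro infsum_cong_neutral) (auto simp: ell2_def)
    also have "\<dots> \<le> (C * ell2_norm y)\<^sup>2"
    proof (rule infsum_le_finite_sums[OF summ[OF y]])
      show "(\<Sum>i\<in>F. (cmod (S y i))\<^sup>2) \<le> (C * ell2_norm y)\<^sup>2" if "finite F" "F \<subseteq> I" for F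
        by (rule bound[OF that y])
    qed
    finally show ?thesis by (rule power2_le_imp_le) (use C(1) in auto)
  qed
  have adj: "ell2_inner (T x) y = ell2_inner x (S y)" if x: "x \<in> ell2 I" and y: "y \<in> ell2 J" for x y
  proof -
    have "cmod (ell2_inner (T x) y - ell2_inner x (S y)) \<le> 0 + \<epsilon>" if "\<epsilon> > 0" for \<epsilon>
    proof -
      \<comment> \<open>\<open>K\<close> bounds the combined coefficient of \<open>|z|\<close> in
        the two error terms; the added 1 keeps it positive.\<close>
      define K where "K = C * ell2_norm y + ell2_norm (S y) + 1"
      have K: "K > 0" using C(1) by (simp add: K_def add_nonneg_pos)
      obtain F where F: "finite F" "F \<subseteq> I" and le: "ell2_norm (\<lambda>i. x i - ell2_trunc F x i) \<le> \<epsilon> / K"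
        using ell2_trunc_approx[OF x, of "\<epsilon> / K"] \<open>\<epsilon> > 0\<close> K by auto
      define z where "z = (\<lambda>i. x i - ell2_trunc F x i)"
      have tm: "ell2_trunc F x \<in> ell2 I" by (rule ell2_trunc_mem[OF F])
      have z: "z \<in> ell2 I" unfolding z_def using x tm by simp
      have xz: "x = (\<lambda>i. z i + ell2_trunc F x i)" by (simp add: z_def)
      have Tx: "T x = (\<lambda>j. T z j + T (ell2_trunc F x) j)"
        by (subst xz) (rule bounded_ops_add[OF T z tm])
      have "ell2_inner (T x) y = ell2_inner (T z) y + ell2_inner (T (ell2_trunc F x)) y"
        unfolding Tx using z tm y op_maps[OF T]
        by (intro ell2_inner_add_left) (auto intro: ell2_UNIV[of _ I] ell2_UNIV[of _ J])
      moreover have "ell2_inner x (S y) = ell2_inner z (S y) + ell2_inner (ell2_trunc F x) (S y)"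
        by (subst xz) (use z tm mem[OF y] in \<open>auto intro!: ell2_inner_add_left intro: ell2_UNIV[of _ I]\<close>)
      ultimately have "ell2_inner (T x) y - ell2_inner x (S y) = ell2_inner (T z) y - ell2_inner z (S y)"
        using fin[OF F y] by simp
      also have "cmod \<dots> \<le> cmod (ell2_inner (T z) y) + cmod (ell2_inner z (S y))"
        by (rule norm_triangle_ineq4)
      also have "\<dots> \<le> ell2_norm (T z) * ell2_norm y + ell2_norm z * ell2_norm (S y)"
        using z y op_maps[OF T z] mem[OF y]
        by (intro add_mono ell2_cauchy_schwarz) (auto intro: ell2_UNIV[of _ I] ell2_UNIV[of _ J])
      also have "\<dots> \<le> C * ell2_norm z * ell2_norm y + ell2_norm z * ell2_norm (S y)"
        by (intro add_mono mult_right_mono C z) auto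
      also have "\<dots> \<le> ell2_norm z * K" by (simp add: K_def algebra_simps)
      also have "\<dots> \<le> \<epsilon> / K * K" using le K by (intro mult_right_mono) (auto simp: z_def)
      finally show ?thesis using K by simp
    qed
    then have "cmod (ell2_inner (T x) y - ell2_inner x (S y)) \<le> 0" by (rule field_le_epsilon)
    then show ?thesis by simp
  qed
  have "S (\<lambda>i. x i + y i) = (\<lambda>j. S x j + S y j)" if "x \<in> ell2 J" "y \<in> ell2 J" for x y
    using that e op_maps[OF T] by (auto simp: S_def fun_eq_iff ell2_UNIV[of _ J])
  moreover have "S (\<lambda>i. c * x i) = (\<lambda>j. c * S x j)" if "x \<in> ell2 J" for x c
    using that by (auto simp: S_def fun_eq_iff)
  ultimately have "S \<in> bounded_ops J I"
    using mem norm by (intro bounded_opsI[where C=C]) (auto simp: S_def)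
  then show ?thesis using adj by blast
qed

lemma ell2_eqI:
  assumes "x \<in> ell2 I" "y \<in> ell2 I" "\<And>z. z \<in> ell2 I \<Longrightarrow> ell2_inner z x = ell2_inner z y"
  shows "x = y"
proof -
  have d: "(\<lambda>i. x i - y i) \<in> ell2 I" using assms by simp
  have "ell2_inner (\<lambda>i. x i - y i) (\<lambda>i. x i - y i) = 0"
    using ell2_inner_diff_right[OF ell2_UNIV[OF assms(1)] ell2_UNIV[OF assms(2)] ell2_UNIV[OF d]] assms(3)[OF d]
    by simp
  then have "ell2_norm (\<lambda>i. x i - y i) = 0" by (simp add: ell2_inner_self)
  then show ?thesis using ell2_norm_zero_iff[OF ell2_UNIV[OF d]] by (simp add: fun_eq_iff)
qed

lemma bounded_ops_eqI:
  assumes S: "S \<in> bounded_ops I J" and T: "T \<in> bounded_ops I J"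
    and eq: "\<And>x z. x \<in> ell2 I \<Longrightarrow> z \<in> ell2 J \<Longrightarrow> ell2_inner z (S x) = ell2_inner z (T x)"
  shows "S = T"
proof
  fix x
  show "S x = T x"
  proof (cases "x \<in> ell2 I")
    case True
    then show ?thesis
      by (intro ell2_eqI[of _ J]) (auto intro: op_maps[OF S] op_maps[OF T] eq)
  qed (simp add: bounded_ops_outside[OF S] bounded_ops_outside[OF T])
qed

text \<open>The pairing determines an operator, so the description in \<open>op_adj\<close> is
  resolved by exhibiting one bounded candidate. All adjoint identities are obtained this
  way.\<close>

lemma op_adj_eqI:
  assumes S: "S \<in> bounded_ops J I"
    and eq: "\<And>x y. x \<in> ell2 I \<Longrightarrow> y \<in> ell2 J \<Longrightarrow> ell2_inner (T x) y = ell2_inner x (S y)"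
  shows "op_adj I J T = S"
  unfolding op_adj_def
proof (rule the_equality)
  fix R assume R: "R \<in> bounded_ops J I \<and> (\<forall>x\<in>ell2 I. \<forall>y\<in>ell2 J. ell2_inner (T x) y = ell2_inner x (R y))"
  show "R = S" using R S eq by (intro bounded_ops_eqI[of _ J I]) auto
qed (use assms in auto)

lemma
  assumes T: "T \<in> bounded_ops I J"
  shows op_adj_mem: "op_adj I J T \<in> bounded_ops J I"
    and op_adj_inner: "x \<in> ell2 I \<Longrightarrow> y \<in> ell2 J \<Longrightarrow> ell2_inner x (op_adj I J T y) = ell2_inner (T x) y"
    and op_adj_inner_left: "x \<in> ell2 I \<Longrightarrow> y \<in> ell2 J \<Longrightarrow> ell2_inner (op_adj I J T y) x = ell2_inner y (T x)"
proof -
  obtain S where "S \<in> bounded_ops J I" "\<And>x y. x \<in> ell2 I \<Longrightarrow> y \<in> ell2 J \<Longrightarrow> ell2_inner (T x) y = ell2_inner x (S y)"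
    using bounded_ops_adjoint_exists[OF T] by blast
  moreover from this have "op_adj I J T = S" by (rule op_adj_eqI)
  ultimately show "op_adj I J T \<in> bounded_ops J I"
    and *: "x \<in> ell2 I \<Longrightarrow> y \<in> ell2 J \<Longrightarrow> ell2_inner x (op_adj I J T y) = ell2_inner (T x) y" for x y
    by auto
  show "x \<in> ell2 I \<Longrightarrow> y \<in> ell2 J \<Longrightarrow> ell2_inner (op_adj I J T y) x = ell2_inner y (T x)"
    using * by (subst (1 2) ell2_inner_commute) simp
qed

lemma op_adj_op_adj: "T \<in> bounded_ops I J \<Longrightarrow> op_adj J I (op_adj I J T) = T"
  by (rule op_adj_eqI) (auto simp: op_adj_inner_left)

lemma op_id_mem: "op_id I \<in> bounded_ops I I"
  by (rule bounded_opsI[where C=1]) (auto simp: op_id_def)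

lemma op_add_mem:
  assumes S: "S \<in> bounded_ops I J" and T: "T \<in> bounded_ops I J"
  shows "op_add S T \<in> bounded_ops I J"
proof -
  obtain C where C: "\<And>x. x \<in> ell2 I \<Longrightarrow> ell2_norm (S x) \<le> C * ell2_norm x"
    using bounded_ops_bound[OF S] by blast
  obtain D where D: "\<And>x. x \<in> ell2 I \<Longrightarrow> ell2_norm (T x) \<le> D * ell2_norm x"
    using bounded_ops_bound[OF T] by blast
  have "ell2_norm (op_add S T x) \<le> (C + D) * ell2_norm x" if x: "x \<in> ell2 I" for x
  proof -
    have "ell2_norm (op_add S T x) \<le> ell2_norm (S x) + ell2_norm (T x)"
      unfolding op_add_def using x op_maps[OF S] op_maps[OF T]
      by (intro ell2_norm_triangle) (auto intro: ell2_UNIV[of _ I] ell2_UNIV[of _ J])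
    then show ?thesis using C[OF x] D[OF x] by (simp add: algebra_simps)
  qed
  then show ?thesis
    by (intro bounded_opsI[where C="C + D"])
       (simp_all add: op_add_def op_maps[OF S] op_maps[OF T] bounded_ops_add[OF S] bounded_ops_add[OF T]
         bounded_ops_scale[OF S] bounded_ops_scale[OF T] bounded_ops_outside[OF S] bounded_ops_outside[OF T]
         add_ac ring_distribs)
qed

lemma op_scale_mem:
  assumes T: "T \<in> bounded_ops I J"
  shows "op_scale c T \<in> bounded_ops I J"
proof -
  obtain D where D: "\<And>x. x \<in> ell2 I \<Longrightarrow> ell2_norm (T x) \<le> D * ell2_norm x"
    using bounded_ops_bound[OF T] by blast
  have "ell2_norm (op_scale c T x) \<le> (cmod c * D) * ell2_norm x" if x: "x \<in> ell2 I" for x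
    using mult_left_mono[OF D[OF x], of "cmod c"] by (simp add: op_scale_def mult_ac)
  then show ?thesis
    by (intro bounded_opsI[where C="cmod c * D"])
       (simp_all add: op_scale_def op_maps[OF T] bounded_ops_add[OF T]
         bounded_ops_scale[OF T] bounded_ops_outside[OF T] ring_distribs mult.left_commute)
qed

lemma op_comp_mem:
  assumes S: "S \<in> bounded_ops J K" and T: "T \<in> bounded_ops I J"
  shows "S \<circ> T \<in> bounded_ops I K"
proof -
  obtain C where C: "C > 0" "\<And>x. x \<in> ell2 J \<Longrightarrow> ell2_norm (S x) \<le> C * ell2_norm x"
    using bounded_ops_bound[OF S] by blast
  obtain D where D: "\<And>x. x \<in> ell2 I \<Longrightarrow> ell2_norm (T x) \<le> D * ell2_norm x"
    using bounded_ops_bound[OF T] by blast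
  have "ell2_norm ((S \<circ> T) x) \<le> (C * D) * ell2_norm x" if x: "x \<in> ell2 I" for x
  proof -
    have "ell2_norm (S (T x)) \<le> C * ell2_norm (T x)" by (intro C op_maps[OF T] x)
    also have "\<dots> \<le> C * (D * ell2_norm x)" using C(1) by (intro mult_left_mono D x) auto
    finally show ?thesis by (simp add: mult_ac)
  qed
  then show ?thesis
    by (intro bounded_opsI[where C="C * D"])
       (auto simp: op_maps[OF S] op_maps[OF T] bounded_ops_add[OF S] bounded_ops_add[OF T]
         bounded_ops_scale[OF S] bounded_ops_scale[OF T] bounded_ops_outside[OF T] bounded_ops_zero[OF S])
qed

lemma op_adj_id: "op_adj I I (op_id I) = op_id I"
  by (rule op_adj_eqI[OF op_id_mem]) (simp add: op_id_def)

lemma op_adj_add: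
  assumes S: "S \<in> bounded_ops I J" and T: "T \<in> bounded_ops I J"
  shows "op_adj I J (op_add S T) = op_add (op_adj I J S) (op_adj I J T)"
proof (rule op_adj_eqI)
  show "op_add (op_adj I J S) (op_adj I J T) \<in> bounded_ops J I"
    by (intro op_add_mem op_adj_mem S T)
  fix x y assume "x \<in> ell2 I" "y \<in> ell2 J"
  then show "ell2_inner (op_add S T x) y = ell2_inner x (op_add (op_adj I J S) (op_adj I J T) y)"
    using op_adj_inner[OF S, of x y] op_adj_inner[OF T, of x y] op_maps[OF S] op_maps[OF T]
      op_maps[OF op_adj_mem[OF S]] op_maps[OF op_adj_mem[OF T]]
    by (simp add: op_add_def ell2_UNIV[of _ I] ell2_UNIV[of _ J])
qed

lemma op_adj_scale:
  assumes T: "T \<in> bounded_ops I J"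
  shows "op_adj I J (op_scale c T) = op_scale (cnj c) (op_adj I J T)"
proof (rule op_adj_eqI)
  show "op_scale (cnj c) (op_adj I J T) \<in> bounded_ops J I"
    by (intro op_scale_mem op_adj_mem T)
  fix x y assume "x \<in> ell2 I" "y \<in> ell2 J"
  then show "ell2_inner (op_scale c T x) y = ell2_inner x (op_scale (cnj c) (op_adj I J T) y)"
    using op_adj_inner[OF T, of x y] by (simp add: op_scale_def)
qed

lemma op_adj_comp:
  assumes S: "S \<in> bounded_ops J K" and T: "T \<in> bounded_ops I J"
  shows "op_adj I K (S \<circ> T) = op_adj I J T \<circ> op_adj J K S"
proof (rule op_adj_eqI)
  show "op_adj I J T \<circ> op_adj J K S \<in> bounded_ops K I"
    by (rule op_comp_mem[OF op_adj_mem[OF T] op_adj_mem[OF S]])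
  fix x y assume "x \<in> ell2 I" "y \<in> ell2 K"
  then show "ell2_inner ((S \<circ> T) x) y = ell2_inner x ((op_adj I J T \<circ> op_adj J K S) y)"
    by (simp add: op_adj_inner[OF T] op_adj_inner[OF S] op_maps[OF T] op_maps[OF op_adj_mem[OF S]])
qed

text \<open>Testing the difference of the adjoints on its own value \<open>z\<close> moves the
  estimate over to \<open>S - T\<close>. This lets the adjoint condition in
  \<open>approx_eigen_cstar\<close> survive operator-norm limits.\<close>

lemma op_adj_norm_diff:
  assumes S: "S \<in> bounded_ops I J" and T: "T \<in> bounded_ops I J"
    and le: "\<And>x. x \<in> ell2 I \<Longrightarrow> ell2_norm (\<lambda>j. S x j - T x j) \<le> e * ell2_norm x"
    and y: "y \<in> ell2 J" and "e \<ge> 0"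
  shows "ell2_norm (\<lambda>i. op_adj I J S y i - op_adj I J T y i) \<le> e * ell2_norm y"
proof -
  note mem [simp] = op_maps[OF S] op_maps[OF T]
      op_maps[OF op_adj_mem[OF S]] op_maps[OF op_adj_mem[OF T]]
      ell2_UNIV[of _ I] ell2_UNIV[of _ J]
  define z where "z = (\<lambda>i. op_adj I J S y i - op_adj I J T y i)"
  have z: "z \<in> ell2 I" using y by (simp add: z_def)
  have "ell2_inner z z = ell2_inner z (op_adj I J S y) - ell2_inner z (op_adj I J T y)"
    by (subst (2) z_def) (use z y in simp)
  also have "\<dots> = ell2_inner (\<lambda>j. S z j - T z j) y"
    using z y by (simp add: op_adj_inner[OF S] op_adj_inner[OF T])
  finally have "(ell2_norm z)\<^sup>2 = cmod (ell2_inner (\<lambda>j. S z j - T z j) y)"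
    unfolding ell2_inner_self by (metis abs_of_nonneg norm_of_real zero_le_power2)
  also have "\<dots> \<le> ell2_norm (\<lambda>j. S z j - T z j) * ell2_norm y"
    using z y by (intro ell2_cauchy_schwarz) auto
  also have "\<dots> \<le> e * ell2_norm z * ell2_norm y"
    by (intro mult_right_mono le z) simp
  finally have "ell2_norm z * ell2_norm z \<le> ell2_norm z * (e * ell2_norm y)"
    by (simp add: power2_eq_square mult_ac)
  then show ?thesis
    using \<open>e \<ge> 0\<close> unfolding z_def[symmetric]
    by (metis ell2_norm_nonneg mult_left_le_imp_le mult_nonneg_nonneg order_le_less)
qed

section \<open>Generated unital C*-algebras\<close>

lemma unital_cstar_subalgebra_bounded_ops: "unital_cstar_subalgebra I (bounded_ops I I)"
  unfolding unital_cstar_subalgebra_def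
  by (intro conjI ballI allI impI subset_refl op_id_mem op_add_mem op_scale_mem op_comp_mem op_adj_mem)

lemma cstar_gen_least:
  "unital_cstar_subalgebra I \<A> \<Longrightarrow> range A \<subseteq> \<A> \<Longrightarrow> cstar_gen I A \<subseteq> \<A>"
  by (auto simp: cstar_gen_def)

lemma cstar_gen_bounded: "range A \<subseteq> bounded_ops I I \<Longrightarrow> cstar_gen I A \<subseteq> bounded_ops I I"
  by (rule cstar_gen_least[OF unital_cstar_subalgebra_bounded_ops])

lemma
  shows cstar_gen_gen: "A k \<in> cstar_gen I A"
    and cstar_gen_id: "op_id I \<in> cstar_gen I A"
    and cstar_gen_add: "S \<in> cstar_gen I A \<Longrightarrow> T \<in> cstar_gen I A \<Longrightarrow> op_add S T \<in> cstar_gen I A"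
    and cstar_gen_scale: "T \<in> cstar_gen I A \<Longrightarrow> op_scale c T \<in> cstar_gen I A"
    and cstar_gen_comp: "S \<in> cstar_gen I A \<Longrightarrow> T \<in> cstar_gen I A \<Longrightarrow> S \<circ> T \<in> cstar_gen I A"
  by (auto simp: cstar_gen_def unital_cstar_subalgebra_def)

section \<open>Approximate eigenvectors and characters\<close>

abbreviation eigen_defect :: "('i, 'i) oper \<Rightarrow> complex \<Rightarrow> ('i \<Rightarrow> complex) \<Rightarrow> real" where
  "eigen_defect T c x \<equiv> ell2_norm (\<lambda>i. T x i - c * x i)"

text \<open>The sequence \<open>x\<close> stays fixed while the operator varies, so the eigenvalue
  becomes a function of the operator; unit length of the vectors is assumed separately.\<close>

definition approx_eigen :: "(nat \<Rightarrow> 'i \<Rightarrow> complex) \<Rightarrow> ('i, 'i) oper \<Rightarrow> complex \<Rightarrow> bool" where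
  "approx_eigen x T c \<longleftrightarrow> (\<lambda>n. eigen_defect T c (x n)) \<longlonglongrightarrow> 0"

lemma approx_eigen_unique:
  assumes x: "\<And>n. x n \<in> ell2 I" "\<And>n. ell2_norm (x n) = 1" and T: "T \<in> bounded_ops I I"
    and c: "approx_eigen x T c" and d: "approx_eigen x T d"
  shows "c = d"
proof -
  have "cmod (c - d) \<le> eigen_defect T d (x n) + eigen_defect T c (x n)" for n
  proof -
    have "(\<lambda>i. (c - d) * x n i) = (\<lambda>i. (T (x n) i - d * x n i) - (T (x n) i - c * x n i))"
      by (simp add: algebra_simps)
    then have "cmod (c - d) = ell2_norm (\<lambda>i. (T (x n) i - d * x n i) - (T (x n) i - c * x n i))"
      using ell2_norm_scale[of "c - d" "x n"] x(2)[of n] by simp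
    also have "\<dots> \<le> eigen_defect T d (x n) + eigen_defect T c (x n)"
      by (intro ell2_norm_triangle_diff ell2_UNIV[of _ I] ell2_diff ell2_scale x op_maps[OF T])
    finally show ?thesis .
  qed
  moreover have "(\<lambda>n. eigen_defect T d (x n) + eigen_defect T c (x n)) \<longlonglongrightarrow> 0 + 0"
    using c d unfolding approx_eigen_def by (intro tendsto_add)
  ultimately have "cmod (c - d) \<le> 0 + 0"
    by (intro LIMSEQ_le_const) auto
  then show ?thesis by simp
qed

lemma approx_eigenI:
  assumes "g \<longlonglongrightarrow> 0" "\<And>n. eigen_defect T c (x n) \<le> g n"
  shows "approx_eigen x T c"
  unfolding approx_eigen_def
  by (rule tendsto_sandwich[OF _ _ tendsto_const assms(1)]) (use assms(2) in auto)

lemma approx_eigen_bound: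
  assumes "approx_eigen x S c"
    and "\<And>n. eigen_defect T d (x n) \<le> K * eigen_defect S c (x n)"
  shows "approx_eigen x T d"
proof (rule approx_eigenI)
  show "(\<lambda>n. K * eigen_defect S c (x n)) \<longlonglongrightarrow> 0"
    using tendsto_mult_left[OF assms(1)[unfolded approx_eigen_def], of K] by simp
qed (rule assms(2))

lemma approx_eigen_id: "(\<And>n. x n \<in> ell2 I) \<Longrightarrow> approx_eigen x (op_id I) 1"
  by (simp add: approx_eigen_def op_id_def)

lemma approx_eigen_add:
  assumes x: "\<And>n. x n \<in> ell2 I" and S: "S \<in> bounded_ops I I" and T: "T \<in> bounded_ops I I"
    and c: "approx_eigen x S c" and d: "approx_eigen x T d"
  shows "approx_eigen x (op_add S T) (c + d)"
proof (rule approx_eigenI)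
  show "(\<lambda>n. eigen_defect S c (x n) + eigen_defect T d (x n)) \<longlonglongrightarrow> 0"
    using tendsto_add[OF c[unfolded approx_eigen_def] d[unfolded approx_eigen_def]] by simp
  show "eigen_defect (op_add S T) (c + d) (x n)
     \<le> eigen_defect S c (x n) + eigen_defect T d (x n)" for n
  proof -
    have "(\<lambda>i. op_add S T (x n) i - (c + d) * x n i) = (\<lambda>i. (S (x n) i - c * x n i) + (T (x n) i - d * x n i))"
      by (simp add: op_add_def algebra_simps)
    then show ?thesis
      using ell2_norm_triangle[of "\<lambda>i. S (x n) i - c * x n i" "\<lambda>i. T (x n) i - d * x n i"]
      by (simp add: ell2_UNIV[of _ I] x op_maps[OF S] op_maps[OF T])
  qed
qed

lemma approx_eigen_scale:
  assumes "approx_eigen x T d"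
  shows "approx_eigen x (op_scale c T) (c * d)"
proof (rule approx_eigen_bound[OF assms])
  fix n
  have "(\<lambda>i. op_scale c T (x n) i - c * d * x n i) = (\<lambda>i. c * (T (x n) i - d * x n i))"
    by (simp add: op_scale_def algebra_simps)
  then show "eigen_defect (op_scale c T) (c * d) (x n) \<le> cmod c * eigen_defect T d (x n)"
    by simp
qed

lemma approx_eigen_comp:
  assumes x: "\<And>n. x n \<in> ell2 I" and S: "S \<in> bounded_ops I I" and T: "T \<in> bounded_ops I I"
    and c: "approx_eigen x S c" and d: "approx_eigen x T d"
  shows "approx_eigen x (S \<circ> T) (c * d)"
proof -
  obtain K where K: "\<And>x. x \<in> ell2 I \<Longrightarrow> ell2_norm (S x) \<le> K * ell2_norm x"
    using bounded_ops_bound[OF S] by blast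
  show ?thesis
  proof (rule approx_eigenI)
    show "(\<lambda>n. K * eigen_defect T d (x n) + cmod d * eigen_defect S c (x n)) \<longlonglongrightarrow> 0"
      using tendsto_add[OF tendsto_mult_left[OF d[unfolded approx_eigen_def], of K]
          tendsto_mult_left[OF c[unfolded approx_eigen_def], of "cmod d"]] by simp
    show "eigen_defect (S \<circ> T) (c * d) (x n)
       \<le> K * eigen_defect T d (x n) + cmod d * eigen_defect S c (x n)" for n
    proof -
      define z where "z = (\<lambda>i. T (x n) i - d * x n i)"
      have z: "z \<in> ell2 I" unfolding z_def by (intro ell2_diff ell2_scale x op_maps[OF T])
      have "S z = (\<lambda>i. S (T (x n)) i - d * S (x n) i)" unfolding z_def
        by (simp add: bounded_ops_diff[OF S] bounded_ops_scale[OF S] x op_maps[OF T])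
      then have eq: "(\<lambda>i. (S \<circ> T) (x n) i - c * d * x n i) = (\<lambda>i. S z i + d * (S (x n) i - c * x n i))"
        by (simp add: algebra_simps)
      have "eigen_defect (S \<circ> T) (c * d) (x n)
        \<le> ell2_norm (S z) + ell2_norm (\<lambda>i. d * (S (x n) i - c * x n i))"
        unfolding eq by (intro ell2_norm_triangle ell2_UNIV[of _ I] ell2_diff ell2_scale x z op_maps[OF S])
      also have "\<dots> \<le> K * ell2_norm z + cmod d * eigen_defect S c (x n)"
        using K[OF z] by simp
      finally show ?thesis by (simp add: z_def)
    qed
  qed
qed

text \<open>Three errors are added: the eigen-defect of \<open>S\<close>, the distance of
  \<open>S\<close> from \<open>T\<close>, and the distance of the two eigenvalues. Taking each at
  most \<open>r/4\<close> leaves strict room below \<open>r\<close>.\<close>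

lemma approx_eigen_limit:
  assumes x: "\<And>n. x n \<in> ell2 I" "\<And>n. ell2_norm (x n) = 1" and T: "T \<in> bounded_ops I I"
    and lim: "\<And>e. e > 0 \<Longrightarrow> \<exists>S\<in>bounded_ops I I. \<exists>d.
       (\<forall>x\<in>ell2 I. ell2_norm (\<lambda>i. S x i - T x i) \<le> e * ell2_norm x) \<and> approx_eigen x S d \<and> cmod (d - c) \<le> e"
  shows "approx_eigen x T c"
  unfolding approx_eigen_def
proof (rule LIMSEQ_I)
  fix r :: real assume "r > 0"
  then obtain S d where S: "S \<in> bounded_ops I I"
    and ST: "\<forall>x\<in>ell2 I. ell2_norm (\<lambda>i. S x i - T x i) \<le> r / 4 * ell2_norm x"
    and ev: "approx_eigen x S d" and dc: "cmod (d - c) \<le> r / 4"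
    using lim[of "r / 4"] by auto
  obtain no where no: "\<And>n. n \<ge> no \<Longrightarrow> eigen_defect S d (x n) < r / 4"
    using LIMSEQ_D[OF ev[unfolded approx_eigen_def], of "r / 4"] \<open>r > 0\<close> by auto
  have "eigen_defect T c (x n) < r" if "n \<ge> no" for n
  proof -
    note mem = x op_maps[OF S x(1)] op_maps[OF T x(1)]
    have eq: "(\<lambda>i. T (x n) i - c * x n i) =
      (\<lambda>i. ((S (x n) i - d * x n i) + (d - c) * x n i) - (S (x n) i - T (x n) i))"
      by (simp add: algebra_simps)
    have "eigen_defect T c (x n) \<le>
       (eigen_defect S d (x n) + ell2_norm (\<lambda>i. (d - c) * x n i)) + ell2_norm (\<lambda>i. S (x n) i - T (x n) i)"
      unfolding eq
      by (rule order_trans[OF ell2_norm_triangle_diff add_right_mono[OF ell2_norm_triangle]];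
          intro ell2_UNIV[of _ I] ell2_add ell2_diff ell2_scale mem)
    also have "\<dots> < (r / 4 + r / 4) + r / 4"
      using no[OF that] dc ST x(1)[of n] x(2)[of n] by (intro add_less_le_mono) auto
    finally show ?thesis using \<open>r > 0\<close> by simp
  qed
  then show "\<exists>no. \<forall>n\<ge>no. norm (eigen_defect T c (x n) - 0) < r" by auto
qed

text \<open>For normal \<open>T\<close> the images of \<open>x\<close> under \<open>T\<close> and
  its adjoint have equal length, and their inner products with \<open>x\<close> are conjugate, so
  the expansions of the two squared defects coincide.\<close>

lemma normal_norm_adj:
  assumes T: "T \<in> bounded_ops I I" and normal: "op_adj I I T \<circ> T = T \<circ> op_adj I I T"
    and x: "x \<in> ell2 I"
  shows "eigen_defect (op_adj I I T) (cnj c) x = eigen_defect T c x"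
proof -
  note T' = op_adj_mem[OF T]
  note mem [simp] = op_maps[OF T] op_maps[OF T'] ell2_UNIV[of _ I]
  have "of_real ((ell2_norm (op_adj I I T x))\<^sup>2) = ell2_inner x (T (op_adj I I T x))"
    unfolding ell2_inner_self[symmetric]
    using op_adj_inner_left[OF T op_maps[OF T' x] x] by simp
  also have "T (op_adj I I T x) = op_adj I I T (T x)" using normal by (metis comp_apply)
  also have "ell2_inner x (op_adj I I T (T x)) = of_real ((ell2_norm (T x))\<^sup>2)"
    using op_adj_inner[OF T, of x "T x"] x by (simp add: ell2_inner_self)
  finally have n: "(ell2_norm (op_adj I I T x))\<^sup>2 = (ell2_norm (T x))\<^sup>2" by (simp only: of_real_eq_iff)
  have i: "ell2_inner (op_adj I I T x) x = cnj (ell2_inner (T x) x)"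
    using op_adj_inner_left[OF T, of x x] x ell2_inner_commute[of x "T x"] by simp
  have "(eigen_defect (op_adj I I T) (cnj c) x)\<^sup>2 = (eigen_defect T c x)\<^sup>2"
    using x by (simp add: ell2_norm_diff_power2 n i)
  then show ?thesis by (simp add: power2_eq_iff_nonneg)
qed

lemma approx_eigen_adj:
  assumes x: "\<And>n. x n \<in> ell2 I"
    and T: "T \<in> bounded_ops I I" and normal: "op_adj I I T \<circ> T = T \<circ> op_adj I I T"
    and ev: "approx_eigen x T c"
  shows "approx_eigen x (op_adj I I T) (cnj c)"
  by (rule approx_eigen_bound[OF ev, where K=1]) (simp add: normal_norm_adj[OF T normal x])

text \<open>
  Requiring the adjoint condition as well makes the set closed under adjoints without assuming that
  its members are normal.
\<close>
lemma approx_eigen_cstar: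
  assumes x: "\<And>n. x n \<in> ell2 I" "\<And>n. ell2_norm (x n) = 1"
  shows "unital_cstar_subalgebra I {T \<in> bounded_ops I I. \<exists>c. approx_eigen x T c \<and> approx_eigen x (op_adj I I T) (cnj c)}"
    (is "unital_cstar_subalgebra I ?A")
  unfolding unital_cstar_subalgebra_def
proof (intro conjI ballI allI impI)
  show "?A \<subseteq> bounded_ops I I" by blast
  show "op_id I \<in> ?A"
    using approx_eigen_id[of x I, OF x(1)] op_id_mem by (auto simp: op_adj_id intro!: exI[of _ 1])
next
  fix S T assume "S \<in> ?A" "T \<in> ?A"
  then obtain c d where *: "S \<in> bounded_ops I I" "approx_eigen x S c" "approx_eigen x (op_adj I I S) (cnj c)"
     "T \<in> bounded_ops I I" "approx_eigen x T d" "approx_eigen x (op_adj I I T) (cnj d)" by blast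
  show "op_add S T \<in> ?A"
    using approx_eigen_add[OF x(1) *(1,4,2,5)]
      approx_eigen_add[OF x(1) op_adj_mem[OF *(1)] op_adj_mem[OF *(4)] *(3,6)] op_add_mem[OF *(1,4)]
    by (auto simp: op_adj_add[OF *(1,4)] intro!: exI[of _ "c + d"])
  show "S \<circ> T \<in> ?A"
    using approx_eigen_comp[OF x(1) *(1,4,2,5)]
      approx_eigen_comp[OF x(1) op_adj_mem[OF *(4)] op_adj_mem[OF *(1)] *(6,3)] op_comp_mem[OF *(1,4)]
    by (auto simp: op_adj_comp[OF *(1,4)] mult.commute intro!: exI[of _ "c * d"])
next
  fix c T assume "T \<in> ?A"
  then obtain d where *:
     "T \<in> bounded_ops I I" "approx_eigen x T d" "approx_eigen x (op_adj I I T) (cnj d)" by blast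
  show "op_scale c T \<in> ?A"
    using approx_eigen_scale[OF *(2), of c]
      approx_eigen_scale[OF *(3), of "cnj c"] op_scale_mem[OF *(1)]
    by (auto simp: op_adj_scale[OF *(1)] intro!: exI[of _ "c * d"])
next
  fix T assume "T \<in> ?A"
  then obtain d where *:
     "T \<in> bounded_ops I I" "approx_eigen x T d" "approx_eigen x (op_adj I I T) (cnj d)" by blast
  show "op_adj I I T \<in> ?A"
    using * op_adj_mem[OF *(1)] by (auto simp: op_adj_op_adj[OF *(1)] intro!: exI[of _ "cnj d"])
next
  fix T assume T: "T \<in> bounded_ops I I"
    and lim: "\<forall>e>0. \<exists>S\<in>?A. \<forall>x\<in>ell2 I. ell2_norm (\<lambda>i. S x i - T x i) \<le> e * ell2_norm x"
  define e where "e m = 1 / real (Suc m)" for m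
  have e: "e m > 0" for m by (simp add: e_def)
  have "\<forall>m. \<exists>S c. S \<in> bounded_ops I I \<and> approx_eigen x S c \<and> approx_eigen x (op_adj I I S) (cnj c) \<and>
      (\<forall>x\<in>ell2 I. ell2_norm (\<lambda>i. S x i - T x i) \<le> e m * ell2_norm x)"
    using lim e by blast
  then obtain S c where S: "\<And>m. S m \<in> bounded_ops I I" and ev: "\<And>m. approx_eigen x (S m) (c m)"
    and ev': "\<And>m. approx_eigen x (op_adj I I (S m)) (cnj (c m))"
    and ST: "\<And>m x. x \<in> ell2 I \<Longrightarrow> ell2_norm (\<lambda>i. S m x i - T x i) \<le> e m * ell2_norm x"
    by metis
  \<comment> \<open>The eigenvalues of two approximants are compared on the same unit vectors
    \<open>x n\<close>; both defects vanish as \<open>n\<close> grows, leaving only the two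
    distances to \<open>T\<close>.\<close>
  have close: "cmod (c m - c l) \<le> e m + e l" for m l
  proof -
    have "cmod (c m - c l) \<le> (eigen_defect (S m) (c m) (x n) + eigen_defect (S l) (c l) (x n))
       + (e m + e l)" for n
    proof -
      note mem = x op_maps[OF S x(1)] op_maps[OF T x(1)]
      have eq: "(\<lambda>i. (c m - c l) * x n i) = (\<lambda>i. ((S m (x n) i - T (x n) i) + (S l (x n) i - c l * x n i))
         - ((S m (x n) i - c m * x n i) + (S l (x n) i - T (x n) i)))"
        by (simp add: algebra_simps)
      have "cmod (c m - c l) = ell2_norm (\<lambda>i. (c m - c l) * x n i)" by (simp add: x(2))
      also have "\<dots> \<le> (ell2_norm (\<lambda>i. S m (x n) i - T (x n) i) + eigen_defect (S l) (c l) (x n))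
          + (eigen_defect (S m) (c m) (x n) + ell2_norm (\<lambda>i. S l (x n) i - T (x n) i))"
        unfolding eq
        by (rule order_trans[OF ell2_norm_triangle_diff add_mono[OF ell2_norm_triangle ell2_norm_triangle]];
            intro ell2_UNIV[of _ I] ell2_add ell2_diff ell2_scale mem)
      finally show ?thesis using ST[OF x(1)[of n], of m] ST[OF x(1)[of n], of l] by (simp add: x(2))
    qed
    moreover have "(\<lambda>n. (eigen_defect (S m) (c m) (x n) + eigen_defect (S l) (c l) (x n))
       + (e m + e l)) \<longlonglongrightarrow> (0 + 0) + (e m + e l)"
      using ev unfolding approx_eigen_def by (intro tendsto_add tendsto_const) auto
    ultimately have "cmod (c m - c l) \<le> (0 + 0) + (e m + e l)" by (intro LIMSEQ_le_const) auto
    then show ?thesis by simp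
  qed
  have e0: "e \<longlonglongrightarrow> 0" unfolding e_def using LIMSEQ_inverse_real_of_nat by (simp add: inverse_eq_divide)
  have "Cauchy c"
  proof (rule metric_CauchyI)
    fix r :: real assume "r > 0"
    then obtain M where M: "\<And>m. m \<ge> M \<Longrightarrow> e m < r / 2"
      using LIMSEQ_D[OF e0, of "r / 2"] e by force
    have "dist (c m) (c l) < r" if "m \<ge> M" "l \<ge> M" for m l
      using close[of m l] M[OF that(1)] M[OF that(2)] by (simp add: dist_norm)
    then show "\<exists>M. \<forall>m\<ge>M. \<forall>n\<ge>M. dist (c m) (c n) < r" by blast
  qed
  then obtain a where a: "c \<longlonglongrightarrow> a" using Cauchy_convergent convergent_def by blast
  have pick: "\<exists>m. e m \<le> r \<and> cmod (c m - a) \<le> r" if r: "r > 0" for r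
  proof -
    obtain M where "\<And>m. m \<ge> M \<Longrightarrow> e m < r" using LIMSEQ_D[OF e0 r] e by force
    moreover obtain M' where "\<And>m. m \<ge> M' \<Longrightarrow> cmod (c m - a) < r" using LIMSEQ_D[OF a r] by force
    ultimately show ?thesis by (intro exI[of _ "max M M'"]) (simp add: less_imp_le)
  qed
  have "approx_eigen x T a"
  proof (rule approx_eigen_limit[OF x T])
    fix r :: real assume "r > 0"
    then obtain m where m: "e m \<le> r" "cmod (c m - a) \<le> r" using pick by blast
    have "ell2_norm (\<lambda>i. S m x i - T x i) \<le> r * ell2_norm x" if "x \<in> ell2 I" for x
      using ST[OF that, of m] mult_right_mono[OF m(1), of "ell2_norm x"] by simp
    then show "\<exists>S\<in>bounded_ops I I. \<exists>d. (\<forall>x\<in>ell2 I. ell2_norm (\<lambda>i. S x i - T x i) \<le> r * ell2_norm x) \<and>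
        approx_eigen x S d \<and> cmod (d - a) \<le> r"
      using S ev m by blast
  qed
  moreover have "approx_eigen x (op_adj I I T) (cnj a)"
  proof (rule approx_eigen_limit[OF x op_adj_mem[OF T]])
    fix r :: real assume "r > 0"
    then obtain m where m: "e m \<le> r" "cmod (c m - a) \<le> r" using pick by blast
    have "ell2_norm (\<lambda>i. S m x i - T x i) \<le> r * ell2_norm x" if "x \<in> ell2 I" for x
      using ST[OF that, of m] mult_right_mono[OF m(1), of "ell2_norm x"] by simp
    then have "ell2_norm (\<lambda>i. op_adj I I (S m) x i - op_adj I I T x i) \<le> r * ell2_norm x" if "x \<in> ell2 I" for x
      using that \<open>r > 0\<close> by (intro op_adj_norm_diff[OF S T]) auto
    moreover have "cmod (cnj (c m) - cnj a) \<le> r" using m(2) by (metis complex_cnj_diff complex_mod_cnj)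
    ultimately show "\<exists>S\<in>bounded_ops I I. \<exists>d. (\<forall>x\<in>ell2 I. ell2_norm (\<lambda>i. S x i - op_adj I I T x i) \<le> r * ell2_norm x) \<and>
        approx_eigen x S d \<and> cmod (d - cnj a) \<le> r"
      using op_adj_mem[OF S] ev' by blast
  qed
  ultimately show "T \<in> ?A" using T by blast
qed

text \<open>By \<open>approx_eigen_cstar\<close>, a sequence that asymptotically diagonalises the
  generators does so for every element of the generated algebra, and the eigenvalue depends linearly
  and multiplicatively on the element.\<close>

lemma approx_eigen_character:
  fixes N :: "'d::finite \<Rightarrow> ('i, 'i) oper"
  assumes N: "normal_tuple I N"
    and x: "\<And>n. x n \<in> ell2 I" "\<And>n. ell2_norm (x n) = 1"
    and ev: "\<And>k. approx_eigen x (N k) (c k)"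
  shows "(\<chi> k. c k) \<in> joint_spectrum I N"
proof -
  \<comment> \<open>Uniqueness of approximate eigenvalues along unit vectors makes this description
    meaningful on the generated algebra.\<close>
  define \<phi> where "\<phi> T = (THE c. approx_eigen x T c)" for T
  have Nb: "N k \<in> bounded_ops I I" "op_adj I I (N k) \<circ> N k = N k \<circ> op_adj I I (N k)" for k
    using N by (auto simp: normal_tuple_def)
  have "cstar_gen I N \<subseteq> {T \<in> bounded_ops I I. \<exists>c. approx_eigen x T c \<and> approx_eigen x (op_adj I I T) (cnj c)}"
  proof (intro cstar_gen_least approx_eigen_cstar x image_subsetI CollectI conjI Nb)
    show "\<exists>c. approx_eigen x (N k) c \<and> approx_eigen x (op_adj I I (N k)) (cnj c)" for k
      using ev approx_eigen_adj[of x I, OF x(1) Nb ev] by blast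
  qed
  then have gen: "T \<in> bounded_ops I I" "\<exists>c. approx_eigen x T c" if "T \<in> cstar_gen I N" for T
    using that by (blast dest: subsetD)+
  have \<phi>I: "\<phi> T = c" if "T \<in> bounded_ops I I" "approx_eigen x T c" for T c
    unfolding \<phi>_def
  proof (rule the_equality)
    show "d = c" if "approx_eigen x T d" for d
      by (rule approx_eigen_unique[of x I T, OF x]) fact+
  qed fact
  have \<phi>: "approx_eigen x T (\<phi> T)" if T: "T \<in> cstar_gen I N" for T
  proof -
    obtain c where "approx_eigen x T c" using gen(2)[OF T] by blast
    then show ?thesis using \<phi>I[OF gen(1)[OF T]] by simp
  qed
  have "character_on I (cstar_gen I N) \<phi>"
    unfolding character_on_def linear_functional_on_def
  proof (intro conjI ballI allI)
    fix S T assume S: "S \<in> cstar_gen I N" and T: "T \<in> cstar_gen I N"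
    show "\<phi> (op_add S T) = \<phi> S + \<phi> T"
      using S T by (intro \<phi>I op_add_mem approx_eigen_add[where I=I] gen \<phi> x)
    show "\<phi> (S \<circ> T) = \<phi> S * \<phi> T"
      using S T by (intro \<phi>I op_comp_mem[of _ I I] approx_eigen_comp[where I=I] gen \<phi> x)
  next
    fix c T assume T: "T \<in> cstar_gen I N"
    then show "\<phi> (op_scale c T) = c * \<phi> T"
      by (intro \<phi>I op_scale_mem approx_eigen_scale gen \<phi> x)
  next
    show "\<phi> (op_id I) = 1" by (intro \<phi>I op_id_mem approx_eigen_id x)
  qed
  moreover have "(\<chi> k. c k) = (\<chi> k. \<phi> (N k))" by (simp add: \<phi>I[OF Nb(1) ev])
  ultimately show ?thesis unfolding joint_spectrum_def by blast
qed

section \<open>Approximate eigenvalues of self-adjoint operators\<close>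

text \<open>In use, \<open>q\<close> is 0 or a sum of eigen-defects already under control. Keeping
  it abstract lets one result serve every stage of building joint approximate eigenvectors.\<close>

definition seminorm_on :: "'i set \<Rightarrow> (('i \<Rightarrow> complex) \<Rightarrow> real) \<Rightarrow> bool" where
  "seminorm_on I q \<longleftrightarrow> (\<forall>x\<in>ell2 I. 0 \<le> q x) \<and>
     (\<forall>x\<in>ell2 I. \<forall>y\<in>ell2 I. q (\<lambda>i. x i + y i) \<le> q x + q y) \<and>
     (\<forall>c. \<forall>x\<in>ell2 I. q (\<lambda>i. c * x i) = cmod c * q x)"

definition approx_null :: "'i set \<Rightarrow> (('i \<Rightarrow> complex) \<Rightarrow> real) \<Rightarrow> bool" where
  "approx_null I q \<longleftrightarrow> (\<forall>e>0. \<exists>x\<in>ell2 I. ell2_norm x = 1 \<and> q x \<le> e)"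

text \<open>
  The witness \<open>a\<close> is the largest asymptotic value of the quadratic form of \<open>A\<close> on unit vectors with
  \<open>q x \<rightarrow> 0\<close>. Near such vectors \<open>P = a - A\<close> is almost positive; testing this on \<open>y = x - P x / M\<close>
  shows that \<open>P x\<close> is small when \<open>\<langle>P x, x\<rangle>\<close> is.
\<close>
lemma self_adjoint_approx_eigenvalue:
  assumes A: "A \<in> bounded_ops I I" and sa: "op_adj I I A = A"
    and q: "seminorm_on I q" and qA: "\<And>x. x \<in> ell2 I \<Longrightarrow> q (A x) \<le> K * q x"
    and r: "\<And>e. e > 0 \<Longrightarrow> \<exists>x\<in>ell2 I. ell2_norm x = 1 \<and> q x \<le> e \<and> r \<le> Re (ell2_inner (A x) x)"
  shows "\<exists>a\<ge>r. approx_null I (\<lambda>x. q x + eigen_defect A (of_real a) x)"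
proof -
  have q0: "0 \<le> q x" and qadd: "y \<in> ell2 I \<Longrightarrow> q (\<lambda>i. x i + y i) \<le> q x + q y"
    and qsc: "q (\<lambda>i. c * x i) = cmod c * q x" if "x \<in> ell2 I" for x y c
    using q that unfolding seminorm_on_def by blast+
  obtain M0 where M0: "M0 > 0" "\<And>x. x \<in> ell2 I \<Longrightarrow> ell2_norm (A x) \<le> M0 * ell2_norm x"
    using bounded_ops_bound[OF A] by blast
  define rq where "rq x = Re (ell2_inner (A x) x)" for x
  \<comment> \<open>\<open>Z\<close> collects the levels that the form of \<open>A\<close> reaches
    on unit vectors with \<open>q\<close> arbitrarily small; its supremum is the candidate
    eigenvalue.\<close>
  define Z where "Z = {s. \<forall>e>0. \<exists>x\<in>ell2 I. ell2_norm x = 1 \<and> q x \<le> e \<and> s \<le> rq x}"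
  have rZ: "r \<in> Z" using r by (auto simp: Z_def rq_def)
  have "s \<le> M0" if sZ: "s \<in> Z" for s
  proof -
    obtain x where x: "x \<in> ell2 I" "ell2_norm x = 1" "s \<le> rq x"
      using sZ[unfolded Z_def, THEN CollectD, rule_format, of 1] by auto
    have "rq x \<le> ell2_norm (A x) * ell2_norm x"
      unfolding rq_def using complex_Re_le_cmod ell2_cauchy_schwarz[of "A x" x] op_maps[OF A x(1)] x(1)
        ell2_UNIV[of _ I] order_trans by blast
    then show ?thesis using x M0(2)[OF x(1)] by simp
  qed
  then have bdd: "bdd_above Z" by (rule bdd_aboveI)
  define a where "a = Sup Z"
  have ra: "r \<le> a" unfolding a_def by (rule cSup_upper[OF rZ bdd])
  define P where "P = op_add (op_scale (of_real a) (op_id I)) (op_scale (-1) A)"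
  have P: "P \<in> bounded_ops I I"
    unfolding P_def by (intro op_add_mem op_scale_mem op_id_mem A)
  have Px: "P x = (\<lambda>i. of_real a * x i - A x i)" if "x \<in> ell2 I" for x
    using that by (simp add: P_def op_add_def op_scale_def op_id_def)
  have Psa: "op_adj I I P = P"
    unfolding P_def
    by (simp add: op_adj_add[OF op_scale_mem[OF op_id_mem] op_scale_mem[OF A]] op_adj_scale[OF op_id_mem]
        op_adj_scale[OF A] op_adj_id sa)
  define M where "M = \<bar>a\<bar> + M0 + 1"
  have M: "M \<ge> 1" "M > 0" using M0 by (auto simp: M_def)
  note mem [simp] = op_maps[OF A] op_maps[OF P] ell2_UNIV[of _ I]
  have PM: "ell2_norm (P x) \<le> M * ell2_norm x" if x: "x \<in> ell2 I" for x
  proof -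
    have "ell2_norm (P x) \<le> ell2_norm (\<lambda>i. of_real a * x i) + ell2_norm (A x)"
      unfolding Px[OF x] using x by (intro ell2_norm_triangle_diff) auto
    also have "\<dots> \<le> \<bar>a\<bar> * ell2_norm x + M0 * ell2_norm x" using M0(2)[OF x] by simp
    also have "\<dots> \<le> M * ell2_norm x" by (simp add: M_def algebra_simps)
    finally show ?thesis .
  qed
  have P2: "\<bar>Re (ell2_inner (P x) x)\<bar> \<le> M * (ell2_norm x)\<^sup>2" if x: "x \<in> ell2 I" for x
  proof -
    have "\<bar>Re (ell2_inner (P x) x)\<bar> \<le> cmod (ell2_inner (P x) x)" by (rule abs_Re_le_cmod)
    also have "\<dots> \<le> ell2_norm (P x) * ell2_norm x" using x by (intro ell2_cauchy_schwarz) auto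
    also have "\<dots> \<le> M * ell2_norm x * ell2_norm x" by (intro mult_right_mono PM x) simp
    finally show ?thesis by (simp add: power2_eq_square mult_ac)
  qed
  have Prq: "Re (ell2_inner (P x) x) = a * (ell2_norm x)\<^sup>2 - rq x" if x: "x \<in> ell2 I" for x
    unfolding Px[OF x] rq_def using x by (simp add: ell2_inner_self)
  define C where "C = 1 + \<bar>a\<bar> + \<bar>K\<bar>"
  have C: "C > 0" by (simp add: C_def add_pos_nonneg)
  have "approx_null I (\<lambda>x. q x + eigen_defect A (of_real a) x)"
    unfolding approx_null_def
  proof (intro allI impI)
    fix \<eta> :: real assume \<eta>: "\<eta> > 0"
    \<comment> \<open>The closing estimate is \<open>|P x|^2 \<le> 5 M \<delta>\<close>; with this
      \<delta> the right side is \<open>(\<eta> / 2)^2\<close>.\<close>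
    define \<delta> where "\<delta> = \<eta>\<^sup>2 / (20 * M)"
    have \<delta>: "\<delta> > 0" using \<eta> M by (simp add: \<delta>_def)
    have "a + \<delta> \<notin> Z" using cSup_upper[OF _ bdd, of "a + \<delta>"] \<delta> by (auto simp: a_def)
    then obtain e0 where e0: "e0 > 0"
      and up: "\<And>x. x \<in> ell2 I \<Longrightarrow> ell2_norm x = 1 \<Longrightarrow> q x \<le> e0 \<Longrightarrow> rq x < a + \<delta>"
      unfolding Z_def by force
    \<comment> \<open>A vector \<open>y\<close> shorter than \<tau> is not normalised; its form is
      then at most \<open>M \<tau>^2 \<le> \<delta>\<close> in absolute value.\<close>
    define \<tau> where "\<tau> = min 1 (\<delta> / M)"
    have \<tau>: "\<tau> > 0" "\<tau> \<le> 1" "\<tau> \<le> \<delta> / M" using \<delta> M by (auto simp: \<tau>_def)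
    \<comment> \<open>The second bound gives \<open>q y \<le> C q x \<le> e0 \<tau>\<close>, so a
      \<open>y\<close> of length at least \<tau> has \<open>q \<le> e0\<close> after normalisation,
      and \<open>up\<close> applies to it.\<close>
    define \<epsilon> where "\<epsilon> = min (\<eta> / 2) (e0 * \<tau> / C)"
    have \<epsilon>: "\<epsilon> > 0" "\<epsilon> \<le> \<eta> / 2" "\<epsilon> \<le> e0 * \<tau> / C" using \<eta> e0 \<tau> C unfolding \<epsilon>_def
      by (simp_all only: min.cobounded1 min.cobounded2 min_less_iff_conj) simp
    have "\<exists>s\<in>Z. a - \<delta> < s"
      using less_cSup_iff[of Z "a - \<delta>"] rZ bdd \<delta> by (auto simp: a_def)
    then obtain x where x: "x \<in> ell2 I" and nx: "ell2_norm x = 1" and qx: "q x \<le> \<epsilon>" and rqx: "a - \<delta> < rq x"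
      using \<epsilon>(1) unfolding Z_def by force
    define w where "w = P x"
    define t where "t = 1 / M"
    have t: "t > 0" "t \<le> 1" "t * M = 1" using M by (auto simp: t_def)
    \<comment> \<open>A descent step for the form of \<open>P\<close>: with step
      \<open>t = 1 / M\<close> it lowers the form by at least \<open>t |w|^2\<close>. Since
      \<open>|y| \<le> 2\<close>, the form at \<open>y\<close> cannot fall below
      \<open>- 4 \<delta>\<close>, which limits \<open>|w|\<close>.\<close>
    define y where "y = (\<lambda>i. x i - of_real t * w i)"
    have w: "w \<in> ell2 I" and y: "y \<in> ell2 I" using x by (auto simp: w_def y_def)
    have Py: "P y = (\<lambda>i. w i - of_real t * P w i)"
      unfolding y_def using x w by (simp add: bounded_ops_diff[OF P] bounded_ops_scale[OF P] w_def)
    have Pwx: "ell2_inner (P w) x = of_real ((ell2_norm w)\<^sup>2)"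
      using op_adj_inner[OF P w x] w_def by (simp add: Psa ell2_inner_self)
    have "Re (ell2_inner (P y) y) = Re (ell2_inner w x) - t * (ell2_norm w)\<^sup>2 - t * (ell2_norm w)\<^sup>2
       + t * t * Re (ell2_inner (P w) w)"
      unfolding Py unfolding y_def using x w by (simp add: Pwx ell2_inner_self algebra_simps)
    also have "\<dots> \<le> \<delta> - t * (ell2_norm w)\<^sup>2"
    proof -
      have "t * t * Re (ell2_inner (P w) w) \<le> t * t * (M * (ell2_norm w)\<^sup>2)"
        using P2[OF w] t by (intro mult_left_mono) auto
      also have "\<dots> = t * (t * M) * (ell2_norm w)\<^sup>2" by (simp only: mult_ac)
      also have "\<dots> = t * (ell2_norm w)\<^sup>2" using t(3) by simp
      finally have "t * t * Re (ell2_inner (P w) w) \<le> t * (ell2_norm w)\<^sup>2" .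
      moreover have "Re (ell2_inner w x) \<le> \<delta>"
        unfolding w_def Prq[OF x] using nx rqx by simp
      ultimately show ?thesis by linarith
    qed
    finally have upper: "Re (ell2_inner (P y) y) \<le> \<delta> - t * (ell2_norm w)\<^sup>2" .
    have nw: "ell2_norm w \<le> M" using PM[OF x] nx by (simp add: w_def)
    have "ell2_norm y \<le> ell2_norm x + ell2_norm (\<lambda>i. of_real t * w i)"
      unfolding y_def using x w by (intro ell2_norm_triangle_diff) auto
    also have "\<dots> \<le> 1 + t * M" using nx mult_left_mono[OF nw, of t] t by simp
    finally have ny: "ell2_norm y \<le> 2" using t(3) by simp
    have "q y \<le> C * q x"
    proof -
      have y': "y = (\<lambda>i. x i + of_real (- t) * w i)" by (simp add: y_def)
      have w': "w = (\<lambda>i. of_real a * x i + (-1) * A x i)" by (simp add: w_def Px[OF x])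
      have "q w \<le> q (\<lambda>i. of_real a * x i) + q (\<lambda>i. (-1) * A x i)"
        unfolding w' using x by (intro qadd) auto
      also have "\<dots> = \<bar>a\<bar> * q x + q (A x)"
        using x by (simp only: qsc mem) simp
      also have "\<dots> \<le> \<bar>a\<bar> * q x + \<bar>K\<bar> * q x"
        using qA[OF x] mult_right_mono[OF abs_ge_self[of K] q0[OF x]] by linarith
      finally have qw: "q w \<le> (\<bar>a\<bar> + \<bar>K\<bar>) * q x" by (simp add: algebra_simps)
      have "q y \<le> q x + q (\<lambda>i. of_real (- t) * w i)"
        unfolding y' using x w by (intro qadd ell2_scale)
      also have "\<dots> = q x + t * q w" using w t by (simp only: qsc) simp
      also have "\<dots> \<le> q x + 1 * q w" using t q0[OF w] by (intro add_left_mono mult_right_mono) auto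
      finally show ?thesis using qw by (simp add: C_def algebra_simps)
    qed
    also have "\<dots> \<le> C * (e0 * \<tau> / C)" using qx \<epsilon> C by (intro mult_left_mono) auto
    finally have qy: "q y \<le> e0 * \<tau>" using C by simp
    have lower: "- (4 * \<delta>) \<le> Re (ell2_inner (P y) y)"
    proof (cases "\<tau> \<le> ell2_norm y")
      case True
      define n where "n = ell2_norm y"
      have n: "n > 0" using True \<tau> by (simp add: n_def)
      define m where "m = 1 / n"
      have m: "m > 0" "m * n = 1" using n by (auto simp: m_def)
      define u where "u = (\<lambda>i. of_real m * y i)"
      have u: "u \<in> ell2 I" unfolding u_def by (rule ell2_scale[OF y])
      have nu: "ell2_norm u = 1" unfolding u_def ell2_norm_scale using m by (simp add: n_def)
      have "q u = m * q y" unfolding u_def qsc[OF y] using m by simp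
      also have "\<dots> \<le> m * (e0 * \<tau>)" using qy m by (intro mult_left_mono) auto
      also have "\<dots> \<le> m * (e0 * n)" using True e0 m by (intro mult_left_mono) (auto simp: n_def)
      also have "\<dots> = e0" using m by simp
      finally have "rq u < a + \<delta>" by (rule up[OF u nu])
      then have "- \<delta> \<le> Re (ell2_inner (P u) u)" unfolding Prq[OF u] nu by simp
      also have "\<dots> = m * m * Re (ell2_inner (P y) y)"
        unfolding u_def bounded_ops_scale[OF P y] ell2_inner_scale_left ell2_inner_scale_right complex_cnj_complex_of_real
        by simp
      finally have "- \<delta> * (n * n) \<le> (m * m * Re (ell2_inner (P y) y)) * (n * n)"
        using n by (intro mult_right_mono) auto
      also have "\<dots> = (m * n) * (m * n) * Re (ell2_inner (P y) y)" by (simp only: mult_ac)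
      finally have "- \<delta> * n\<^sup>2 \<le> Re (ell2_inner (P y) y)" using m by (simp add: power2_eq_square)
      moreover have "\<delta> * n\<^sup>2 \<le> \<delta> * 2\<^sup>2" using ny n \<delta> by (intro mult_left_mono power_mono) (auto simp: n_def)
      ultimately show ?thesis by simp
    next
      case False
      then have "(ell2_norm y)\<^sup>2 \<le> \<tau>\<^sup>2" by (intro power_mono) auto
      also have "\<dots> \<le> \<tau>" using \<tau> by (simp add: power2_eq_square mult_left_le)
      also have "\<dots> \<le> \<delta> / M" by (rule \<tau>)
      finally have "M * (ell2_norm y)\<^sup>2 \<le> \<delta>" using M by (simp add: field_simps)
      then show ?thesis using P2[OF y] \<delta> by linarith
    qed
    have "t * (ell2_norm w)\<^sup>2 \<le> 5 * \<delta>" using upper lower by linarith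
    then have "(ell2_norm w)\<^sup>2 \<le> (\<eta> / 2)\<^sup>2"
      using M by (simp add: t_def \<delta>_def field_simps)
    then have "ell2_norm w \<le> \<eta> / 2" by (rule power2_le_imp_le) (use \<eta> in simp)
    moreover have "eigen_defect A (of_real a) x = ell2_norm w"
      unfolding w_def Px[OF x] using ell2_norm_uminus[of "\<lambda>i. of_real a * x i - A x i"] by simp
    ultimately show "\<exists>x\<in>ell2 I. ell2_norm x = 1 \<and> q x + eigen_defect A (of_real a) x \<le> \<eta>"
      using x nx qx \<epsilon>(2) by (intro bexI[of _ x]) auto
  qed
  then show ?thesis using ra by blast
qed

section \<open>Joint approximate eigenvectors of normal tuples\<close>

lemma seminorm_onD:
  assumes "seminorm_on I q"
  shows seminorm_on_nonneg: "x \<in> ell2 I \<Longrightarrow> 0 \<le> q x"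
    and seminorm_on_triangle: "x \<in> ell2 I \<Longrightarrow> y \<in> ell2 I \<Longrightarrow> q (\<lambda>i. x i + y i) \<le> q x + q y"
    and seminorm_on_scale: "x \<in> ell2 I \<Longrightarrow> q (\<lambda>i. c * x i) = cmod c * q x"
  using assms unfolding seminorm_on_def by blast+

lemma seminorm_on_zero: "seminorm_on I (\<lambda>_. 0)"
  by (simp add: seminorm_on_def)

lemma seminorm_on_add:
  assumes "seminorm_on I q" "seminorm_on I p"
  shows "seminorm_on I (\<lambda>x. q x + p x)"
  unfolding seminorm_on_def
proof (intro conjI ballI allI)
  fix x y assume x: "x \<in> ell2 I" and y: "y \<in> ell2 I"
  show "q (\<lambda>i. x i + y i) + p (\<lambda>i. x i + y i) \<le> q x + p x + (q y + p y)"
    using seminorm_on_triangle[OF assms(1) x y] seminorm_on_triangle[OF assms(2) x y] by linarith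
qed (simp_all add: seminorm_onD[OF assms(1)] seminorm_onD[OF assms(2)] distrib_left)

lemma seminorm_on_op:
  assumes T: "T \<in> bounded_ops I I"
  shows "seminorm_on I (eigen_defect T c)"
  unfolding seminorm_on_def
proof (intro conjI ballI allI)
  note mem [simp] = op_maps[OF T] ell2_UNIV[of _ I]
  fix x y assume x: "x \<in> ell2 I" and y: "y \<in> ell2 I"
  have "(\<lambda>i. T (\<lambda>i. x i + y i) i - c * (x i + y i)) = (\<lambda>i. (T x i - c * x i) + (T y i - c * y i))"
    by (simp add: bounded_ops_add[OF T x y] algebra_simps)
  then show "ell2_norm (\<lambda>i. T (\<lambda>i. x i + y i) i - c * (x i + y i))
    \<le> eigen_defect T c x + eigen_defect T c y"
    using x y by (simp add: ell2_norm_triangle)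
next
  fix d x assume x: "x \<in> ell2 I"
  have "(\<lambda>i. T (\<lambda>i. d * x i) i - c * (d * x i)) = (\<lambda>i. d * (T x i - c * x i))"
    by (simp add: bounded_ops_scale[OF T x] algebra_simps)
  then show "ell2_norm (\<lambda>i. T (\<lambda>i. d * x i) i - c * (d * x i)) = cmod d * eigen_defect T c x"
    by simp
qed simp

lemma approx_null_mono:
  assumes "approx_null I q" "\<And>x. x \<in> ell2 I \<Longrightarrow> p x \<le> q x"
  shows "approx_null I p"
  using assms unfolding approx_null_def by (meson order_trans)

text \<open>An approximate form of invariance of the kernel of \<open>q\<close> under
  \<open>T\<close>: wherever \<open>q\<close> is small at \<open>x\<close>, it stays small at
  \<open>T x\<close>.\<close>

definition rel_bounded :: "'i set \<Rightarrow> (('i \<Rightarrow> complex) \<Rightarrow> real) \<Rightarrow> ('i, 'i) oper \<Rightarrow> bool" where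
  "rel_bounded I q T \<longleftrightarrow> (\<exists>K\<ge>0. \<forall>x\<in>ell2 I. q (T x) \<le> K * q x)"

lemma rel_bounded_add:
  assumes "seminorm_on I q" "seminorm_on I p" "rel_bounded I q T" "rel_bounded I p T"
  shows "rel_bounded I (\<lambda>x. q x + p x) T"
proof -
  obtain K L where K: "K \<ge> 0" "\<And>x. x \<in> ell2 I \<Longrightarrow> q (T x) \<le> K * q x"
    and L: "L \<ge> 0" "\<And>x. x \<in> ell2 I \<Longrightarrow> p (T x) \<le> L * p x"
    using assms unfolding rel_bounded_def by blast
  have "q (T x) + p (T x) \<le> (K + L) * (q x + p x)" if x: "x \<in> ell2 I" for x
  proof -
    have "0 \<le> K * p x" "0 \<le> L * q x"
      using K(1) L(1) seminorm_on_nonneg[OF assms(1) x] seminorm_on_nonneg[OF assms(2) x] by auto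
    then show ?thesis using K(2)[OF x] L(2)[OF x] by (simp add: algebra_simps)
  qed
  then show ?thesis unfolding rel_bounded_def using K(1) L(1) by (intro exI[of _ "K + L"]) auto
qed

lemma rel_bounded_op_add:
  assumes q: "seminorm_on I q" and S: "S \<in> bounded_ops I I" "rel_bounded I q S"
    and T: "T \<in> bounded_ops I I" "rel_bounded I q T"
  shows "rel_bounded I q (op_add S T)"
proof -
  obtain K L where K: "K \<ge> 0" "\<And>x. x \<in> ell2 I \<Longrightarrow> q (S x) \<le> K * q x"
    and L: "L \<ge> 0" "\<And>x. x \<in> ell2 I \<Longrightarrow> q (T x) \<le> L * q x"
    using S(2) T(2) unfolding rel_bounded_def by blast
  have "q (op_add S T x) \<le> (K + L) * q x" if x: "x \<in> ell2 I" for x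
    using seminorm_on_triangle[OF q op_maps[OF S(1) x] op_maps[OF T(1) x]] K(2)[OF x] L(2)[OF x]
    by (simp add: op_add_def algebra_simps)
  then show ?thesis unfolding rel_bounded_def using K(1) L(1) by (intro exI[of _ "K + L"]) auto
qed

lemma rel_bounded_op_scale:
  assumes q: "seminorm_on I q" and T: "T \<in> bounded_ops I I" "rel_bounded I q T"
  shows "rel_bounded I q (op_scale c T)"
proof -
  obtain L where L: "L \<ge> 0" "\<And>x. x \<in> ell2 I \<Longrightarrow> q (T x) \<le> L * q x"
    using T(2) unfolding rel_bounded_def by blast
  have "q (op_scale c T x) \<le> (cmod c * L) * q x" if x: "x \<in> ell2 I" for x
    using seminorm_on_scale[OF q op_maps[OF T(1) x], of c] mult_left_mono[OF L(2)[OF x], of "cmod c"]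
    by (simp add: op_scale_def mult_ac)
  then show ?thesis unfolding rel_bounded_def using L(1) by (intro exI[of _ "cmod c * L"]) auto
qed

text \<open>\<open>S\<close> commutes with \<open>T - c\<close>, so the defect at \<open>S x\<close>
  is the norm of \<open>S\<close> applied to \<open>T x - c x\<close>.\<close>

lemma rel_bounded_commute:
  assumes S: "S \<in> bounded_ops I I" and T: "T \<in> bounded_ops I I" and comm: "S \<circ> T = T \<circ> S"
  shows "rel_bounded I (eigen_defect T c) S"
proof -
  obtain K where K: "K > 0" "\<And>x. x \<in> ell2 I \<Longrightarrow> ell2_norm (S x) \<le> K * ell2_norm x"
    using bounded_ops_bound[OF S] by blast
  have "eigen_defect T c (S x) \<le> K * eigen_defect T c x" if x: "x \<in> ell2 I" for x
  proof -
    have "(\<lambda>i. T (S x) i - c * S x i) = S (\<lambda>i. T x i - c * x i)"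
      using fun_cong[OF comm, of x]
      by (simp add: bounded_ops_diff[OF S] bounded_ops_scale[OF S] x op_maps[OF T])
    then show ?thesis using K(2)[of "\<lambda>i. T x i - c * x i"] x op_maps[OF T x] by simp
  qed
  then show ?thesis unfolding rel_bounded_def using K(1) by (intro exI[of _ K]) auto
qed

text \<open>
  Normality of \<open>T\<close> alone makes this seminorm compatible with the adjoint of \<open>S\<close>, so that Fuglede's
  theorem is not needed.
\<close>
lemma rel_bounded_commute_adj:
  assumes S: "S \<in> bounded_ops I I" and T: "T \<in> bounded_ops I I" and comm: "S \<circ> T = T \<circ> S"
    and normal: "op_adj I I T \<circ> T = T \<circ> op_adj I I T"
  shows "rel_bounded I (eigen_defect T c) (op_adj I I S)"
proof -
  have "op_adj I I S \<circ> op_adj I I T = op_adj I I T \<circ> op_adj I I S"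
    using comm by (metis op_adj_comp[OF S T] op_adj_comp[OF T S])
  from rel_bounded_commute[OF op_adj_mem[OF S] op_adj_mem[OF T] this, of "cnj c"]
  show ?thesis unfolding rel_bounded_def
    by (simp add: normal_norm_adj[OF T normal] op_maps[OF op_adj_mem[OF S]])
qed

text \<open>A norm bound \<open>M\<close> for \<open>A\<close> keeps its form above
  \<open>- M\<close> on unit vectors, which supplies the starting level for
  \<open>self_adjoint_approx_eigenvalue\<close>.\<close>

lemma self_adjoint_approx_eigenvalue_ex:
  assumes A: "A \<in> bounded_ops I I" and sa: "op_adj I I A = A"
    and q: "seminorm_on I q" and qA: "rel_bounded I q A" and null: "approx_null I q"
  shows "\<exists>a. approx_null I (\<lambda>x. q x + eigen_defect A (of_real a) x)"
proof -
  obtain K where K: "\<And>x. x \<in> ell2 I \<Longrightarrow> q (A x) \<le> K * q x"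
    using qA unfolding rel_bounded_def by blast
  obtain M where M: "\<And>x. x \<in> ell2 I \<Longrightarrow> ell2_norm (A x) \<le> M * ell2_norm x"
    using bounded_ops_bound[OF A] by blast
  have "- M \<le> Re (ell2_inner (A x) x)" if x: "x \<in> ell2 I" "ell2_norm x = 1" for x
  proof -
    have "\<bar>Re (ell2_inner (A x) x)\<bar> \<le> cmod (ell2_inner (A x) x)" by (rule abs_Re_le_cmod)
    also have "\<dots> \<le> ell2_norm (A x) * ell2_norm x"
      using x op_maps[OF A x(1)] by (intro ell2_cauchy_schwarz ell2_UNIV[of _ I])
    finally show ?thesis using M[OF x(1)] x(2) by simp
  qed
  then have "\<exists>x\<in>ell2 I. ell2_norm x = 1 \<and> q x \<le> e \<and> - M \<le> Re (ell2_inner (A x) x)" if "e > 0" for e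
    using null that unfolding approx_null_def by blast
  then show ?thesis using self_adjoint_approx_eigenvalue[OF A sa q K] by blast
qed

section \<open>Real and imaginary parts, and the step from one operator to a tuple\<close>

definition op_Re :: "'i set \<Rightarrow> ('i, 'i) oper \<Rightarrow> ('i, 'i) oper" where
  "op_Re I T = op_scale (1 / 2) (op_add T (op_adj I I T))"

definition op_Im :: "'i set \<Rightarrow> ('i, 'i) oper \<Rightarrow> ('i, 'i) oper" where
  "op_Im I T = op_scale (- \<i> / 2) (op_add T (op_scale (- 1) (op_adj I I T)))"

lemma
  assumes T: "T \<in> bounded_ops I I"
  shows op_Re_mem: "op_Re I T \<in> bounded_ops I I"
    and op_Im_mem: "op_Im I T \<in> bounded_ops I I"
    and op_Re_adj: "op_adj I I (op_Re I T) = op_Re I T"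
    and op_Im_adj: "op_adj I I (op_Im I T) = op_Im I T"
proof -
  note T' = op_adj_mem[OF T]
  show "op_Re I T \<in> bounded_ops I I" "op_Im I T \<in> bounded_ops I I"
    unfolding op_Re_def op_Im_def by (intro op_add_mem op_scale_mem T T')+
  show "op_adj I I (op_Re I T) = op_Re I T"
    unfolding op_Re_def op_adj_scale[OF op_add_mem[OF T T']] op_adj_add[OF T T'] op_adj_op_adj[OF T]
    by (simp add: op_add_def op_scale_def add.commute)
  show "op_adj I I (op_Im I T) = op_Im I T"
    unfolding op_Im_def op_adj_scale[OF op_add_mem[OF T op_scale_mem[OF T']]] op_adj_add[OF T op_scale_mem[OF T']]
      op_adj_scale[OF T'] op_adj_op_adj[OF T]
    by (simp add: op_add_def op_scale_def algebra_simps fun_eq_iff)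
qed

lemma op_Re_Im: "T x = (\<lambda>i. op_Re I T x i + \<i> * op_Im I T x i)"
  by (simp add: op_Re_def op_Im_def op_add_def op_scale_def field_simps fun_eq_iff)

lemma op_Re_Im_commute:
  assumes T: "T \<in> bounded_ops I I" and normal: "op_adj I I T \<circ> T = T \<circ> op_adj I I T"
  shows "op_Im I T \<circ> op_Re I T = op_Re I T \<circ> op_Im I T"
proof
  note T' = op_adj_mem[OF T]
  fix x
  have c: "op_adj I I T (T x) = T (op_adj I I T x)" using normal by (metis comp_apply)
  show "(op_Im I T \<circ> op_Re I T) x = (op_Re I T \<circ> op_Im I T) x"
  proof (cases "x \<in> ell2 I")
    case True
    define U where "U = op_add T (op_adj I I T)"
    define W where "W = op_add T (op_scale (- 1) (op_adj I I T))"
    have U: "U \<in> bounded_ops I I" and W: "W \<in> bounded_ops I I"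
      unfolding U_def W_def by (intro op_add_mem op_scale_mem T T')+
    note mem = True op_maps[OF T] op_maps[OF T']
    have "W (U x) = U (W x)"
      by (simp add: U_def W_def op_add_def op_scale_def mem bounded_ops_add[OF T] bounded_ops_add[OF T']
         bounded_ops_diff[OF T] bounded_ops_diff[OF T'] c)
    then show ?thesis
      unfolding op_Re_def op_Im_def U_def[symmetric] W_def[symmetric]
      by (simp only: o_def op_scale_def bounded_ops_scale[OF U op_maps[OF W True]]
          bounded_ops_scale[OF W op_maps[OF U True]] mult.left_commute)
  next
    case False
    then show ?thesis using bounded_ops_outside[OF op_Re_mem[OF T] False] bounded_ops_outside[OF op_Im_mem[OF T] False]
        bounded_ops_zero[OF op_Re_mem[OF T]] bounded_ops_zero[OF op_Im_mem[OF T]] by simp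
  qed
qed

lemma Re_Im_norm_bound:
  assumes T: "T \<in> bounded_ops I I" and x: "x \<in> ell2 I"
  shows "eigen_defect T (Complex b a) x \<le>
    eigen_defect (op_Re I T) (of_real b) x + eigen_defect (op_Im I T) (of_real a) x"
proof -
  have eq: "(\<lambda>i. T x i - Complex b a * x i) =
     (\<lambda>i. (op_Re I T x i - of_real b * x i) + \<i> * (op_Im I T x i - of_real a * x i))"
    by (subst op_Re_Im[of T x I]) (simp add: Complex_eq algebra_simps)
  have "eigen_defect T (Complex b a) x \<le> eigen_defect (op_Re I T) (of_real b) x +
     ell2_norm (\<lambda>i. \<i> * (op_Im I T x i - of_real a * x i))"
    unfolding eq
    by (intro ell2_norm_triangle ell2_UNIV[of _ I] ell2_diff ell2_scale op_maps[OF op_Re_mem[OF T]]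
        op_maps[OF op_Im_mem[OF T]] x)
  then show ?thesis by simp
qed

text \<open>The real part is treated first and its defect added to \<open>q\<close>; the imaginary
  part commutes with it by normality and therefore respects the enlarged seminorm.\<close>

lemma normal_approx_eigenvalue_ex:
  assumes T: "T \<in> bounded_ops I I" and normal: "op_adj I I T \<circ> T = T \<circ> op_adj I I T"
    and q: "seminorm_on I q" and qT: "rel_bounded I q T" "rel_bounded I q (op_adj I I T)" and null: "approx_null I q"
  shows "\<exists>c. approx_null I (\<lambda>x. q x + eigen_defect T c x)"
proof -
  note T' = op_adj_mem[OF T]
  have "rel_bounded I q (op_Re I T)" "rel_bounded I q (op_Im I T)"
    unfolding op_Re_def op_Im_def
    by (intro rel_bounded_op_scale rel_bounded_op_add op_add_mem op_scale_mem q qT T T')+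
  obtain b where b: "approx_null I (\<lambda>x. q x + eigen_defect (op_Re I T) (of_real b) x)"
    using self_adjoint_approx_eigenvalue_ex[OF op_Re_mem[OF T] op_Re_adj[OF T] q \<open>rel_bounded I q (op_Re I T)\<close> null] by blast
  have "rel_bounded I (\<lambda>x. q x + eigen_defect (op_Re I T) (of_real b) x) (op_Im I T)"
    by (intro rel_bounded_add q seminorm_on_op op_Re_mem T \<open>rel_bounded I q (op_Im I T)\<close> rel_bounded_commute op_Im_mem
        op_Re_Im_commute normal)
  then obtain a where a: "approx_null I (\<lambda>x. (q x + eigen_defect (op_Re I T) (of_real b) x)
       + eigen_defect (op_Im I T) (of_real a) x)"
    using self_adjoint_approx_eigenvalue_ex[OF op_Im_mem[OF T] op_Im_adj[OF T]
        seminorm_on_add[OF q seminorm_on_op[OF op_Re_mem[OF T]]] _ b] by blast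
  have "approx_null I (\<lambda>x. q x + eigen_defect T (Complex b a) x)"
    by (rule approx_null_mono[OF a]) (use Re_Im_norm_bound[OF T, of _ b a] in \<open>auto simp: add.assoc\<close>)
  then show ?thesis by blast
qed

text \<open>Operators are adjoined one at a time, with the defects of those already treated carried
  in the seminorm. The initial \<open>q\<close> can pin an eigenvalue prescribed in advance.\<close>

lemma normal_tuple_approx_null:
  fixes N :: "'d \<Rightarrow> ('i, 'i) oper"
  assumes N: "normal_tuple I N" and q: "seminorm_on I q"
    and qN: "\<And>k. rel_bounded I q (N k)" "\<And>k. rel_bounded I q (op_adj I I (N k))" and null: "approx_null I q"
    and "finite D"
  shows "\<exists>c. approx_null I (\<lambda>x. q x + (\<Sum>k\<in>D. eigen_defect (N k) (c k) x))"
  using \<open>finite D\<close>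
proof (induction D)
  case empty
  then show ?case using null by simp
next
  case (insert l D)
  have Nb: "N k \<in> bounded_ops I I" "op_adj I I (N k) \<circ> N k = N k \<circ> op_adj I I (N k)" "N k \<circ> N l = N l \<circ> N k" for k l
    using N unfolding normal_tuple_def by blast+
  obtain c where c: "approx_null I (\<lambda>x. q x + (\<Sum>k\<in>D. eigen_defect (N k) (c k) x))"
    using insert.IH by blast
  \<comment> \<open>The enlarged seminorm must be respected by every \<open>N l\<close>, including
    those still to come, and by the adjoints, since real and imaginary parts involve both.\<close>
  have *: "seminorm_on I (\<lambda>x. q x + (\<Sum>k\<in>D. eigen_defect (N k) (c k) x)) \<and>
    (\<forall>l. rel_bounded I (\<lambda>x. q x + (\<Sum>k\<in>D. eigen_defect (N k) (c k) x)) (N l) \<and>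
     rel_bounded I (\<lambda>x. q x + (\<Sum>k\<in>D. eigen_defect (N k) (c k) x)) (op_adj I I (N l)))"
    using \<open>finite D\<close>
  proof (induction D)
    case empty
    then show ?case using q qN by simp
  next
    case (insert m D)
    define Q where "Q = (\<lambda>x. q x + (\<Sum>k\<in>D. eigen_defect (N k) (c k) x))"
    define p where "p = (eigen_defect (N m) (c m))"
    have eq: "(\<lambda>x. q x + (\<Sum>k\<in>insert m D. eigen_defect (N k) (c k) x)) = (\<lambda>x. Q x + p x)"
      using insert.hyps by (simp add: Q_def p_def algebra_simps)
    have Q: "seminorm_on I Q" "rel_bounded I Q (N l)" "rel_bounded I Q (op_adj I I (N l))" for l
      using insert.IH unfolding Q_def by blast+
    have p: "seminorm_on I p" "rel_bounded I p (N l)" "rel_bounded I p (op_adj I I (N l))" for l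
      unfolding p_def
      by (intro seminorm_on_op rel_bounded_commute rel_bounded_commute_adj Nb)+
    show ?case unfolding eq
      by (intro conjI allI seminorm_on_add rel_bounded_add Q p)
  qed
  define Q where "Q = (\<lambda>x. q x + (\<Sum>k\<in>D. eigen_defect (N k) (c k) x))"
  have Q: "seminorm_on I Q" "rel_bounded I Q (N l)" "rel_bounded I Q (op_adj I I (N l))" "approx_null I Q"
    using * c unfolding Q_def by blast+
  obtain a where "approx_null I (\<lambda>x. Q x + eigen_defect (N l) a x)"
    using normal_approx_eigenvalue_ex[OF Nb(1,2) Q] by blast
  also have "(\<lambda>x. Q x + eigen_defect (N l) a x) =
    (\<lambda>x. q x + (\<Sum>k\<in>insert l D. eigen_defect (N k) ((c(l := a)) k) x))"
  proof
    fix x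
    have "(\<Sum>k\<in>D. eigen_defect (N k) ((c(l := a)) k) x) = (\<Sum>k\<in>D. eigen_defect (N k) (c k) x)"
      using insert.hyps by (intro sum.cong) auto
    then show "Q x + eigen_defect (N l) a x =
      q x + (\<Sum>k\<in>insert l D. eigen_defect (N k) ((c(l := a)) k) x)"
      using insert.hyps by (simp add: Q_def)
  qed
  finally show ?case by blast
qed

text \<open>Because \<open>q\<close> still tends to 0 along the sequence, an eigenvalue equation
  encoded in \<open>q\<close> constrains the spectral point obtained.\<close>

lemma joint_spectrum_approx:
  fixes N :: "'d::finite \<Rightarrow> ('i, 'i) oper"
  assumes N: "normal_tuple I N" and q: "seminorm_on I q"
    and qN: "\<And>k. rel_bounded I q (N k)" "\<And>k. rel_bounded I q (op_adj I I (N k))" and null: "approx_null I q"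
  obtains x c where "\<And>n. x n \<in> ell2 I" "\<And>n. ell2_norm (x n) = 1" "(\<lambda>n. q (x n)) \<longlonglongrightarrow> 0"
    "\<And>k. approx_eigen x (N k) (c k)" "(\<chi> k. c k) \<in> joint_spectrum I N"
proof -
  obtain c where c: "approx_null I (\<lambda>x. q x + (\<Sum>k\<in>UNIV. eigen_defect (N k) (c k) x))"
    using normal_tuple_approx_null[OF N q qN null, of UNIV] by auto
  have "\<forall>n. \<exists>x. x \<in> ell2 I \<and> ell2_norm x = 1 \<and>
      q x + (\<Sum>k\<in>UNIV. eigen_defect (N k) (c k) x) \<le> 1 / real (Suc n)"
    using c unfolding approx_null_def by (auto simp: Bex_def)
  from choice[OF this] obtain x where x: "\<And>n. x n \<in> ell2 I" "\<And>n. ell2_norm (x n) = 1"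
    and le: "\<And>n. q (x n) + (\<Sum>k\<in>UNIV. eigen_defect (N k) (c k) (x n)) \<le> 1 / real (Suc n)"
    by blast
  have lim: "(\<lambda>n. 1 / real (Suc n)) \<longlonglongrightarrow> 0" using LIMSEQ_inverse_real_of_nat by (simp add: inverse_eq_divide)
  have q0: "0 \<le> q (x n)" for n by (rule seminorm_on_nonneg[OF q x(1)])
  have "q (x n) \<le> 1 / real (Suc n)" for n
    using le[of n] sum_nonneg[of UNIV "\<lambda>k. eigen_defect (N k) (c k) (x n)"] by simp
  then have 1: "(\<lambda>n. q (x n)) \<longlonglongrightarrow> 0"
    using q0 by (intro tendsto_sandwich[OF _ _ tendsto_const lim]) auto
  have "eigen_defect (N k) (c k) (x n) \<le> 1 / real (Suc n)" for n k
    using le[of n] q0[of n] member_le_sum[of k UNIV "\<lambda>k. eigen_defect (N k) (c k) (x n)"] by simp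
  then have 2: "approx_eigen x (N k) (c k)" for k
    unfolding approx_eigen_def by (intro tendsto_sandwich[OF _ _ tendsto_const lim]) auto
  show ?thesis using that[OF x 1 2 approx_eigen_character[OF N x 2]] .
qed

text \<open>Testing the vanishing form at \<open>x + A x\<close> leaves only the cross terms, which
  add up to \<open>2 |A x|^2\<close>.\<close>

lemma self_adjoint_eq_zero:
  assumes A: "A \<in> bounded_ops I I" and sa: "op_adj I I A = A"
    and zero: "\<And>x. x \<in> ell2 I \<Longrightarrow> Re (ell2_inner (A x) x) = 0" and x: "x \<in> ell2 I"
  shows "A x = (\<lambda>_. 0)"
proof -
  note mem = op_maps[OF A]
  have y: "A x \<in> ell2 I" using mem x by simp
  have i: "ell2_inner (A (A x)) x = ell2_inner (A x) (A x)"
    using op_adj_inner[OF A y x] by (simp add: sa)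
  have "Re (ell2_inner (A (\<lambda>i. x i + A x i)) (\<lambda>i. x i + A x i)) = 0"
    using x y by (intro zero) simp
  then have "Re (ell2_inner (A x) (A x)) = 0"
    using zero[OF x] zero[OF y] x y i
    by (simp add: bounded_ops_add[OF A x y] mem ell2_UNIV[of _ I])
  then show ?thesis using ell2_norm_zero_iff[OF ell2_UNIV[OF y]] by (simp add: ell2_inner_self)
qed

lemma approx_null_real_approx_eigenvalue:
  assumes A: "A \<in> bounded_ops I I" and sa: "op_adj I I A = A"
    and x: "x \<in> ell2 I" and pos: "Re (ell2_inner (A x) x) > 0"
  shows "\<exists>a>0. approx_null I (eigen_defect A (of_real a))"
proof -
  have "x \<noteq> (\<lambda>_. 0)" using pos by auto
  then have n: "ell2_norm x > 0"
    using ell2_norm_zero_iff[OF ell2_UNIV[OF x]] ell2_norm_nonneg[of x] by linarith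
  define m where "m = inverse (ell2_norm x)"
  have m: "m > 0" "m * ell2_norm x = 1" using n by (simp_all add: m_def)
  define u where "u = (\<lambda>i. of_real m * x i)"
  have u: "u \<in> ell2 I" "ell2_norm u = 1" using x m by (simp_all add: u_def)
  have "Re (ell2_inner (A u) u) = m * (m * Re (ell2_inner (A x) x))"
    unfolding u_def bounded_ops_scale[OF A x] ell2_inner_scale_left ell2_inner_scale_right complex_cnj_complex_of_real
    by simp
  then have r: "Re (ell2_inner (A u) u) > 0" using pos m by simp
  obtain a where "a \<ge> Re (ell2_inner (A u) u)" "approx_null I (\<lambda>x. 0 + eigen_defect A (of_real a) x)"
    using self_adjoint_approx_eigenvalue[OF A sa seminorm_on_zero, of 0 "Re (ell2_inner (A u) u)"] u by force
  then show ?thesis using r by (intro exI[of _ a]) auto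
qed

text \<open>If \<open>N k\<close> were not self-adjoint, its imaginary part would have an
  approximate eigenvalue \<open>a \<noteq> 0\<close>. Joined with some real \<open>b\<close> for the
  real part, this makes \<open>b + i a\<close> an approximate eigenvalue of \<open>N k\<close>;
  pinning it in a seminorm yields a spectral point with a nonreal coordinate.\<close>

lemma real_joint_spectrum_self_adjoint:
  fixes N :: "'d::finite \<Rightarrow> ('i, 'i) oper"
  assumes N: "normal_tuple I N" and spec: "joint_spectrum I N \<subseteq> real_points L"
  shows "op_adj I I (N k) = N k"
proof (rule ccontr)
  assume neq: "op_adj I I (N k) \<noteq> N k"
  have Nb: "N k \<in> bounded_ops I I" "op_adj I I (N k) \<circ> N k = N k \<circ> op_adj I I (N k)" "N k \<circ> N l = N l \<circ> N k" for k l
    using N unfolding normal_tuple_def by blast+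
  define A where "A = op_Im I (N k)"
  have A: "A \<in> bounded_ops I I" "op_adj I I A = A" unfolding A_def by (intro op_Im_mem op_Im_adj Nb)+
  have "\<exists>x\<in>ell2 I. Re (ell2_inner (A x) x) \<noteq> 0"
  proof (rule ccontr)
    assume "\<not> ?thesis"
    then have A0: "A x = (\<lambda>_. 0)" if "x \<in> ell2 I" for x using self_adjoint_eq_zero[OF A] that by blast
    have "op_adj I I (N k) x = N k x" for x
    proof (cases "x \<in> ell2 I")
      case True
      from A0[OF True] show ?thesis
        by (simp add: A_def op_Im_def op_scale_def op_add_def fun_eq_iff)
    qed (simp add: bounded_ops_outside[OF Nb(1)] bounded_ops_outside[OF op_adj_mem[OF Nb(1)]])
    then show False using neq by blast
  qed
  then obtain x where x: "x \<in> ell2 I" "Re (ell2_inner (A x) x) \<noteq> 0" by blast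
  have "\<exists>a. a \<noteq> 0 \<and> approx_null I (eigen_defect A (of_real a))"
  proof (cases "Re (ell2_inner (A x) x) > 0")
    case True
    then obtain a where "a > 0" "approx_null I (eigen_defect A (of_real a))"
      using approx_null_real_approx_eigenvalue[OF A x(1)] by blast
    then show ?thesis by (intro exI[of _ a]) simp
  next
    case False
    \<comment> \<open>A positive value of a form is what yields an eigenvalue of known sign, so a
      negative value is handled through \<open>- A\<close>.\<close>
    define B where "B = op_scale (-1) A"
    have "B \<in> bounded_ops I I" "op_adj I I B = B"
      unfolding B_def by (simp_all add: op_scale_mem A op_adj_scale[OF A(1)])
    moreover have "Re (ell2_inner (B x) x) > 0" using False x(2) by (simp add: B_def op_scale_def)
    ultimately obtain a where a: "a > 0" "approx_null I (eigen_defect B (of_real a))"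
      using approx_null_real_approx_eigenvalue[of B I x] x(1) by blast
    have "eigen_defect A (of_real (- a)) x = eigen_defect B (of_real a) x" for x
      using ell2_norm_uminus[of "\<lambda>i. A x i - of_real (- a) * x i"] by (simp add: B_def op_scale_def algebra_simps)
    then show ?thesis using a by (intro exI[of _ "- a"]) simp
  qed
  then obtain a where a: "a \<noteq> 0" "approx_null I (eigen_defect A (of_real a))" by blast
  define B where "B = op_Re I (N k)"
  have B: "B \<in> bounded_ops I I" "op_adj I I B = B" unfolding B_def by (intro op_Re_mem op_Re_adj Nb)+
  have BA: "B \<circ> A = A \<circ> B" unfolding A_def B_def by (rule op_Re_Im_commute[symmetric]) (rule Nb)+
  obtain b where b: "approx_null I (\<lambda>x. eigen_defect A (of_real a) x + eigen_defect B (of_real b) x)"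
    using self_adjoint_approx_eigenvalue_ex[OF B seminorm_on_op[OF A(1)] rel_bounded_commute[OF B(1) A(1) BA] a(2)] by blast
  define q where "q = (eigen_defect (N k) (Complex b a))"
  have null: "approx_null I q"
    unfolding q_def by (rule approx_null_mono[OF b])
      (use Re_Im_norm_bound[OF Nb(1), of _ k b a] in \<open>auto simp: A_def B_def add.commute\<close>)
  have q: "seminorm_on I q" "rel_bounded I q (N l)" "rel_bounded I q (op_adj I I (N l))" for l
    unfolding q_def by (intro seminorm_on_op rel_bounded_commute rel_bounded_commute_adj Nb)+
  obtain y c where y: "\<And>n. y n \<in> ell2 I" "\<And>n. ell2_norm (y n) = 1" "(\<lambda>n. q (y n)) \<longlonglongrightarrow> 0"
    "\<And>k. approx_eigen y (N k) (c k)" "(\<chi> k. c k) \<in> joint_spectrum I N"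
    using joint_spectrum_approx[OF N q null] by blast
  have "approx_eigen y (N k) (Complex b a)" using y(3) by (simp add: approx_eigen_def q_def)
  then have "c k = Complex b a" using approx_eigen_unique[of y I, OF y(1,2) Nb(1) y(4)] by blast
  moreover have "Im (c k) = 0" using y(5) spec by (auto simp: real_points_def vec_eq_iff subset_iff)
  ultimately show False using a(1) by simp
qed

section \<open>Finite sums of operators and quadratic inequalities on the joint spectrum\<close>

definition op_sum :: "'k set \<Rightarrow> ('k \<Rightarrow> ('i, 'j) oper) \<Rightarrow> ('i, 'j) oper" where
  "op_sum D f = (\<lambda>x j. \<Sum>k\<in>D. f k x j)"

lemma op_sum_insert: "finite D \<Longrightarrow> l \<notin> D \<Longrightarrow> op_sum (insert l D) f = op_add (f l) (op_sum D f)"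
  by (simp add: op_sum_def op_add_def)

lemma op_sum_empty_mem: "op_sum {} f \<in> bounded_ops I J"
  by (rule bounded_opsI[where C=0]) (auto simp: op_sum_def)

lemma op_sum_mem:
  assumes "finite D" "\<And>k. f k \<in> bounded_ops I J"
  shows "op_sum D f \<in> bounded_ops I J"
  using assms(1) by (induction D) (simp_all add: op_sum_empty_mem op_sum_insert op_add_mem assms(2))

lemma op_adj_sum:
  assumes "finite D" "\<And>k. f k \<in> bounded_ops I J"
  shows "op_adj I J (op_sum D f) = op_sum D (\<lambda>k. op_adj I J (f k))"
  using assms(1)
proof (induction D)
  case empty
  show ?case by (rule op_adj_eqI[OF op_sum_empty_mem]) (simp add: op_sum_def)
next
  case (insert l D)
  then show ?case by (simp add: op_sum_insert op_adj_add[OF assms(2) op_sum_mem[OF _ assms(2)]])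
qed

lemma approx_eigen_sum:
  assumes x: "\<And>n. x n \<in> ell2 I" and "finite D" and f: "\<And>k. f k \<in> bounded_ops I I"
    and ev: "\<And>k. approx_eigen x (f k) (c k)"
  shows "approx_eigen x (op_sum D f) (\<Sum>k\<in>D. c k)"
  using \<open>finite D\<close>
proof (induction D)
  case empty
  show ?case by (simp add: approx_eigen_def op_sum_def)
next
  case (insert l D)
  then show ?case
    by (simp add: op_sum_insert approx_eigen_add[OF x f op_sum_mem[OF _ f] ev])
qed

text \<open>\<open>A\<close> arises from \<open>|v|^2 - p \<bullet> v - \<rho>\<close> by
  substituting \<open>N\<close> for \<open>v\<close>. A violation gives \<open>A\<close> a positive
  approximate eigenvalue; as \<open>A\<close> commutes with the tuple, this eigenvalue can be pinned
  while the \<open>N k\<close> are diagonalised, and it is then the value of the polynomial at a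
  point of \<open>L\<close>.\<close>

lemma joint_spectrum_quadratic_bound:
  fixes N :: "'d::finite \<Rightarrow> ('i, 'i) oper"
  assumes N: "normal_tuple I N" and spec: "joint_spectrum I N \<subseteq> real_points L"
    and L: "\<And>v. v \<in> L \<Longrightarrow> (norm v)\<^sup>2 \<le> \<rho> + p \<bullet> v"
    and x: "x \<in> ell2 I"
  shows "(\<Sum>k\<in>UNIV. (ell2_norm (N k x))\<^sup>2) \<le> \<rho> * (ell2_norm x)\<^sup>2 + (\<Sum>k\<in>UNIV. vec_nth p k * Re (ell2_inner (N k x) x))"
proof (rule ccontr)
  assume contra: "\<not> ?thesis"
  have Nb: "N k \<in> bounded_ops I I" "N k \<circ> N l = N l \<circ> N k" for k l
    using N unfolding normal_tuple_def by blast+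
  have Nsa: "op_adj I I (N k) = N k" for k by (rule real_joint_spectrum_self_adjoint[OF N spec])
  define T where "T k = op_add (N k \<circ> N k) (op_scale (- of_real (vec_nth p k)) (N k))" for k
  have T: "T k \<in> bounded_ops I I" for k
    unfolding T_def by (intro op_add_mem op_comp_mem[of _ I I] op_scale_mem Nb)
  have Tsa: "op_adj I I (T k) = T k" for k
    unfolding T_def op_adj_add[OF op_comp_mem[OF Nb(1) Nb(1)] op_scale_mem[OF Nb(1)]] op_adj_comp[OF Nb(1) Nb(1)]
      op_adj_scale[OF Nb(1)] Nsa by simp
  define S where "S = op_sum UNIV T"
  have S: "S \<in> bounded_ops I I" unfolding S_def by (intro op_sum_mem T) simp
  have Ssa: "op_adj I I S = S" unfolding S_def by (simp add: op_adj_sum[OF _ T] Tsa)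
  define A where "A = op_add S (op_scale (- of_real \<rho>) (op_id I))"
  have A: "A \<in> bounded_ops I I" unfolding A_def by (intro op_add_mem S op_scale_mem op_id_mem)
  have Asa: "op_adj I I A = A"
    unfolding A_def op_adj_add[OF S op_scale_mem[OF op_id_mem]] op_adj_scale[OF op_id_mem] op_adj_id Ssa by simp
  have Ax: "A y = (\<lambda>i. (\<Sum>k\<in>UNIV. N k (N k y) i - of_real (vec_nth p k) * N k y i) - of_real \<rho> * y i)"
    if "y \<in> ell2 I" for y
    using that by (simp add: A_def S_def T_def op_add_def op_scale_def op_id_def op_sum_def)
  note mem [simp] = op_maps[OF Nb(1)] ell2_UNIV[of _ I]
  have comm: "N l \<circ> A = A \<circ> N l" for l
  proof
    fix y
    show "(N l \<circ> A) y = (A \<circ> N l) y"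
    proof (cases "y \<in> ell2 I")
      case True
      have c: "N l (N k y) = N k (N l y)" for k y using Nb(2)[of l k] by (metis comp_apply)
      have "N l (A y) = (\<lambda>i. N l (\<lambda>i. \<Sum>k\<in>UNIV. N k (N k y) i - of_real (vec_nth p k) * N k y i) i - of_real \<rho> * N l y i)"
        unfolding Ax[OF True] using True
        by (simp add: bounded_ops_diff[OF Nb(1)] bounded_ops_scale[OF Nb(1)])
      also have "N l (\<lambda>i. \<Sum>k\<in>UNIV. N k (N k y) i - of_real (vec_nth p k) * N k y i)
        = (\<lambda>j. \<Sum>k\<in>UNIV. N k (N k (N l y)) j - of_real (vec_nth p k) * N k (N l y) j)"
        using True
        by (subst bounded_ops_sum[OF Nb(1)]) (simp_all add: bounded_ops_diff[OF Nb(1)] bounded_ops_scale[OF Nb(1)] c)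
      also have "(\<lambda>i. \<dots> i - of_real \<rho> * N l y i) = A (N l y)"
        using True by (simp add: Ax)
      finally show ?thesis by simp
    qed (simp add: bounded_ops_outside[OF Nb(1)] bounded_ops_outside[OF A] bounded_ops_zero[OF Nb(1)] bounded_ops_zero[OF A])
  qed
  have sa: "ell2_inner (N k y) z = ell2_inner y (N k z)" if "y \<in> ell2 I" "z \<in> ell2 I" for k y z
    using op_adj_inner[OF Nb(1) that] by (simp add: Nsa)
  have "ell2_inner (A x) x = (\<Sum>k\<in>UNIV. ell2_inner (N k x) (N k x) - of_real (vec_nth p k) * ell2_inner (N k x) x)
      - of_real \<rho> * ell2_inner x x"
    unfolding Ax[OF x] using x by (simp add: ell2_inner_sum_left sa)
  then have "Re (ell2_inner (A x) x) > 0"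
    using contra by (simp add: ell2_inner_self sum_subtractf)
  then obtain a where a: "a > 0" "approx_null I (eigen_defect A (of_real a))"
    using approx_null_real_approx_eigenvalue[OF A Asa x] by blast
  define q where "q = (eigen_defect A (of_real a))"
  have q: "seminorm_on I q" "rel_bounded I q (N k)" "rel_bounded I q (op_adj I I (N k))" "approx_null I q" for k
    unfolding q_def Nsa by (intro seminorm_on_op A rel_bounded_commute Nb comm a)+
  obtain y c where y: "\<And>n. y n \<in> ell2 I" "\<And>n. ell2_norm (y n) = 1" "(\<lambda>n. q (y n)) \<longlonglongrightarrow> 0"
    "\<And>k. approx_eigen y (N k) (c k)" "(\<chi> k. c k) \<in> joint_spectrum I N"
    using joint_spectrum_approx[OF N q] by blast
  obtain v where v: "v \<in> L" "\<And>k. c k = of_real (vec_nth v k)"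
    using y(5) spec by (auto simp: real_points_def vec_eq_iff subset_iff)
  have "approx_eigen y (T k) (c k * c k + (- of_real (vec_nth p k)) * c k)" for k
    unfolding T_def
    by (intro approx_eigen_add[of y I, OF y(1)] approx_eigen_comp[of y I, OF y(1)] approx_eigen_scale op_comp_mem[of _ I I] op_scale_mem Nb y(4))
  then have "approx_eigen y A ((\<Sum>k\<in>UNIV. c k * c k + (- of_real (vec_nth p k)) * c k) + (- of_real \<rho>) * 1)"
    unfolding A_def S_def
    by (intro approx_eigen_add[of y I, OF y(1)] approx_eigen_sum[of y I, OF y(1)] approx_eigen_scale approx_eigen_id[of y I, OF y(1)] op_scale_mem
        op_sum_mem op_id_mem T) simp_all
  moreover have "approx_eigen y A (of_real a)" using y(3) by (simp add: approx_eigen_def q_def)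
  ultimately have "of_real a = (\<Sum>k\<in>UNIV. c k * c k + (- of_real (vec_nth p k)) * c k) + (- of_real \<rho>) * 1"
    using approx_eigen_unique[of y I, OF y(1,2) A] by blast
  also have "\<dots> = of_real ((norm v)\<^sup>2 - p \<bullet> v - \<rho>)"
    by (simp add: v(2) power2_norm_eq_inner inner_vec_def sum_subtractf sum_negf)
  finally have "a = (norm v)\<^sup>2 - p \<bullet> v - \<rho>" by (simp only: of_real_eq_iff)
  then show False using L[OF v(1)] a(1) by simp
qed

section \<open>Barycentric coordinates and positive semidefinite kernels\<close>

text \<open>Subtracting a base vertex \<open>w\<close> turns affine into linear independence, so a
  linear functional may be prescribed on the differences; with \<open>w \<noteq> v\<close>, the
  value 0 at \<open>w\<close> is automatic.\<close>

lemma affine_coordinate_exists: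
  fixes C :: "'a::euclidean_space set"
  assumes ind: "\<not> affine_dependent C" and v: "v \<in> C" and w: "w \<in> C" "w \<noteq> v"
  shows "\<exists>\<alpha> a. \<forall>x\<in>C. \<alpha> + a \<bullet> x = (if x = v then 1 else 0 :: real)"
proof -
  have "independent ((\<lambda>x. - w + x) ` (C - {w}))"
    using ind affine_dependent_iff_dependent2[OF w(1)] by simp
  from linear_independent_extend[OF this, of "\<lambda>y. if y = - w + v then 1 else 0 :: real"]
  obtain g :: "'a \<Rightarrow> real" where g: "linear g"
    "\<And>x. x \<in> C \<Longrightarrow> x \<noteq> w \<Longrightarrow> g (- w + x) = (if x = v then 1 else 0)"
    by auto
  define a where "a = adjoint g 1"
  have ga: "a \<bullet> x = g x" for x
    using adjoint_works[OF g(1), of x 1] by (simp add: a_def inner_commute)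
  have "- (a \<bullet> w) + a \<bullet> x = (if x = v then 1 else 0)" if "x \<in> C" for x
  proof (cases "x = w")
    case False
    have "- (a \<bullet> w) + a \<bullet> x = a \<bullet> (- w + x)" by (simp add: inner_diff_right)
    then show ?thesis using g(2)[OF that False] by (simp add: ga)
  qed (use w in simp)
  then show ?thesis by blast
qed

text \<open>With this many vertices the affine hull is the whole space, so the last two identities
  hold at every point. They are thus identities between coefficients, which is how they carry over
  to matrices.\<close>

lemma barycentric_coordinates:
  fixes C :: "'a::euclidean_space set"
  assumes ind: "\<not> affine_dependent C" and card: "card C = Suc DIM('a)"
  obtains \<alpha> :: "'a \<Rightarrow> real" and a :: "'a \<Rightarrow> 'a"
  where "\<And>v w. v \<in> C \<Longrightarrow> w \<in> C \<Longrightarrow> \<alpha> v + a v \<bullet> w = (if w = v then 1 else 0)"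
    and "\<And>x. (\<Sum>v\<in>C. \<alpha> v + a v \<bullet> x) = 1"
    and "\<And>x. (\<Sum>v\<in>C. (\<alpha> v + a v \<bullet> x) *\<^sub>R v) = x"
proof -
  have fin: "finite C" using aff_independent_finite[OF ind] .
  have "\<exists>\<alpha> a. \<forall>x\<in>C. \<alpha> + a \<bullet> x = (if x = v then 1 else 0 :: real)" if v: "v \<in> C" for v
  proof -
    have "C \<noteq> {v}" using card by auto
    then obtain w where "w \<in> C" "w \<noteq> v" using v by blast
    then show ?thesis using affine_coordinate_exists[OF ind v] by blast
  qed
  then have "\<exists>f. \<forall>v\<in>C. \<forall>x\<in>C. fst (f v) + snd (f v) \<bullet> x = (if x = v then 1 else 0 :: real)"
    by (intro bchoice) (metis fst_conv snd_conv)
  then obtain f :: "'a \<Rightarrow> real \<times> 'a" where f: "\<And>v x. v \<in> C \<Longrightarrow> x \<in> C \<Longrightarrow> fst (f v) + snd (f v) \<bullet> x = (if x = v then 1 else 0)"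
    by blast
  have span: "affine hull C = UNIV" using affine_independent_span_eq[OF ind card] .
  have coords: "\<exists>u. sum u C = 1 \<and> (\<Sum>v\<in>C. u v *\<^sub>R v) = x \<and> (\<forall>w\<in>C. fst (f w) + snd (f w) \<bullet> x = u w)" for x
  proof -
    have "x \<in> affine hull C" using span by simp
    then obtain u where u: "sum u C = 1" "(\<Sum>v\<in>C. u v *\<^sub>R v) = x"
      by (auto simp: affine_hull_finite[OF fin])
    have "fst (f w) + snd (f w) \<bullet> x = u w" if "w \<in> C" for w
    proof -
      have "fst (f w) + snd (f w) \<bullet> x = (\<Sum>v\<in>C. u v * fst (f w)) + (\<Sum>v\<in>C. u v * (snd (f w) \<bullet> v))"
        unfolding u(2)[symmetric] by (simp add: inner_sum_right u(1) flip: sum_distrib_right)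
      also have "\<dots> = (\<Sum>v\<in>C. u v * (fst (f w) + snd (f w) \<bullet> v))"
        by (simp add: sum.distrib distrib_left)
      also have "\<dots> = (\<Sum>v\<in>C. if v = w then u v else 0)"
        by (intro sum.cong) (auto simp: f that)
      finally show ?thesis using that fin by simp
    qed
    then show ?thesis using u by blast
  qed
  show ?thesis
  proof (rule that[of "\<lambda>v. fst (f v)" "\<lambda>v. snd (f v)"])
    show "(\<Sum>v\<in>C. fst (f v) + snd (f v) \<bullet> x) = 1" for x
      using coords[of x] by (metis (no_types, lifting) sum.cong)
    show "(\<Sum>v\<in>C. (fst (f v) + snd (f v) \<bullet> x) *\<^sub>R v) = x" for x
      using coords[of x] by (metis (no_types, lifting) sum.cong)
  qed (rule f)
qed

section \<open>Cholesky factorisation of positive semidefinite kernels\<close>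

definition herm_form :: "'k set \<Rightarrow> ('k \<Rightarrow> 'k \<Rightarrow> complex) \<Rightarrow> ('k \<Rightarrow> complex) \<Rightarrow> complex" where
  "herm_form S h x = (\<Sum>i\<in>S. \<Sum>j\<in>S. cnj (x i) * h i j * x j)"

lemma herm_form_insert:
  assumes "finite S" "s \<notin> S" and herm: "\<And>i j. h j i = cnj (h i j)"
  shows "herm_form (insert s S) h x = cnj (x s) * h s s * x s + cnj (x s) * (\<Sum>j\<in>S. h s j * x j)
     + cnj (cnj (x s) * (\<Sum>j\<in>S. h s j * x j)) + herm_form S h x"
proof -
  have "(\<Sum>i\<in>S. cnj (x i) * h i s * x s) = cnj (cnj (x s) * (\<Sum>j\<in>S. h s j * x j))"
    unfolding complex_cnj_mult cnj_sum sum_distrib_left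
    by (intro sum.cong) (simp_all add: herm[of _ s] mult_ac)
  moreover have "(\<Sum>j\<in>S. cnj (x s) * h s j * x j) = cnj (x s) * (\<Sum>j\<in>S. h s j * x j)"
    by (simp add: sum_distrib_left mult_ac)
  ultimately show ?thesis
    using assms(1,2) by (simp add: herm_form_def sum.distrib)
qed

lemma herm_form_cong:
  "(\<And>i. i \<in> S \<Longrightarrow> x i = y i) \<Longrightarrow> herm_form S h x = herm_form S h y"
  by (simp add: herm_form_def)

text \<open>Induction on the index set: the pivot \<open>s\<close> contributes one row of
  \<open>R\<close>, and the Schur complement on the remaining indices is again positive
  semidefinite. A zero pivot forces its whole row to vanish.\<close>

lemma psd_factorization:
  assumes "finite S" and "\<And>i j. h j i = cnj (h i j)" and "\<And>x. 0 \<le> Re (herm_form S h x)"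
  shows "\<exists>R. \<forall>i\<in>S. \<forall>j\<in>S. h i j = (\<Sum>k\<in>S. cnj (R k i) * R k j)"
  using assms
proof (induction S arbitrary: h)
  case empty
  show ?case by simp
next
  case (insert s S)
  note herm = insert.prems(1)
  have split: "Re (herm_form (insert s S) h x) = Re (h s s) * (cmod (x s))\<^sup>2
     + 2 * Re (cnj (x s) * (\<Sum>j\<in>S. h s j * x j)) + Re (herm_form S h x)" for x
  proof -
    have "Re (cnj (x s) * h s s * x s) = Re (h s s * of_real ((cmod (x s))\<^sup>2))"
      unfolding complex_norm_square by (simp only: mult_ac)
    also have "\<dots> = Re (h s s) * (cmod (x s))\<^sup>2" by simp
    finally have e: "Re (cnj (x s) * h s s * x s) = Re (h s s) * (cmod (x s))\<^sup>2" .
    have "Re (A + z + cnj z + B) = Re A + 2 * Re z + Re B" for A z B by simp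
    then show ?thesis unfolding herm_form_insert[OF insert.hyps(1,2) herm] e[symmetric] by blast
  qed
  have im: "Im (h s s) = 0" using arg_cong[OF herm[of s s], of Im] by simp
  have nonneg: "0 \<le> Re (h s s)"
  proof -
    have "Re (herm_form (insert s S) h (\<lambda>i. if i = s then 1 else 0)) = Re (h s s)"
    proof -
      have "(\<Sum>j\<in>S. h s j * (if j = s then 1 else 0)) = 0" using insert.hyps by (intro sum.neutral) auto
      moreover have "herm_form S h (\<lambda>i. if i = s then 1 else 0) = 0"
        unfolding herm_form_def using insert.hyps by (intro sum.neutral) auto
      ultimately show ?thesis unfolding split by simp
    qed
    then show ?thesis using insert.prems(2)[of "\<lambda>i. if i = s then 1 else 0"] by simp
  qed
  show ?case
  proof (cases "Re (h s s) = 0")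
    case True
    have hz: "h s j = 0" if j: "j \<in> S" for j
    proof (rule ccontr)
      assume nz: "h s j \<noteq> 0"
      define b where "b = h s j"
      \<comment> \<open>With \<open>x s = - l b\<close> and \<open>x j = 1\<close>, the real part of
        the form is \<open>Re (h j j) - 2 (|Re (h j j)| + 1) < 0\<close>.\<close>
      define l where "l = (\<bar>Re (h j j)\<bar> + 1) / (cmod b)\<^sup>2"
      define x where "x i = (if i = s then - of_real l * b else if i = j then 1 else 0)" for i
      have js: "j \<noteq> s" using j insert.hyps by blast
      have "(\<Sum>i\<in>S. h s i * x i) = (\<Sum>i\<in>S. if i = j then b else 0)"
        using insert.hyps by (intro sum.cong) (auto simp: x_def b_def)
      then have 1: "(\<Sum>i\<in>S. h s i * x i) = b" using j insert.hyps by simp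
      have "herm_form S h x = (\<Sum>i\<in>S. \<Sum>k\<in>S. if k = j then (if i = j then h j j else 0) else 0)"
        unfolding herm_form_def using insert.hyps by (intro sum.cong) (auto simp: x_def)
      then have 2: "herm_form S h x = h j j" using j insert.hyps by simp
      have "cnj (x s) * b = - (of_real l * (b * cnj b))" by (simp add: x_def)
      also have "\<dots> = of_real (- l * (cmod b)\<^sup>2)"
        by (simp only: complex_norm_square of_real_minus of_real_mult mult_minus_left)
      finally have "Re (cnj (x s) * b) = - l * (cmod b)\<^sup>2" by simp
      also have "\<dots> = - (\<bar>Re (h j j)\<bar> + 1)" using nz by (simp add: l_def b_def)
      finally have "Re (herm_form (insert s S) h x) < 0"
        unfolding split 1 2 using True by simp
      then show False using insert.prems(2)[of x] by simp
    qed
    have nn: "0 \<le> Re (herm_form S h x)" for x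
    proof -
      have "(\<Sum>j\<in>S. h s j * x j) = 0" by (simp add: hz)
      then show ?thesis using insert.prems(2)[of x] unfolding split by (simp add: True)
    qed
    obtain R where R: "\<And>i j. i \<in> S \<Longrightarrow> j \<in> S \<Longrightarrow> h i j = (\<Sum>k\<in>S. cnj (R k i) * R k j)"
      using insert.IH[OF herm nn] by blast
    have hss: "h s s = 0" using True im by (simp add: complex_eq_iff)
    define R' where "R' k i = (if k = s \<or> i = s then 0 else R k i)" for k i
    have "h i j = (\<Sum>k\<in>insert s S. cnj (R' k i) * R' k j)" if i: "i \<in> insert s S" and j: "j \<in> insert s S" for i j
    proof -
      have sum: "(\<Sum>k\<in>insert s S. cnj (R' k i) * R' k j) = (\<Sum>k\<in>S. cnj (R' k i) * R' k j)"
        using insert.hyps by (simp add: R'_def)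
      show ?thesis
      proof (cases "i = s \<or> j = s")
        case True
        have "h s k = 0" if "k \<in> insert s S" for k using that hz hss by blast
        note hs = this
        have "h i j = 0"
        proof (cases "i = s")
          case True
          then show ?thesis using hs[OF j] by blast
        next
          case False
          then have "h i j = cnj (h s i)" using \<open>i = s \<or> j = s\<close> herm[of i s] by blast
          then show ?thesis using hs[OF i] by simp
        qed
        moreover have "(\<Sum>k\<in>S. cnj (R' k i) * R' k j) = 0"
          using True by (intro sum.neutral) (auto simp: R'_def)
        ultimately show ?thesis using sum by simp
      next
        case False
        then have "(\<Sum>k\<in>S. cnj (R' k i) * R' k j) = (\<Sum>k\<in>S. cnj (R k i) * R k j)"
          using insert.hyps by (intro sum.cong) (auto simp: R'_def)
        then show ?thesis using R[of i j] False i j sum by simp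
      qed
    qed
    then show ?thesis by blast
  next
    case False
    define p where "p = Re (h s s)"
    have p: "p > 0" using False nonneg by (simp add: p_def)
    have hss: "h s s = of_real p" using im by (simp add: p_def complex_eq_iff)
    define h' where "h' i j = h i j - cnj (h s i) * h s j / of_real p" for i j
    have herm': "h' j i = cnj (h' i j)" for i j
      unfolding h'_def complex_cnj_diff complex_cnj_divide complex_cnj_mult by (simp add: herm[of i j] mult.commute)
    \<comment> \<open>Completing the square: \<open>h'\<close> is the Schur complement, and \<open>y\<close> minimises the form over the \<open>s\<close> entry.\<close>
    have nn: "0 \<le> Re (herm_form S h' x)" for x
    proof -
      define b where "b = (\<Sum>j\<in>S. h s j * x j)"
      define y where "y = x(s := - b / of_real p)"
      have ys: "y i = x i" if "i \<in> S" for i using that insert.hyps by (auto simp: y_def)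
      have by': "(\<Sum>j\<in>S. h s j * y j) = b" unfolding b_def by (intro sum.cong) (auto simp: ys)
      have "herm_form S h' x = herm_form S h x - (\<Sum>i\<in>S. \<Sum>j\<in>S. cnj (h s i * x i) * (h s j * x j) / of_real p)"
        by (simp add: herm_form_def h'_def algebra_simps sum_subtractf)
      also have "(\<Sum>i\<in>S. \<Sum>j\<in>S. cnj (h s i * x i) * (h s j * x j) / of_real p) = cnj b * b / of_real p"
        unfolding b_def cnj_sum sum_product by (simp only: sum_divide_distrib)
      also have "cnj b * b / of_real p = of_real ((cmod b)\<^sup>2 / p)"
        unfolding of_real_divide complex_norm_square by (simp add: mult.commute)
      finally have 1: "Re (herm_form S h' x) = Re (herm_form S h x) - (cmod b)\<^sup>2 / p" by simp
      have "Re (cnj (y s) * b) = - ((cmod b)\<^sup>2 / p)"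
      proof -
        have "cnj (y s) * b = - (b * cnj b / of_real p)" by (simp add: y_def)
        also have "\<dots> = of_real (- ((cmod b)\<^sup>2 / p))"
          by (simp only: complex_norm_square of_real_minus of_real_divide)
        finally show ?thesis by simp
      qed
      moreover have "p * (cmod (y s))\<^sup>2 = (cmod b)\<^sup>2 / p"
        using p by (simp add: y_def norm_divide power_divide power2_eq_square)
      moreover have "herm_form S h y = herm_form S h x" by (rule herm_form_cong) (rule ys)
      ultimately have "Re (herm_form (insert s S) h y) = Re (herm_form S h x) - (cmod b)\<^sup>2 / p"
        unfolding split by' by (simp add: p_def)
      then show ?thesis using 1 insert.prems(2)[of y] by simp
    qed
    obtain R where R: "\<And>i j. i \<in> S \<Longrightarrow> j \<in> S \<Longrightarrow> h' i j = (\<Sum>k\<in>S. cnj (R k i) * R k j)"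
      using insert.IH[OF herm' nn] by blast
    \<comment> \<open>Row \<open>s\<close> restores the rank one kernel subtracted in
      \<open>h'\<close>; the other rows vanish in column \<open>s\<close> and elsewhere factor the
      complement.\<close>
    define R' where "R' k i = (if k = s then h s i / of_real (sqrt p) else if i = s then 0 else R k i)" for k i
    have sq: "complex_of_real (sqrt p) * complex_of_real (sqrt p) = of_real p"
      using p by (simp flip: of_real_mult)
    have "h i j = (\<Sum>k\<in>insert s S. cnj (R' k i) * R' k j)" if i: "i \<in> insert s S" and j: "j \<in> insert s S" for i j
    proof -
      have R's: "cnj (R' s i) * R' s j = cnj (h s i) * h s j / of_real p"
        by (simp add: R'_def sq)
      have sum: "(\<Sum>k\<in>insert s S. cnj (R' k i) * R' k j) = cnj (h s i) * h s j / of_real p + (\<Sum>k\<in>S. cnj (R' k i) * R' k j)"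
        using insert.hyps by (simp add: R's)
      show ?thesis
      proof (cases "i = s \<or> j = s")
        case True
        then have "(\<Sum>k\<in>S. cnj (R' k i) * R' k j) = 0"
          using insert.hyps by (intro sum.neutral) (auto simp: R'_def)
        moreover have "h i j = cnj (h s i) * h s j / of_real p"
        proof (cases "i = s")
          case False
          then have "j = s" using True by blast
          moreover have "h i s = cnj (h s i)" by (rule herm)
          ultimately show ?thesis using p by (simp add: hss)
        qed (use p in \<open>simp add: hss\<close>)
        ultimately show ?thesis using sum by simp
      next
        case False
        then have "(\<Sum>k\<in>S. cnj (R' k i) * R' k j) = (\<Sum>k\<in>S. cnj (R k i) * R k j)"
          using insert.hyps by (intro sum.cong) (auto simp: R'_def)
        then show ?thesis using R[of i j] False i j sum by (simp add: h'_def diff_eq_eq add.commute)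
      qed
    qed
    then show ?thesis by blast
  qed
qed

section \<open>Operators on finite index sets\<close>

lemma ell2_finite_iff: "finite I \<Longrightarrow> x \<in> ell2 I \<longleftrightarrow> (\<forall>i. i \<notin> I \<longrightarrow> x i = 0)"
  by (simp add: ell2_def)

lemma ell2_inner_finite:
  assumes "finite I" "x \<in> ell2 I"
  shows "ell2_inner x y = (\<Sum>i\<in>I. x i * cnj (y i))"
proof -
  have "x = ell2_trunc I x" using assms(2) by (auto simp: ell2_trunc_def ell2_def)
  then show ?thesis using ell2_inner_trunc[OF assms(1), of x y] by simp
qed

lemma ell2_norm_finite:
  assumes "finite I" "x \<in> ell2 I"
  shows "(ell2_norm x)\<^sup>2 = (\<Sum>i\<in>I. (cmod (x i))\<^sup>2)"
proof -
  have "x = ell2_trunc I x" using assms(2) by (auto simp: ell2_trunc_def ell2_def)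
  then show ?thesis using ell2_norm_trunc[OF assms(1), of x] by simp
qed

definition fin_op :: "'i set \<Rightarrow> 'j set \<Rightarrow> ('j \<Rightarrow> 'i \<Rightarrow> complex) \<Rightarrow> ('i, 'j) oper" where
  "fin_op I J m = (\<lambda>x. if x \<in> ell2 I then (\<lambda>j. if j \<in> J then (\<Sum>i\<in>I. m j i * x i) else 0) else (\<lambda>_. 0))"

lemma fin_op_apply: "x \<in> ell2 I \<Longrightarrow> fin_op I J m x = (\<lambda>j. if j \<in> J then (\<Sum>i\<in>I. m j i * x i) else 0)"
  by (simp add: fin_op_def)

lemma fin_op_mem:
  assumes I: "finite I" and J: "finite J"
  shows "fin_op I J m \<in> bounded_ops I J"
proof (rule bounded_opsI)
  show mem: "fin_op I J m x \<in> ell2 J" if "x \<in> ell2 I" for x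
    using that J by (simp add: fin_op_apply ell2_finite_iff)
  show "fin_op I J m x = (\<lambda>_. 0)" if "x \<notin> ell2 I" for x
    using that by (simp add: fin_op_def)
  show "fin_op I J m (\<lambda>i. x i + y i) = (\<lambda>j. fin_op I J m x j + fin_op I J m y j)"
    if "x \<in> ell2 I" "y \<in> ell2 I" for x y
    using that by (auto simp: fin_op_apply sum.distrib ring_distribs)
  show "fin_op I J m (\<lambda>i. c * x i) = (\<lambda>j. c * fin_op I J m x j)" if "x \<in> ell2 I" for x c
    using that by (auto simp: fin_op_apply sum_distrib_left mult.left_commute)
  define B where "B = (\<Sum>j\<in>J. (\<Sum>i\<in>I. cmod (m j i))\<^sup>2)"
  show "ell2_norm (fin_op I J m x) \<le> sqrt B * ell2_norm x" if x: "x \<in> ell2 I" for x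
  proof (rule power2_le_imp_le)
    have xi: "cmod (x i) \<le> ell2_norm x" if "i \<in> I" for i
    proof (rule power2_le_imp_le)
      show "(cmod (x i))\<^sup>2 \<le> (ell2_norm x)\<^sup>2"
        unfolding ell2_norm_finite[OF I x] using I that by (intro member_le_sum) auto
    qed simp
    have "(ell2_norm (fin_op I J m x))\<^sup>2 = (\<Sum>j\<in>J. (cmod (\<Sum>i\<in>I. m j i * x i))\<^sup>2)"
      unfolding ell2_norm_finite[OF J mem[OF x]] by (intro sum.cong) (auto simp: fin_op_apply[OF x])
    also have "\<dots> \<le> (\<Sum>j\<in>J. ((\<Sum>i\<in>I. cmod (m j i)) * ell2_norm x)\<^sup>2)"
    proof (intro sum_mono power_mono)
      fix j
      have "cmod (\<Sum>i\<in>I. m j i * x i) \<le> (\<Sum>i\<in>I. cmod (m j i) * ell2_norm x)"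
        by (intro order_trans[OF norm_sum sum_mono]) (simp add: norm_mult mult_left_mono xi)
      then show "cmod (\<Sum>i\<in>I. m j i * x i) \<le> (\<Sum>i\<in>I. cmod (m j i)) * ell2_norm x"
        by (simp add: sum_distrib_right)
    qed simp
    also have "\<dots> = B * (ell2_norm x)\<^sup>2" by (simp add: B_def power_mult_distrib flip: sum_distrib_right)
    also have "\<dots> = (sqrt B * ell2_norm x)\<^sup>2"
      by (simp add: power_mult_distrib B_def sum_nonneg)
    finally show "(ell2_norm (fin_op I J m x))\<^sup>2 \<le> (sqrt B * ell2_norm x)\<^sup>2" .
  qed (simp add: B_def sum_nonneg)
qed

lemma fin_op_adj:
  assumes I: "finite I" and J: "finite J"
  shows "op_adj I J (fin_op I J m) = fin_op J I (\<lambda>i j. cnj (m j i))"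
proof (rule op_adj_eqI[OF fin_op_mem[OF J I]])
  fix x y assume x: "x \<in> ell2 I" and y: "y \<in> ell2 J"
  have "ell2_inner (fin_op I J m x) y = (\<Sum>j\<in>J. (\<Sum>i\<in>I. m j i * x i) * cnj (y j))"
    unfolding ell2_inner_finite[OF J op_maps[OF fin_op_mem[OF I J] x]]
    by (intro sum.cong) (auto simp: fin_op_apply[OF x])
  also have "\<dots> = (\<Sum>i\<in>I. \<Sum>j\<in>J. m j i * x i * cnj (y j))"
    unfolding sum_distrib_right by (rule sum.swap)
  also have "\<dots> = (\<Sum>i\<in>I. x i * cnj (fin_op J I (\<lambda>i j. cnj (m j i)) y i))"
    by (intro sum.cong) (auto simp: fin_op_apply[OF y] sum_distrib_left mult_ac)
  also have "\<dots> = ell2_inner x (fin_op J I (\<lambda>i j. cnj (m j i)) y)"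
    by (rule ell2_inner_finite[OF I x, symmetric])
  finally show "ell2_inner (fin_op I J m x) y = ell2_inner x (fin_op J I (\<lambda>i j. cnj (m j i)) y)" .
qed

section \<open>Matrices as operators, vector states and diagonal tuples\<close>

lemma mat_op_fin_op: "mat_op n A = fin_op {..<n} {..<n} (\<lambda>i j. A $$ (i, j))"
  by (auto simp: mat_op_def fin_op_def fun_eq_iff)

lemma mat_op_mem: "mat_op n A \<in> bounded_ops {..<n} {..<n}"
  unfolding mat_op_fin_op by (rule fin_op_mem) auto

lemma mat_adjoint_index:
  "A \<in> carrier_mat n n \<Longrightarrow> i < n \<Longrightarrow> j < n \<Longrightarrow> mat_adjoint A $$ (i, j) = cnj (A $$ (j, i))"
  for A :: "complex mat"
  by (simp add: mat_adjoint_def mat_of_rows_def)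

lemma sa_tuples_index:
  assumes "X \<in> sa_tuples n" "i < n" "j < n"
  shows "X k $$ (i, j) = cnj (X k $$ (j, i))"
  using assms mat_adjoint_index[of "X k" n i j] by (simp add: sa_tuples_def)

lemma mat_op_adj:
  assumes "X \<in> sa_tuples n"
  shows "op_adj {..<n} {..<n} (mat_op n (X k)) = mat_op n (X k)"
proof -
  have "fin_op {..<n} {..<n} (\<lambda>i j. cnj (X k $$ (j, i))) = fin_op {..<n} {..<n} (\<lambda>i j. X k $$ (i, j))"
    by (auto simp: fin_op_def fun_eq_iff sa_tuples_index[OF assms, symmetric] intro!: sum.cong)
  then show ?thesis by (simp add: mat_op_fin_op fin_op_adj)
qed

lemma vector_state_W1:
  fixes A :: "'d::finite \<Rightarrow> ('i, 'i) oper"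
  assumes A: "\<And>k. A k \<in> bounded_ops I I" and x: "x \<in> ell2 I" "ell2_norm x = 1"
  shows "(\<chi> k. ell2_inner (A k x) x) \<in> W1 I A"
proof -
  have sub: "T \<in> bounded_ops I I" if "T \<in> cstar_gen I A" for T
    using cstar_gen_bounded[of A I] A that by blast
  have "state_on I (cstar_gen I A) (\<lambda>T. ell2_inner (T x) x)"
    unfolding state_on_def linear_functional_on_def
  proof (intro conjI ballI allI)
    fix S T assume S: "S \<in> cstar_gen I A" and T: "T \<in> cstar_gen I A"
    show "ell2_inner (op_add S T x) x = ell2_inner (S x) x + ell2_inner (T x) x"
      unfolding op_add_def
      by (intro ell2_inner_add_left ell2_UNIV[of _ I] op_maps[OF sub[OF S]] op_maps[OF sub[OF T]] x)
  next
    fix c T assume "T \<in> cstar_gen I A"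
    show "ell2_inner (op_scale c T x) x = c * ell2_inner (T x) x" by (simp add: op_scale_def)
  next
    fix T assume T: "T \<in> cstar_gen I A"
    have "ell2_inner ((op_adj I I T \<circ> T) x) x = ell2_inner (T x) (T x)"
      using op_adj_inner_left[OF sub[OF T] x(1) op_maps[OF sub[OF T] x(1)]] by simp
    then show "ell2_inner ((op_adj I I T \<circ> T) x) x \<in> \<real>\<^sub>\<ge>\<^sub>0" by (simp add: ell2_inner_self)
  next
    show "ell2_inner (op_id I x) x = 1" using x by (simp add: op_id_def ell2_inner_self)
  qed
  then show ?thesis unfolding W1_def by (intro CollectI exI[of _ "\<lambda>T. ell2_inner (T x) x"] conjI refl)
qed

text \<open>Vector states are among the states defining \<open>W1\<close>, and points of
  \<open>real_points K\<close> have real coordinates, so taking real parts loses nothing.\<close>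

lemma Wmax_level_vector:
  assumes X: "X \<in> Wmax_level n K" and x: "x \<in> ell2 {..<n}" "ell2_norm x = 1"
  shows "(\<chi> k. Re (ell2_inner (mat_op n (X k) x) x)) \<in> K"
proof -
  have "(\<chi> k. ell2_inner (mat_op n (X k) x) x) \<in> real_points K"
    using X vector_state_W1[of "\<lambda>k. mat_op n (X k)" "{..<n}" x] x mat_op_mem by (auto simp: Wmax_level_def)
  then obtain y where y: "y \<in> K"
    and eq: "(\<chi> k. ell2_inner (mat_op n (X k) x) x) = (\<chi> k. complex_of_real (vec_nth y k))"
    unfolding real_points_def by blast
  have "ell2_inner (mat_op n (X k) x) x = of_real (vec_nth y k)" for k
    using arg_cong[OF eq, of "\<lambda>v. vec_nth v k"] by simp
  then have "(\<chi> k. Re (ell2_inner (mat_op n (X k) x) x)) = y" by (simp add: vec_eq_iff)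
  then show ?thesis using y by simp
qed

text \<open>A spectral point outside \<open>C\<close> would differ from each
  \<open>v \<in> C\<close> in some coordinate \<open>\<kappa> v\<close>. The product over
  \<open>v\<close> of the operators \<open>N (\<kappa> v) - v (\<kappa> v)\<close> is then 0, since
  it kills every coordinate, yet the character takes on it a product of nonzero numbers.\<close>

lemma diagonal_joint_spectrum:
  fixes N :: "'d::finite \<Rightarrow> ('i, 'i) oper" and pt :: "'i \<Rightarrow> real ^ 'd"
  assumes N: "\<And>k. N k \<in> bounded_ops J J" and C: "finite C" "\<And>j. j \<in> J \<Longrightarrow> pt j \<in> C"
    and Nx: "\<And>k y j. y \<in> ell2 J \<Longrightarrow> j \<in> J \<Longrightarrow> N k y j = of_real (vec_nth (pt j) k) * y j"
  shows "joint_spectrum J N \<subseteq> real_points C"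
proof
  fix z assume "z \<in> joint_spectrum J N"
  then obtain \<phi> where z: "z = (\<chi> k. \<phi> (N k))" and \<phi>: "character_on J (cstar_gen J N) \<phi>"
    unfolding joint_spectrum_def by blast
  have add: "\<phi> (op_add S T) = \<phi> S + \<phi> T" and mult: "\<phi> (S \<circ> T) = \<phi> S * \<phi> T"
    if "S \<in> cstar_gen J N" "T \<in> cstar_gen J N" for S T
    using \<phi> that unfolding character_on_def linear_functional_on_def by blast+
  have scale: "\<phi> (op_scale c T) = c * \<phi> T" if "T \<in> cstar_gen J N" for T c
    using \<phi> that unfolding character_on_def linear_functional_on_def by blast
  have id: "\<phi> (op_id J) = 1"
    using \<phi> unfolding character_on_def by blast
  have sub: "T \<in> bounded_ops J J" if "T \<in> cstar_gen J N" for T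
    using cstar_gen_bounded[of N J] N that by blast
  show "z \<in> real_points C"
  proof (rule ccontr)
    assume "z \<notin> real_points C"
    have "\<exists>k. \<phi> (N k) \<noteq> of_real (vec_nth v k)" if "v \<in> C" for v
    proof (rule ccontr)
      assume "\<not> ?thesis"
      then have "z = (\<chi> k. of_real (vec_nth v k))" by (simp add: z)
      then show False using \<open>z \<notin> real_points C\<close> that by (auto simp: real_points_def)
    qed
    then obtain \<kappa> where \<kappa>: "\<And>v. v \<in> C \<Longrightarrow> \<phi> (N (\<kappa> v)) \<noteq> of_real (vec_nth v (\<kappa> v))" by metis
    \<comment> \<open>\<open>T\<close> is the partial product over the points of
      \<open>S\<close>.\<close>
    have "\<exists>T\<in>cstar_gen J N. \<phi> T \<noteq> 0 \<and> (\<forall>y\<in>ell2 J. \<forall>j\<in>J. pt j \<in> S \<longrightarrow> T y j = 0)" if "S \<subseteq> C" for S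
      using finite_subset[OF that C(1)] that
    proof (induction S)
      case empty
      show ?case using id by (intro bexI[of _ "op_id J"] cstar_gen_id) auto
    next
      case (insert s S)
      then obtain T where T: "T \<in> cstar_gen J N" "\<phi> T \<noteq> 0" "\<forall>y\<in>ell2 J. \<forall>j\<in>J. pt j \<in> S \<longrightarrow> T y j = 0"
        by blast
      define M where "M = op_add (N (\<kappa> s)) (op_scale (- of_real (vec_nth s (\<kappa> s))) (op_id J))"
      have M: "M \<in> cstar_gen J N" unfolding M_def
        by (intro cstar_gen_add cstar_gen_scale cstar_gen_id cstar_gen_gen)
      have "\<phi> M = \<phi> (N (\<kappa> s)) - of_real (vec_nth s (\<kappa> s))"
        unfolding M_def by (simp add: add scale cstar_gen_scale cstar_gen_gen cstar_gen_id id)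
      then have "\<phi> (M \<circ> T) \<noteq> 0" using \<kappa>[of s] insert.prems T M by (simp add: mult)
      moreover have "(M \<circ> T) y j = 0" if "y \<in> ell2 J" "j \<in> J" "pt j \<in> insert s S" for y j
      proof -
        have Ty: "T y \<in> ell2 J" by (rule op_maps[OF sub[OF T(1)] that(1)])
        have "(M \<circ> T) y j = (of_real (vec_nth (pt j) (\<kappa> s)) - of_real (vec_nth s (\<kappa> s))) * T y j"
          using Ty by (simp add: M_def op_add_def op_scale_def op_id_def Nx[OF Ty that(2)] algebra_simps)
        then show ?thesis using that T(3) by auto
      qed
      ultimately show ?case using cstar_gen_comp[OF M T(1)] by blast
    qed
    from this[of C] obtain T where T: "T \<in> cstar_gen J N" "\<phi> T \<noteq> 0" "\<forall>y\<in>ell2 J. \<forall>j\<in>J. T y j = 0"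
      using C(2) by blast
    have "T y = (\<lambda>_. 0)" for y
    proof (cases "y \<in> ell2 J")
      case True
      then have "\<forall>j. j \<notin> J \<longrightarrow> T y j = 0"
        using op_maps[OF sub[OF T(1)] True] ell2_iff[of "T y" J] by blast
      then show ?thesis using T(3) True by (auto simp: fun_eq_iff)
    qed (simp add: bounded_ops_outside[OF sub[OF T(1)]])
    then have "T = op_scale 0 T" by (auto simp: op_scale_def fun_eq_iff)
    then have "\<phi> T = 0" using scale[OF T(1), of 0] by simp
    then show False using T(2) by simp
  qed
qed

section \<open>Dilating to the vertices of a simplex\<close>

lemma sum_product_swap:
  fixes f :: "'a \<Rightarrow> 'c::comm_semiring_0"
  shows "(\<Sum>i\<in>S. f i) * (\<Sum>l\<in>T. g l) = (\<Sum>l\<in>T. \<Sum>i\<in>S. g l * f i)"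
  unfolding sum_product by (subst sum.swap) (simp only: mult.commute)

lemma barycentric_coordinate_nonneg:
  fixes a :: "'a::euclidean_space"
  assumes "\<And>w. w \<in> C \<Longrightarrow> \<alpha> + a \<bullet> w = (if w = v then 1 else 0 :: real)" and "x \<in> convex hull C"
  shows "0 \<le> \<alpha> + a \<bullet> x"
proof -
  have "C \<subseteq> {x. a \<bullet> x \<ge> - \<alpha>}"
  proof
    fix w assume "w \<in> C"
    then have "0 \<le> \<alpha> + a \<bullet> w" using assms(1)[of w] by simp
    then show "w \<in> {x. a \<bullet> x \<ge> - \<alpha>}" by simp
  qed
  then have "convex hull C \<subseteq> {x. a \<bullet> x \<ge> - \<alpha>}" by (rule hull_minimal) (rule convex_halfspace_ge)
  then show ?thesis using assms(2) by auto
qed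

text \<open>At a unit vector the form of \<open>\<alpha> + \<Sigma> a_k X_k\<close> is the affine
  function evaluated at a point of the numerical range; other nonzero vectors reduce to this by
  scaling.\<close>

lemma affine_matrix_psd:
  fixes X :: "'d::finite \<Rightarrow> complex mat" and a :: "real ^ 'd"
  assumes pos: "\<And>x. x \<in> ell2 {..<n} \<Longrightarrow> ell2_norm x = 1 \<Longrightarrow>
     0 \<le> \<alpha> + a \<bullet> (\<chi> k. Re (ell2_inner (mat_op n (X k) x) x))"
  shows "0 \<le> Re (herm_form {..<n} (\<lambda>i j. of_real \<alpha> * (if i = j then 1 else 0) +
     (\<Sum>k\<in>UNIV. of_real (vec_nth a k) * X k $$ (i, j))) x)"
proof -
  \<comment> \<open>The form sees only the entries of \<open>x\<close> below \<open>n\<close>;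
    truncation produces an element of the Hilbert space with the same form.\<close>
  define z where "z = ell2_trunc {..<n} x"
  have z: "z \<in> ell2 {..<n}" unfolding z_def by (rule ell2_trunc_mem) auto
  have Xz: "ell2_inner (mat_op n (X k) z) z = (\<Sum>i<n. \<Sum>j<n. cnj (x i) * X k $$ (i, j) * x j)" for k
    unfolding ell2_inner_finite[OF finite_lessThan op_maps[OF mat_op_mem z]]
    unfolding mat_op_fin_op fin_op_apply[OF z]
    by (auto simp: z_def ell2_trunc_def sum_distrib_left sum_distrib_right mult_ac intro!: sum.cong)
  have "ell2_inner z z = (\<Sum>i<n. cnj (x i) * x i)"
    unfolding ell2_inner_finite[OF finite_lessThan z] by (auto simp: z_def ell2_trunc_def mult_ac intro!: sum.cong)
  also have "\<dots> = (\<Sum>i<n. \<Sum>j<n. cnj (x i) * (if i = j then 1 else 0) * x j)"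
    by (intro sum.cong) (auto simp: if_distrib[of "\<lambda>c. _ * c"] if_distrib[of "\<lambda>c. c * _"] cong: if_cong)
  finally have zz: "ell2_inner z z = (\<Sum>i<n. \<Sum>j<n. cnj (x i) * (if i = j then 1 else 0) * x j)" .
  have "herm_form {..<n} (\<lambda>i j. of_real \<alpha> * (if i = j then 1 else 0) +
     (\<Sum>k\<in>UNIV. of_real (vec_nth a k) * X k $$ (i, j))) x
    = of_real \<alpha> * ell2_inner z z + (\<Sum>k\<in>UNIV. of_real (vec_nth a k) * ell2_inner (mat_op n (X k) z) z)"
  proof -
    have "(\<Sum>k\<in>UNIV. of_real (vec_nth a k) * ell2_inner (mat_op n (X k) z) z) =
       (\<Sum>i<n. \<Sum>k\<in>UNIV. \<Sum>j<n. of_real (vec_nth a k) * (cnj (x i) * X k $$ (i, j) * x j))"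
      unfolding Xz sum_distrib_left by (rule sum.swap)
    also have "\<dots> = (\<Sum>i<n. \<Sum>j<n. \<Sum>k\<in>UNIV. of_real (vec_nth a k) * (cnj (x i) * X k $$ (i, j) * x j))"
      by (intro sum.cong refl sum.swap)
    also have "\<dots> = (\<Sum>i<n. \<Sum>j<n. cnj (x i) * (\<Sum>k\<in>UNIV. of_real (vec_nth a k) * X k $$ (i, j)) * x j)"
      by (simp add: sum_distrib_left sum_distrib_right mult_ac)
    finally show ?thesis
      unfolding zz herm_form_def sum_distrib_left
      by (simp add: sum.distrib distrib_left distrib_right mult_ac sum_distrib_left sum_distrib_right)
  qed
  then have "Re (herm_form {..<n} (\<lambda>i j. of_real \<alpha> * (if i = j then 1 else 0) +
     (\<Sum>k\<in>UNIV. of_real (vec_nth a k) * X k $$ (i, j))) x)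
    = \<alpha> * (ell2_norm z)\<^sup>2 + (\<Sum>k\<in>UNIV. vec_nth a k * Re (ell2_inner (mat_op n (X k) z) z))" (is "?L = _")
    by (simp add: ell2_inner_self)
  also have "\<dots> \<ge> 0"
  proof (cases "ell2_norm z = 0")
    case True
    then show ?thesis using ell2_norm_zero_iff[OF ell2_UNIV[OF z]] by simp
  next
    case False
    define m where "m = ell2_norm z"
    have m: "m > 0" using False ell2_norm_nonneg[of z] by (simp add: m_def less_le)
    define u where "u = (\<lambda>i. of_real (1 / m) * z i)"
    have u: "u \<in> ell2 {..<n}" unfolding u_def by (rule ell2_scale[OF z])
    have nu: "ell2_norm u = 1" unfolding u_def ell2_norm_scale norm_of_real using m by (simp add: m_def)
    have zu: "z = (\<lambda>i. of_real m * u i)" using m by (auto simp: u_def)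
    have "ell2_inner (mat_op n (X k) z) z = of_real m * (of_real m * ell2_inner (mat_op n (X k) u) u)" for k
      by (subst (1 2) zu) (simp add: bounded_ops_scale[OF mat_op_mem u])
    then have "\<alpha> * (ell2_norm z)\<^sup>2 + (\<Sum>k\<in>UNIV. vec_nth a k * Re (ell2_inner (mat_op n (X k) z) z))
      = m * m * (\<alpha> + a \<bullet> (\<chi> k. Re (ell2_inner (mat_op n (X k) u) u)))"
      by (simp add: m_def[symmetric] inner_vec_def power2_eq_square distrib_left sum_distrib_left mult_ac)
    then show ?thesis using pos[OF u nu] by simp
  qed
  finally show ?thesis .
qed

lemma simplex_dilation:
  fixes C :: "(real ^ 'd::finite) set"
  assumes ind: "\<not> affine_dependent C" and card: "card C = Suc CARD('d)"
    and X: "X \<in> sa_tuples n"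
    and num: "\<And>x. x \<in> ell2 {..<n} \<Longrightarrow> ell2_norm x = 1 \<Longrightarrow>
     (\<chi> k. Re (ell2_inner (mat_op n (X k) x) x)) \<in> convex hull C"
  shows "X \<in> Wmin_level TYPE('i::infinite) n (convex hull C)"
proof -
  have fin: "finite C" using aff_independent_finite[OF ind] .
  have card': "card C = Suc DIM(real ^ 'd)" by (simp add: card)
  obtain \<alpha> :: "real ^ 'd \<Rightarrow> real" and a :: "real ^ 'd \<Rightarrow> real ^ 'd"
    where coord: "\<And>v w. v \<in> C \<Longrightarrow> w \<in> C \<Longrightarrow> \<alpha> v + a v \<bullet> w = (if w = v then 1 else 0)"
    and one: "\<And>x. (\<Sum>v\<in>C. \<alpha> v + a v \<bullet> x) = 1"
    and id: "\<And>x. (\<Sum>v\<in>C. (\<alpha> v + a v \<bullet> x) *\<^sub>R v) = x"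
    by (rule barycentric_coordinates[OF ind card'], rule that)
  \<comment> \<open>Extending the entries by 0 gives hermitian symmetry at all index pairs, which is
    how \<open>psd_factorization\<close> asks for it.\<close>
  define Y where "Y k i j = (if i < n \<and> j < n then X k $$ (i, j) else 0)" for k i j
  define h where "h v i j = of_real (\<alpha> v) * (if i = j then 1 else 0) +
     (\<Sum>k\<in>UNIV. of_real (vec_nth (a v) k) * Y k i j)" for v i j
  have Yherm: "Y k j i = cnj (Y k i j)" for k i j
    by (simp add: Y_def sa_tuples_index[OF X, of j i])
  have herm: "h v j i = cnj (h v i j)" for v i j
    unfolding h_def complex_cnj_add complex_cnj_mult cnj_sum complex_cnj_complex_of_real Yherm[symmetric] by simp
  have psd: "0 \<le> Re (herm_form {..<n} (h v) x)" if v: "v \<in> C" for v x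
  proof -
    have "herm_form {..<n} (h v) x = herm_form {..<n} (\<lambda>i j. of_real (\<alpha> v) * (if i = j then 1 else 0) +
     (\<Sum>k\<in>UNIV. of_real (vec_nth (a v) k) * X k $$ (i, j))) x"
      unfolding herm_form_def by (intro sum.cong refl) (simp add: h_def Y_def)
    moreover have "0 \<le> Re \<dots>"
      by (intro affine_matrix_psd barycentric_coordinate_nonneg[of C _ _ v] coord v num)
    ultimately show ?thesis by simp
  qed
  have "\<exists>R. \<forall>i\<in>{..<n}. \<forall>j\<in>{..<n}. h v i j = (\<Sum>k<n. cnj (R k i) * R k j)" if "v \<in> C" for v
    by (rule psd_factorization[OF finite_lessThan herm psd[OF that]])
  then obtain R where R: "\<And>v i j. v \<in> C \<Longrightarrow> i < n \<Longrightarrow> j < n \<Longrightarrow> h v i j = (\<Sum>k<n. cnj (R v k i) * R v k j)"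
    by (metis lessThan_iff)
  define P where "P = C \<times> {..<n}"
  have finP: "finite P" using fin by (simp add: P_def)
  \<comment> \<open>The dilation space has one copy of \<open>{..<n}\<close> per vertex. Its index
    set must lie in the prescribed type \<open>'i\<close>, whose infinitude leaves room for any
    finite set.\<close>
  obtain J0 :: "'i set" where J0: "finite J0" "card J0 = card P"
    using infinite_arbitrarily_large[OF infinite_UNIV] by blast
  then obtain g where g: "bij_betw g P J0" using finite_same_card_bij[OF finP] by metis
  define dec where "dec = inv_into P g"
  have dec: "dec (g p) = p" if "p \<in> P" for p
    unfolding dec_def using g that by (simp add: bij_betw_def)
  have decP: "dec j \<in> P" if "j \<in> J0" for j
    unfolding dec_def using g that by (metis bij_betw_imp_surj_on inv_into_into)
  have sumJ: "(\<Sum>j\<in>J0. F j) = (\<Sum>v\<in>C. \<Sum>k<n. F (g (v, k)))" for F :: "'i \<Rightarrow> complex"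
  proof -
    have "(\<Sum>j\<in>J0. F j) = (\<Sum>p\<in>P. F (g p))" by (rule sum.reindex_bij_betw[OF g, symmetric])
    then show ?thesis by (simp add: P_def sum.cartesian_product)
  qed
  define V where "V = fin_op {..<n} J0 (\<lambda>j i. R (fst (dec j)) (snd (dec j)) i)"
  define N where "N k = fin_op J0 J0 (\<lambda>j i. if j = i then of_real (vec_nth (fst (dec j)) k) else 0)" for k
  have V: "V \<in> bounded_ops {..<n} J0" unfolding V_def by (rule fin_op_mem) (use J0 in auto)
  have N: "N k \<in> bounded_ops J0 J0" for k unfolding N_def by (rule fin_op_mem) (use J0 in auto)
  have Nx: "N k y j = of_real (vec_nth (fst (dec j)) k) * y j" if "y \<in> ell2 J0" "j \<in> J0" for k y j
    using that J0(1) by (simp add: N_def fin_op_apply if_distrib[of "\<lambda>c. c * _"] cong: if_cong)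
  have N0: "N k y j = 0" if "y \<in> ell2 J0" "j \<notin> J0" for k y j
    using that by (simp add: N_def fin_op_apply)
  have Vx: "V y (g (v, k)) = (\<Sum>i<n. R v k i * y i)" if "y \<in> ell2 {..<n}" "v \<in> C" "k < n" for y v k
  proof -
    have p: "(v, k) \<in> P" using that by (simp add: P_def)
    then have "g (v, k) \<in> J0" using g by (auto simp: bij_betw_def)
    then show ?thesis using that by (simp add: V_def fin_op_apply dec[OF p])
  qed
  \<comment> \<open>The weight \<open>c = 1\<close> will show that \<open>V\<close> is an isometry,
    and the weight \<open>c v = v_k\<close> that \<open>N k\<close> compresses to
    \<open>X k\<close>.\<close>
  have key: "(\<Sum>j\<in>J0. of_real (c (fst (dec j))) * V y j * cnj (V z j)) =
     (\<Sum>l<n. \<Sum>i<n. cnj (z l) * (\<Sum>v\<in>C. of_real (c v) * h v l i) * y i)"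
    if y: "y \<in> ell2 {..<n}" and z: "z \<in> ell2 {..<n}" for c y z
  proof -
    have one_v: "(\<Sum>k<n. (\<Sum>i<n. R v k i * y i) * cnj (\<Sum>l<n. R v k l * z l)) =
      (\<Sum>l<n. \<Sum>i<n. cnj (z l) * h v l i * y i)" if v: "v \<in> C" for v
    proof -
      have "(\<Sum>k<n. (\<Sum>i<n. R v k i * y i) * cnj (\<Sum>l<n. R v k l * z l))
        = (\<Sum>k<n. \<Sum>l<n. \<Sum>i<n. cnj (z l) * (cnj (R v k l) * R v k i) * y i)"
        unfolding cnj_sum complex_cnj_mult sum_product_swap by (simp only: mult_ac)
      also have "\<dots> = (\<Sum>l<n. \<Sum>i<n. \<Sum>k<n. cnj (z l) * (cnj (R v k l) * R v k i) * y i)"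
        by (subst sum.swap) (rule sum.cong[OF refl sum.swap])
      also have "\<dots> = (\<Sum>l<n. \<Sum>i<n. cnj (z l) * h v l i * y i)"
        by (intro sum.cong refl) (simp add: R[OF v] sum_distrib_left sum_distrib_right)
      finally show ?thesis .
    qed
    have "(\<Sum>j\<in>J0. of_real (c (fst (dec j))) * V y j * cnj (V z j)) =
      (\<Sum>v\<in>C. \<Sum>k<n. of_real (c v) * ((\<Sum>i<n. R v k i * y i) * cnj (\<Sum>l<n. R v k l * z l)))"
      unfolding sumJ
    proof (intro sum.cong refl)
      fix v k assume "v \<in> C" "k \<in> {..<n}"
      then have "(v, k) \<in> P" "k < n" by (auto simp: P_def)
      then show "of_real (c (fst (dec (g (v, k))))) * V y (g (v, k)) * cnj (V z (g (v, k))) =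
        of_real (c v) * ((\<Sum>i<n. R v k i * y i) * cnj (\<Sum>l<n. R v k l * z l))"
        using \<open>v \<in> C\<close> by (simp only: dec Vx[OF y] Vx[OF z] fst_conv mult.assoc)
    qed
    also have "\<dots> = (\<Sum>v\<in>C. of_real (c v) * (\<Sum>l<n. \<Sum>i<n. cnj (z l) * h v l i * y i))"
      by (intro sum.cong refl) (simp only: one_v flip: sum_distrib_left)
    also have "\<dots> = (\<Sum>v\<in>C. \<Sum>l<n. \<Sum>i<n. cnj (z l) * (of_real (c v) * h v l i) * y i)"
      by (simp add: sum_distrib_left mult_ac)
    also have "\<dots> = (\<Sum>l<n. \<Sum>v\<in>C. \<Sum>i<n. cnj (z l) * (of_real (c v) * h v l i) * y i)" by (rule sum.swap)
    also have "\<dots> = (\<Sum>l<n. \<Sum>i<n. \<Sum>v\<in>C. cnj (z l) * (of_real (c v) * h v l i) * y i)"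
      by (intro sum.cong refl sum.swap)
    also have "\<dots> = (\<Sum>l<n. \<Sum>i<n. cnj (z l) * (\<Sum>v\<in>C. of_real (c v) * h v l i) * y i)"
      by (simp add: sum_distrib_left sum_distrib_right)
    finally show ?thesis .
  qed
  \<comment> \<open>Evaluating the barycentric identities at 0 and at the unit vectors separates
    their constant from their linear coefficients.\<close>
  have a0: "(\<Sum>v\<in>C. \<alpha> v) = 1" using one[of 0] by simp
  have a1: "(\<Sum>v\<in>C. vec_nth (a v) l) = 0" for l
    using one[of "axis l 1"] a0 by (simp add: sum.distrib inner_axis)
  have v0: "(\<Sum>v\<in>C. vec_nth v k * \<alpha> v) = 0" for k
    using arg_cong[OF id[of 0], of "\<lambda>x. vec_nth x k"] by (simp add: mult.commute)
  have v1: "(\<Sum>v\<in>C. vec_nth v k * vec_nth (a v) l) = (if k = l then 1 else 0)" for k l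
  proof -
    have "vec_nth (axis l (1 :: real)) k = (if k = l then 1 else 0)" by (simp add: axis_def)
    then show ?thesis
      using arg_cong[OF id[of "axis l 1"], of "\<lambda>x. vec_nth x k"] v0[of k]
      by (simp add: inner_axis distrib_left distrib_right sum.distrib mult.commute)
  qed
  have comb: "(\<Sum>v\<in>C. of_real (c v) * h v l i) = of_real (\<Sum>v\<in>C. c v * \<alpha> v) * (if l = i then 1 else 0) +
     (\<Sum>k\<in>UNIV. of_real (\<Sum>v\<in>C. c v * vec_nth (a v) k) * Y k l i)" for c l i
  proof -
    have "(\<Sum>k\<in>UNIV. of_real (\<Sum>v\<in>C. c v * vec_nth (a v) k) * Y k l i) =
      (\<Sum>v\<in>C. \<Sum>k\<in>UNIV. of_real (c v * vec_nth (a v) k) * Y k l i)"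
      unfolding of_real_sum sum_distrib_right by (rule sum.swap)
    then show ?thesis
      by (simp add: h_def distrib_left sum.distrib sum_distrib_left sum_distrib_right mult.assoc)
  qed
  have h1: "(\<Sum>v\<in>C. of_real 1 * h v l i) = (if l = i then 1 else 0)" for l i
    unfolding comb[of "\<lambda>_. 1"] by (simp add: a0 a1)
  have hk: "(\<Sum>v\<in>C. of_real (vec_nth v k) * h v l i) = Y k l i" for k l i
    unfolding comb[of "\<lambda>v. vec_nth v k"] v0 v1 by (simp add: if_distrib[of of_real] if_distrib[of "\<lambda>c. c * _"] cong: if_cong)
  have VV: "ell2_inner (V y) (V y) = ell2_inner y y" if y: "y \<in> ell2 {..<n}" for y
  proof -
    have "ell2_inner (V y) (V y) = (\<Sum>j\<in>J0. of_real 1 * V y j * cnj (V y j))"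
      using ell2_inner_finite[OF J0(1) op_maps[OF V y]] by simp
    also have "\<dots> = (\<Sum>l<n. \<Sum>i<n. cnj (y l) * (if l = i then 1 else 0) * y i)"
      unfolding key[OF y y, of "\<lambda>_. 1"] h1 ..
    also have "\<dots> = (\<Sum>l<n. y l * cnj (y l))"
      by (intro sum.cong) (auto simp: if_distrib[of "\<lambda>c. _ * c"] if_distrib[of "\<lambda>c. c * _"] mult.commute cong: if_cong)
    also have "\<dots> = ell2_inner y y" by (rule ell2_inner_finite[OF finite_lessThan y, symmetric])
    finally show ?thesis .
  qed
  have iso: "op_isometry {..<n} J0 V"
    unfolding op_isometry_def
  proof (intro conjI ballI V)
    fix y :: "nat \<Rightarrow> complex" assume "y \<in> ell2 {..<n}"
    from VV[OF this] have "(ell2_norm (V y))\<^sup>2 = (ell2_norm y)\<^sup>2"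
      unfolding ell2_inner_self by (simp only: of_real_eq_iff)
    then show "ell2_norm (V y) = ell2_norm y" by (simp add: power2_eq_iff_nonneg)
  qed
  have comp: "mat_op n (X k) = op_adj {..<n} J0 V \<circ> N k \<circ> V" for k
  proof (rule bounded_ops_eqI[OF mat_op_mem])
    show "op_adj {..<n} J0 V \<circ> N k \<circ> V \<in> bounded_ops {..<n} {..<n}"
      by (rule op_comp_mem[OF op_comp_mem[OF op_adj_mem[OF V] N] V, of k])
    fix y z :: "nat \<Rightarrow> complex" assume y: "y \<in> ell2 {..<n}" and z: "z \<in> ell2 {..<n}"
    have NV: "N k (V y) \<in> ell2 J0" by (intro op_maps[OF N] op_maps[OF V] y)
    have "ell2_inner (N k (V y)) (V z) = (\<Sum>j\<in>J0. of_real (vec_nth (fst (dec j)) k) * V y j * cnj (V z j))"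
      unfolding ell2_inner_finite[OF J0(1) NV] by (intro sum.cong refl) (simp add: Nx op_maps[OF V y])
    also have "\<dots> = (\<Sum>l<n. \<Sum>i<n. cnj (z l) * X k $$ (l, i) * y i)"
      unfolding key[OF y z, of "\<lambda>v. vec_nth v k"] hk by (intro sum.cong refl) (simp add: Y_def)
    also have "\<dots> = ell2_inner (mat_op n (X k) y) z"
      unfolding ell2_inner_finite[OF finite_lessThan op_maps[OF mat_op_mem y]]
      unfolding mat_op_fin_op fin_op_apply[OF y]
      by (auto simp: sum_distrib_left sum_distrib_right mult_ac intro!: sum.cong)
    finally have "ell2_inner (N k (V y)) (V z) = ell2_inner (mat_op n (X k) y) z" .
    then have "ell2_inner (V z) (N k (V y)) = ell2_inner z (mat_op n (X k) y)"
      by (subst (1 2) ell2_inner_commute) simp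
    then show "ell2_inner z (mat_op n (X k) y) = ell2_inner z ((op_adj {..<n} J0 V \<circ> N k \<circ> V) y)"
      using op_adj_inner[OF V z NV] by simp
  qed
  have adjN: "op_adj J0 J0 (N k) = N k" for k
    unfolding N_def fin_op_adj[OF J0(1) J0(1)]
    by (rule arg_cong[where f="fin_op J0 J0"]) (auto simp: fun_eq_iff)
  have "N k \<circ> N l = N l \<circ> N k" for k l
  proof
    fix y
    show "(N k \<circ> N l) y = (N l \<circ> N k) y"
    proof (cases "y \<in> ell2 J0")
      case True
      have "N k (N l y) j = N l (N k y) j" for j
        by (cases "j \<in> J0") (simp_all add: Nx N0 True op_maps[OF N])
      then show ?thesis by (simp add: fun_eq_iff)
    qed (simp add: bounded_ops_outside[OF N] bounded_ops_zero[OF N])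
  qed
  then have normal: "normal_tuple J0 N" unfolding normal_tuple_def by (simp add: N adjN)
  have "joint_spectrum J0 N \<subseteq> real_points C"
    by (rule diagonal_joint_spectrum[OF N fin _ Nx]) (use decP in \<open>auto simp: P_def mem_Times_iff\<close>)
  also have "\<dots> \<subseteq> real_points (convex hull C)" unfolding real_points_def by (intro image_mono hull_subset)
  finally have "joint_spectrum J0 N \<subseteq> real_points (convex hull C)" .
  then show ?thesis
    unfolding Wmin_level_def dilates_to_def using X normal iso comp by blast
qed

section \<open>Anticommuting symmetries\<close>

lemma sum_antisymmetric:
  fixes F :: "'k::finite \<Rightarrow> 'k \<Rightarrow> 'a::field_char_0"
  assumes "\<And>k l. k \<noteq> l \<Longrightarrow> F k l + F l k = 0"
  shows "(\<Sum>k\<in>UNIV. \<Sum>l\<in>UNIV. F k l) = (\<Sum>k\<in>UNIV. F k k)"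
proof -
  have "2 * (\<Sum>k\<in>UNIV. \<Sum>l\<in>UNIV. F k l) = (\<Sum>k\<in>UNIV. \<Sum>l\<in>UNIV. F k l) + (\<Sum>k\<in>UNIV. \<Sum>l\<in>UNIV. F l k)"
    by (subst (3) sum.swap) simp
  also have "\<dots> = (\<Sum>k\<in>UNIV. \<Sum>l\<in>UNIV. if l = k then 2 * F k k else 0)"
    unfolding sum.distrib[symmetric] using assms by (intro sum.cong) auto
  also have "\<dots> = 2 * (\<Sum>k\<in>UNIV. F k k)" by (simp add: sum_distrib_left)
  finally show ?thesis by simp
qed

lemma cstar_gen_sum:
  assumes "finite D" "\<And>k. f k \<in> cstar_gen I A"
  shows "op_sum D f \<in> cstar_gen I A"
  using assms(1)
proof (induction D)
  case empty
  have "op_sum {} f = op_scale 0 (op_id I)" by (simp add: op_sum_def op_scale_def)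
  then show ?case by (simp add: cstar_gen_scale cstar_gen_id)
qed (simp add: op_sum_insert cstar_gen_add assms(2))

lemma linear_functional_on_sum:
  assumes "linear_functional_on (cstar_gen I A) \<phi>" "finite D" "\<And>k. f k \<in> cstar_gen I A"
  shows "\<phi> (op_sum D f) = (\<Sum>k\<in>D. \<phi> (f k))"
  using assms(2)
proof (induction D)
  case empty
  have "op_sum {} f = op_scale 0 (op_id I)" by (simp add: op_sum_def op_scale_def)
  moreover have "\<phi> (op_scale 0 (op_id I)) = 0 * \<phi> (op_id I)"
    using assms(1) cstar_gen_id unfolding linear_functional_on_def by blast
  ultimately show ?case by simp
next
  case (insert l D)
  have "op_sum D f \<in> cstar_gen I A" by (intro cstar_gen_sum insert.hyps assms(3))
  then have "\<phi> (op_add (f l) (op_sum D f)) = \<phi> (f l) + \<phi> (op_sum D f)"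
    using assms(1,3) unfolding linear_functional_on_def by blast
  then show ?case using insert by (simp add: op_sum_insert)
qed

text \<open>
  With \<open>a\<^sub>k = \<phi>(T\<^sub>k)\<close> and \<open>r = \<Sum>\<^sub>k a\<^sub>k\<^sup>2\<close>, the operator \<open>Y = \<Sum>\<^sub>k a\<^sub>k T\<^sub>k\<close> satisfies \<open>Y\<^sup>2 = r\<close>, so positivity of
  \<open>\<phi>((Y - r)\<^sup>2) = r - r\<^sup>2\<close> gives \<open>r \<le> 1\<close>.
\<close>
lemma clifford_W1:
  fixes T :: "'d::finite \<Rightarrow> ('i, 'i) oper"
  assumes T: "\<And>k. T k \<in> bounded_ops I I" and sa: "\<And>k. op_adj I I (T k) = T k"
    and sq: "\<And>k x. x \<in> ell2 I \<Longrightarrow> T k (T k x) = x"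
    and anti: "\<And>k l x i. k \<noteq> l \<Longrightarrow> x \<in> ell2 I \<Longrightarrow> T k (T l x) i = - T l (T k x) i"
  shows "W1 I T \<subseteq> real_points (cball 0 1)"
proof
  fix z assume "z \<in> W1 I T"
  then obtain \<phi> where z: "z = (\<chi> k. \<phi> (T k))" and st: "state_on I (cstar_gen I T) \<phi>"
    unfolding W1_def by blast
  have lin: "linear_functional_on (cstar_gen I T) \<phi>" using st unfolding state_on_def by blast
  have add: "\<phi> (op_add R S) = \<phi> R + \<phi> S" if "R \<in> cstar_gen I T" "S \<in> cstar_gen I T" for R S
    using lin that unfolding linear_functional_on_def by blast
  have scale: "\<phi> (op_scale c S) = c * \<phi> S" if "S \<in> cstar_gen I T" for S c
    using lin that unfolding linear_functional_on_def by blast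
  have pos: "\<phi> (op_adj I I S \<circ> S) \<in> \<real>\<^sub>\<ge>\<^sub>0" if "S \<in> cstar_gen I T" for S
    using st that unfolding state_on_def by blast
  have one: "\<phi> (op_id I) = 1" using st unfolding state_on_def by blast
  note gen [simp] = cstar_gen_id cstar_gen_gen cstar_gen_add cstar_gen_scale
  note mem = op_maps[OF T]
  have real: "Im (\<phi> (T k)) = 0" for k
  proof -
    \<comment> \<open>\<open>S\<close> is self-adjoint with \<open>S^2 = 2 S\<close>, so positivity
      makes \<open>2 + 2 \<phi>(T_k)\<close> a nonnegative real.\<close>
    define S where "S = op_add (op_id I) (T k)"
    have "op_adj I I S = S"
      unfolding S_def by (simp add: op_adj_add[OF op_id_mem T] op_adj_id sa)
    moreover have "S \<circ> S = op_scale 2 S"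
    proof
      fix x
      show "(S \<circ> S) x = op_scale 2 S x"
      proof (cases "x \<in> ell2 I")
        case True
        then show ?thesis using mem[OF True, of k]
          by (simp add: S_def op_add_def op_scale_def op_id_def bounded_ops_add[OF T] sq fun_eq_iff)
      next
        case False
        then show ?thesis
          by (simp add: S_def op_add_def op_scale_def op_id_def bounded_ops_outside[OF T] bounded_ops_zero[OF T])
      qed
    qed
    moreover have "\<phi> (op_scale 2 S) = 2 + 2 * \<phi> (T k)"
      unfolding S_def by (simp add: scale add one)
    ultimately have "2 + 2 * \<phi> (T k) \<in> \<real>\<^sub>\<ge>\<^sub>0" using pos[of S] by (simp add: S_def)
    then show ?thesis by (auto simp: complex_nonneg_Reals_iff)
  qed
  define a where "a k = Re (\<phi> (T k))" for k
  have \<phi>a: "\<phi> (T k) = of_real (a k)" for k using real[of k] by (simp add: a_def complex_eq_iff)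
  define r where "r = (\<Sum>k\<in>UNIV. a k * a k)"
  define Y where "Y = op_sum UNIV (\<lambda>k. op_scale (of_real (a k)) (T k))"
  have Yb: "Y \<in> bounded_ops I I" unfolding Y_def by (intro op_sum_mem op_scale_mem T) simp
  have Yg: "Y \<in> cstar_gen I T" unfolding Y_def by (rule cstar_gen_sum) auto
  have Ysa: "op_adj I I Y = Y"
    unfolding Y_def by (simp add: op_adj_sum[OF _ op_scale_mem[OF T]] op_adj_scale[OF T] sa)
  have \<phi>Y: "\<phi> Y = of_real r"
    unfolding Y_def by (simp add: linear_functional_on_sum[OF lin] scale \<phi>a r_def)
  have YY: "Y (Y x) = (\<lambda>i. of_real r * x i)" if x: "x \<in> ell2 I" for x
  proof
    fix i
    define F where "F k l = of_real (a k) * (of_real (a l) * T k (T l x) i)" for k l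
    have "Y (Y x) i = (\<Sum>k\<in>UNIV. of_real (a k) * T k (\<lambda>j. \<Sum>l\<in>UNIV. of_real (a l) * T l x j) i)"
      by (simp add: Y_def op_sum_def op_scale_def)
    also have "\<dots> = (\<Sum>k\<in>UNIV. \<Sum>l\<in>UNIV. F k l)"
      unfolding F_def
      by (subst bounded_ops_sum[OF T]) (simp_all add: mem x bounded_ops_scale[OF T] sum_distrib_left)
    finally have 1: "Y (Y x) i = (\<Sum>k\<in>UNIV. \<Sum>l\<in>UNIV. F k l)" .
    have FF: "F k l + F l k = 0" if "k \<noteq> l" for k l
      using anti[OF that x, of i] by (simp add: F_def)
    have "(\<Sum>k\<in>UNIV. \<Sum>l\<in>UNIV. F k l) = (\<Sum>k\<in>UNIV. F k k)"
      by (rule sum_antisymmetric) (rule FF)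
    then show "Y (Y x) i = of_real r * x i"
      unfolding 1 by (simp add: F_def sq x r_def sum_distrib_right mult.assoc)
  qed
  define Z where "Z = op_add Y (op_scale (- of_real r) (op_id I))"
  have Zg: "Z \<in> cstar_gen I T" unfolding Z_def using Yg by simp
  have Zsa: "op_adj I I Z = Z"
    unfolding Z_def op_adj_add[OF Yb op_scale_mem[OF op_id_mem]] op_adj_scale[OF op_id_mem] op_adj_id Ysa by simp
  have "Z \<circ> Z = op_add (op_scale (of_real (r + r * r)) (op_id I)) (op_scale (of_real (- 2 * r)) Y)"
  proof
    fix x
    show "(Z \<circ> Z) x = op_add (op_scale (of_real (r + r * r)) (op_id I)) (op_scale (of_real (- 2 * r)) Y) x"
    proof (cases "x \<in> ell2 I")
      case True
      have Yx: "Y x \<in> ell2 I" by (rule op_maps[OF Yb True])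
      have Zx: "Z w = (\<lambda>i. Y w i - of_real r * w i)" if "w \<in> ell2 I" for w
        using that by (simp add: Z_def op_add_def op_scale_def op_id_def)
      have "Z (Z x) = (\<lambda>i. Y (\<lambda>i. Y x i - of_real r * x i) i - of_real r * (Y x i - of_real r * x i))"
        using Zx[of "\<lambda>i. Y x i - of_real r * x i"] Zx[OF True] True Yx by simp
      also have "Y (\<lambda>i. Y x i - of_real r * x i) = (\<lambda>i. of_real r * x i - of_real r * Y x i)"
        using True Yx by (simp add: bounded_ops_diff[OF Yb] bounded_ops_scale[OF Yb] YY)
      finally show ?thesis using True by (simp add: op_add_def op_scale_def op_id_def algebra_simps)
    next
      case False
      then show ?thesis
        by (simp add: Z_def op_add_def op_scale_def op_id_def bounded_ops_outside[OF Yb] bounded_ops_zero[OF Yb])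
    qed
  qed
  then have "\<phi> (Z \<circ> Z) = of_real (r + r * r) + of_real (- 2 * r) * of_real r"
    using Yg by (simp add: add scale one \<phi>Y)
  also have "\<dots> = of_real (r - r * r)" by (simp add: algebra_simps)
  finally have "of_real (r - r * r) \<in> (\<real>\<^sub>\<ge>\<^sub>0 :: complex set)" using pos[OF Zg] Zsa by simp
  then have "r * r \<le> r" by (simp add: complex_nonneg_Reals_iff)
  moreover have "0 \<le> r" unfolding r_def by (intro sum_nonneg) simp
  ultimately have "r \<le> 1" by (cases "r = 0") simp_all
  define y where "y = (\<chi> k. a k)"
  have "(norm y)\<^sup>2 = r" by (simp add: y_def power2_norm_eq_inner inner_vec_def r_def)
  then have "norm y \<le> 1" using \<open>r \<le> 1\<close> power2_le_imp_le[of "norm y" 1] by simp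
  moreover have "z = (\<chi> k. of_real (vec_nth y k))" by (simp add: z y_def \<phi>a)
  ultimately show "z \<in> real_points (cball 0 1)" unfolding real_points_def by auto
qed

text \<open>This encodes signed permutation matrices with entry \<open>sg k i\<close> in row
  \<open>i\<close> and column \<open>pm k i\<close>. Absence of fixed points gives zero diagonals,
  invariance of \<open>sg k\<close> under the involution \<open>pm k\<close> gives symmetry, and the
  product rule for signs gives anticommutation, as the permutations commute.\<close>

definition clifford_signs :: "nat \<Rightarrow> ('d \<Rightarrow> nat \<Rightarrow> nat) \<Rightarrow> ('d \<Rightarrow> nat \<Rightarrow> real) \<Rightarrow> bool" where
  "clifford_signs n pm sg \<longleftrightarrow> (\<forall>k. \<forall>i<n. pm k i < n \<and> pm k (pm k i) = i \<and> pm k i \<noteq> i \<and>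
     sg k (pm k i) = sg k i \<and> (\<forall>l. pm k (pm l i) = pm l (pm k i)) \<and>
     (\<forall>l. k \<noteq> l \<longrightarrow> sg k (pm l i) * sg l (pm k i) = - (sg k i * sg l i))) \<and> (\<forall>k i. sg k i * sg k i = 1)"

text \<open>
  For such signs, \<open>(T\<^sub>k x)\<^sub>i = sg k i x\<^bsub>pm k i\<^esub>\<close> defines anticommuting self-adjoint unitaries on \<open>\<complex>\<^sup>n\<close>.
\<close>
lemma
  assumes "clifford_signs n pm sg" "i < n"
  shows clifford_signs_perm: "pm k i < n" "pm k (pm k i) = i" "pm k i \<noteq> i" "pm k (pm l i) = pm l (pm k i)"
    and clifford_signs_sign: "sg k (pm k i) = sg k i"
      "k \<noteq> l \<Longrightarrow> sg k (pm l i) * sg l (pm k i) = - (sg k i * sg l i)"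
  using assms unfolding clifford_signs_def by blast+

lemma clifford_signs_square: "clifford_signs n pm sg \<Longrightarrow> sg k i * sg k i = 1"
  by (simp add: clifford_signs_def)

lemma clifford_dilation_bound:
  fixes N :: "'d::finite \<Rightarrow> ('j, 'j) oper" and sg :: "'d \<Rightarrow> nat \<Rightarrow> real"
  assumes n: "n \<ge> 1" and cl: "clifford_signs n pm sg"
    and Tx: "\<And>k x i. x \<in> ell2 {..<n} \<Longrightarrow> i < n \<Longrightarrow> T k x i = of_real (sg k i) * x (pm k i)"
    and dil: "dilates_to {..<n} T J N"
    and N: "normal_tuple J N" and spec: "joint_spectrum J N \<subseteq> real_points L"
    and L: "\<And>v. v \<in> L \<Longrightarrow> (norm v)\<^sup>2 \<le> \<rho> + p \<bullet> v"
  shows "(real CARD('d))\<^sup>2 \<le> \<rho>"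
proof -
  note pm = clifford_signs_perm[OF cl]
  note sg = clifford_signs_sign(1)[OF cl] clifford_signs_square[OF cl] clifford_signs_sign(2)[OF cl]
  define d where "d = real CARD('d)"
  obtain V where V': "op_isometry {..<n} J V \<and> (\<forall>k. T k = op_adj {..<n} J V \<circ> N k \<circ> V)"
    using dil unfolding dilates_to_def ..
  note V = conjunct1[OF V'] and TV = HOL.spec[OF conjunct2[OF V']]
  have Vb: "V \<in> bounded_ops {..<n} J" and Vn: "\<And>x. x \<in> ell2 {..<n} \<Longrightarrow> ell2_norm (V x) = ell2_norm x"
    using V unfolding op_isometry_def by blast+
  have Nb: "N k \<in> bounded_ops J J" "N k \<circ> N l = N l \<circ> N k" for k l
    using N unfolding normal_tuple_def by blast+
  have Nsa: "op_adj J J (N k) = N k" for k by (rule real_joint_spectrum_self_adjoint[OF N spec])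
  define e :: "nat \<Rightarrow> nat \<Rightarrow> complex" where "e b = (\<lambda>j. if j = b then 1 else 0)" for b
  have e: "e b \<in> ell2 {..<n}" if "b < n" for b using that by (auto simp: ell2_finite_iff e_def)
  have ne: "ell2_norm (e b) = 1" if "b < n" for b
  proof -
    have "(ell2_norm (e b))\<^sup>2 = (\<Sum>i<n. if i = b then 1 else 0)"
      unfolding ell2_norm_finite[OF finite_lessThan e[OF that]] by (intro sum.cong) (auto simp: e_def)
    then have "(ell2_norm (e b))\<^sup>2 = 1\<^sup>2" using that by simp
    then show ?thesis by (simp only: power2_eq_iff_nonneg ell2_norm_nonneg zero_le_one)
  qed
  define u where "u b = V (e b)" for b
  have u: "u b \<in> ell2 J" "ell2_norm (u b) = 1" if "b < n" for b
    using that by (simp_all add: u_def op_maps[OF Vb] e Vn ne)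
  have Nu: "N k (u b) \<in> ell2 J" if "b < n" for k b by (rule op_maps[OF Nb(1) u(1)[OF that]])
  have comp: "ell2_inner (N k (u b)) (u c) = (if pm k c = b then of_real (sg k c) else 0)" if b: "b < n" and c: "c < n" for k b c
  proof -
    have "ell2_inner (N k (u b)) (u c) = ell2_inner (T k (e b)) (e c)"
      using op_adj_inner_left[OF Vb e[OF c] Nu[OF b]] by (simp add: TV u_def)
    also have "\<dots> = cnj (ell2_inner (e c) (T k (e b)))" by (rule ell2_inner_commute)
    also have "\<dots> = cnj (\<Sum>i<n. e c i * cnj (T k (e b) i))"
      by (subst ell2_inner_finite[OF finite_lessThan e[OF c]]) simp
    also have "(\<Sum>i<n. e c i * cnj (T k (e b) i)) = (\<Sum>i<n. if i = c then cnj (T k (e b) c) else 0)"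
      by (intro sum.cong) (auto simp: e_def)
    also have "cnj \<dots> = T k (e b) c" using c by simp
    also have "\<dots> = (if pm k c = b then of_real (sg k c) else 0)"
      using Tx[OF e[OF b] c] by (simp add: e_def)
    finally show ?thesis .
  qed
  \<comment> \<open>For fixed \<open>b\<close> and \<open>c\<close>, commutativity and
    self-adjointness of \<open>N\<close> make these Gram entries symmetric in \<open>k\<close> and
    \<open>l\<close>; this drives the cancellation of the mixed terms.\<close>
  define G where "G k l b c = Re (ell2_inner (N k (u b)) (N l (u c)))" for k l b c
  have Gsym: "G k l b c = G l k b c" if b: "b < n" and c: "c < n" for k l b c
  proof -
    have "ell2_inner (N k (u b)) (N l (u c)) = ell2_inner (N l (N k (u b))) (u c)"
      using op_adj_inner[OF Nb(1)[of l] Nu[OF b, of k] u(1)[OF c]] by (simp add: Nsa)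
    moreover have "ell2_inner (N l (u b)) (N k (u c)) = ell2_inner (N k (N l (u b))) (u c)"
      using op_adj_inner[OF Nb(1)[of k] Nu[OF b, of l] u(1)[OF c]] by (simp add: Nsa)
    moreover have "N l (N k (u b)) = N k (N l (u b))"
      using fun_cong[OF Nb(2)[of l k], of "u b"] by simp
    ultimately show ?thesis by (simp add: G_def)
  qed
  \<comment> \<open>\<open>w b\<close> is the column \<open>W e_b\<close> of
    \<open>W = \<Sigma> N_k V X_k\<close>, because \<open>X_k e_b\<close> is \<open>sg k b\<close>
    times the basis vector at \<open>pm k b\<close>. Cauchy-Schwarz is applied in each column, where
    \<open><w b, u b> = d\<close>.\<close>
  define w where "w b = (\<lambda>i. \<Sum>k\<in>UNIV. of_real (sg k b) * N k (u (pm k b)) i)" for b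
  have wt: "(\<lambda>i. of_real (sg k b) * N k (u (pm k b)) i) \<in> ell2 J" if "b < n" for k b
    by (intro ell2_scale Nu pm that)
  have w: "w b \<in> ell2 J" if "b < n" for b unfolding w_def by (intro ell2_sum wt that)
  have wu: "d\<^sup>2 \<le> (ell2_norm (w b))\<^sup>2" if b: "b < n" for b
  proof -
    have "ell2_inner (w b) (u b) = (\<Sum>k\<in>UNIV. of_real (sg k b) * ell2_inner (N k (u (pm k b))) (u b))"
      unfolding w_def by (subst ell2_inner_sum_left) (simp_all add: ell2_UNIV[OF wt[OF b]] ell2_UNIV[OF u(1)[OF b]])
    also have "\<dots> = of_real d"
      using b by (simp add: comp pm d_def sg(2) flip: of_real_mult)
    finally have "d = cmod (ell2_inner (w b) (u b))" by (simp add: d_def)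
    also have "\<dots> \<le> ell2_norm (w b) * ell2_norm (u b)"
      using b by (intro ell2_cauchy_schwarz ell2_UNIV[of _ J] w u)
    finally have "d \<le> ell2_norm (w b)" using u(2)[OF b] by simp
    then show ?thesis by (intro power_mono) (simp_all add: d_def)
  qed
  define f where "f k l b = sg k b * sg l b * G k l (pm k b) (pm l b)" for k l b
  have nw: "(ell2_norm (w b))\<^sup>2 = (\<Sum>k\<in>UNIV. \<Sum>l\<in>UNIV. f k l b)" if b: "b < n" for b
  proof -
    note wU = ell2_UNIV[OF wt[OF b]] ell2_UNIV[OF w[OF b]]
    have "ell2_inner (w b) (w b) = (\<Sum>k\<in>UNIV. of_real (sg k b) * ell2_inner (N k (u (pm k b))) (w b))"
      by (subst (1) w_def, subst ell2_inner_sum_left) (simp_all add: wU)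
    also have "\<dots> = (\<Sum>k\<in>UNIV. \<Sum>l\<in>UNIV. of_real (sg k b) * (of_real (sg l b) * ell2_inner (N k (u (pm k b))) (N l (u (pm l b)))))"
    proof (intro sum.cong refl)
      fix k
      have "ell2_inner (N k (u (pm k b))) (w b) = (\<Sum>l\<in>UNIV. of_real (sg l b) * ell2_inner (N k (u (pm k b))) (N l (u (pm l b))))"
        unfolding w_def by (subst ell2_inner_sum_right) (simp_all add: wU ell2_UNIV[OF Nu[OF pm(1)[OF b]]])
      then show "of_real (sg k b) * ell2_inner (N k (u (pm k b))) (w b) =
        (\<Sum>l\<in>UNIV. of_real (sg k b) * (of_real (sg l b) * ell2_inner (N k (u (pm k b))) (N l (u (pm l b)))))"
        by (simp add: sum_distrib_left)
    qed
    finally have "Re (ell2_inner (w b) (w b)) = (\<Sum>k\<in>UNIV. \<Sum>l\<in>UNIV. f k l b)"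
      by (simp add: f_def G_def mult.assoc)
    then show ?thesis by (simp add: ell2_inner_self)
  qed
  define F where "F k l = (\<Sum>b<n. f k l b)" for k l
  have Fanti: "F k l = - F l k" if kl: "k \<noteq> l" for k l
  proof -
    \<comment> \<open>Reindexing by the involution \<open>pm k \<circ> pm l\<close> exchanges the
      two vectors in \<open>G\<close>; the sign rule and the symmetry of \<open>G\<close> then turn
      the summand into \<open>- f l k b\<close>.\<close>
    have "F k l = (\<Sum>b<n. f k l (pm k (pm l b)))"
      unfolding F_def
      by (rule sum.reindex_bij_witness[of _ "\<lambda>b. pm k (pm l b)" "\<lambda>b. pm k (pm l b)"]) (simp_all add: pm(1) pm(2) pm(4)[of _ k l])
    also have "\<dots> = (\<Sum>b<n. - f l k b)"
    proof (intro sum.cong refl)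
      fix b assume "b \<in> {..<n}"
      then have b: "b < n" by simp
      have 1: "pm k (pm k (pm l b)) = pm l b" "pm l (pm k (pm l b)) = pm k b"
        using pm(2)[OF pm(1)[OF b]] pm(4)[OF b, of l k] pm(4)[OF pm(1)[OF b, of l], of l k] pm(2)[OF b] by simp_all
      have 2: "sg k (pm k (pm l b)) = sg k (pm l b)" by (rule sg(1)[OF pm(1)[OF b]])
      have 3: "sg l (pm k (pm l b)) = sg l (pm k b)"
        using sg(1)[OF pm(1)[OF b, of k], of l] pm(4)[OF b, of l k] by simp
      show "f k l (pm k (pm l b)) = - f l k b"
        unfolding f_def 1 2 3 sg(3)[OF b kl]
        using Gsym[OF pm(1)[OF b, of l] pm(1)[OF b, of k], of k l] by simp
    qed
    finally show ?thesis by (simp add: F_def sum_negf)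
  qed
  have Fkk: "F k k = (\<Sum>b<n. (ell2_norm (N k (u b)))\<^sup>2)" for k
  proof -
    have "F k k = (\<Sum>b<n. (ell2_norm (N k (u (pm k b))))\<^sup>2)"
      unfolding F_def f_def sg(2) by (simp add: G_def ell2_inner_self)
    also have "\<dots> = (\<Sum>b<n. (ell2_norm (N k (u b)))\<^sup>2)"
      by (rule sum.reindex_bij_witness[of _ "pm k" "pm k"]) (simp_all add: pm)
    finally show ?thesis .
  qed
  have FF: "(\<Sum>k\<in>UNIV. \<Sum>l\<in>UNIV. F k l) = (\<Sum>k\<in>UNIV. F k k)"
  proof (rule sum_antisymmetric)
    show "F k l + F l k = 0" if "k \<noteq> l" for k l using Fanti[OF that] by simp
  qed
  have "(\<Sum>b<n. d\<^sup>2) \<le> (\<Sum>b<n. \<Sum>k\<in>UNIV. \<Sum>l\<in>UNIV. f k l b)"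
  proof (rule sum_mono)
    show "d\<^sup>2 \<le> (\<Sum>k\<in>UNIV. \<Sum>l\<in>UNIV. f k l b)" if "b \<in> {..<n}" for b
      using wu[of b] nw[of b] that by simp
  qed
  then have lower: "real n * d\<^sup>2 \<le> (\<Sum>b<n. \<Sum>k\<in>UNIV. \<Sum>l\<in>UNIV. f k l b)" by simp
  have "(\<Sum>b<n. \<Sum>k\<in>UNIV. \<Sum>l\<in>UNIV. f k l b) = (\<Sum>k\<in>UNIV. \<Sum>b<n. \<Sum>l\<in>UNIV. f k l b)"
    by (rule sum.swap)
  also have "\<dots> = (\<Sum>k\<in>UNIV. \<Sum>l\<in>UNIV. F k l)"
    unfolding F_def by (rule sum.cong[OF refl sum.swap])
  also have "\<dots> = (\<Sum>b<n. \<Sum>k\<in>UNIV. (ell2_norm (N k (u b)))\<^sup>2)"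
    unfolding FF Fkk by (rule sum.swap)
  finally have middle: "(\<Sum>b<n. \<Sum>k\<in>UNIV. \<Sum>l\<in>UNIV. f k l b) = (\<Sum>b<n. \<Sum>k\<in>UNIV. (ell2_norm (N k (u b)))\<^sup>2)" .
  have "(\<Sum>b<n. \<Sum>k\<in>UNIV. (ell2_norm (N k (u b)))\<^sup>2) \<le> (\<Sum>b<n. \<rho>)"
  proof (rule sum_mono)
    fix b assume "b \<in> {..<n}"
    then have b: "b < n" by simp
    \<comment> \<open>The matrices have zero diagonal, so the linear term vanishes in every
      column.\<close>
    have "ell2_inner (N k (u b)) (u b) = 0" for k using comp[OF b b, of k] pm(3)[OF b, of k] by simp
    then show "(\<Sum>k\<in>UNIV. (ell2_norm (N k (u b)))\<^sup>2) \<le> \<rho>"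
      using joint_spectrum_quadratic_bound[OF N spec L u(1)[OF b]] u(2)[OF b] by simp
  qed
  then have "real n * d\<^sup>2 \<le> real n * \<rho>" using lower middle by simp
  then show ?thesis using n by (simp add: d_def)
qed

text \<open>
  Creation plus annihilation operators on the exterior algebra, whose basis is indexed by subsets.
\<close>
definition flip :: "'a \<Rightarrow> 'a set \<Rightarrow> 'a set" where
  "flip k S = (if k \<in> S then S - {k} else insert k S)"

lemma flip_simps: "flip k (flip k S) = S" "flip k S \<noteq> S" "flip k (flip l S) = flip l (flip k S)"
  by (auto simp: flip_def)

text \<open>The Jordan-Wigner sign of the exterior algebra, from moving \<open>k\<close> past the
  elements of \<open>S\<close> that precede it.\<close>

definition flip_sign :: "('a \<Rightarrow> nat) \<Rightarrow> 'a \<Rightarrow> 'a set \<Rightarrow> real" where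
  "flip_sign pos k S = (- 1) ^ card {j \<in> S. pos j < pos k}"

lemma flip_sign_square: "flip_sign pos k S * flip_sign pos k S = 1"
  by (simp add: flip_sign_def flip: power_add mult_2)

text \<open>Flipping \<open>l\<close> changes the number of predecessors of \<open>k\<close> by one
  exactly when \<open>l\<close> precedes \<open>k\<close>. In particular flipping \<open>k\<close>
  preserves its own sign, which makes the matrices symmetric.\<close>

lemma flip_sign_flip:
  fixes S :: "'a::finite set"
  shows "flip_sign pos k (flip l S) = (if pos l < pos k then - flip_sign pos k S else flip_sign pos k S)"
proof (cases "pos l < pos k")
  case True
  define A where "A = {j \<in> S. pos j < pos k}"
  have *: "{j \<in> flip l S. pos j < pos k} = flip l A"
    using True by (auto simp: flip_def A_def)
  have "(- 1 :: real) ^ card (flip l A) = - ((- 1) ^ card A)"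
  proof (cases "l \<in> A")
    case True
    then have "card A = Suc (card (A - {l}))" using card_Suc_Diff1[of A l] by simp
    then have "(- 1 :: real) ^ card A = - ((- 1) ^ card (A - {l}))" by (simp only: power_Suc mult_minus1)
    then show ?thesis using True by (simp only: flip_def if_True minus_minus)
  qed (simp add: flip_def)
  then show ?thesis using True unfolding flip_sign_def * A_def[symmetric] by simp
next
  case False
  then have "{j \<in> flip l S. pos j < pos k} = {j \<in> S. pos j < pos k}"
    by (auto simp: flip_def)
  then show ?thesis using False by (simp add: flip_sign_def)
qed

text \<open>Injectivity of \<open>pos\<close> orders \<open>k\<close> and \<open>l\<close> strictly,
  so exactly one of the two factors changes sign.\<close>

lemma flip_sign_anticommute:
  fixes S :: "'a::finite set"
  assumes "inj pos" "k \<noteq> l"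
  shows "flip_sign pos k (flip l S) * flip_sign pos l (flip k S) = - (flip_sign pos k S * flip_sign pos l S)"
proof -
  have "pos k \<noteq> pos l" using assms by (auto dest: injD)
  then show ?thesis by (simp add: flip_sign_flip)
qed

text \<open>Matrix entries are indexed by natural numbers, so the \<open>2^d\<close> subsets of the
  index type are enumerated and the flip identities transported along the enumeration.\<close>

lemma clifford_exists:
  obtains n :: nat and pm :: "'d::finite \<Rightarrow> nat \<Rightarrow> nat" and sg :: "'d \<Rightarrow> nat \<Rightarrow> real"
  where "n \<ge> 1" "clifford_signs n pm sg"
proof -
  define n where "n = card (UNIV :: 'd set set)"
  obtain e :: "nat \<Rightarrow> 'd set" where e: "bij_betw e {..<n} UNIV"
    using ex_bij_betw_nat_finite[of "UNIV :: 'd set set"] by (auto simp: n_def atLeast0LessThan)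
  obtain pos :: "'d \<Rightarrow> nat" where pos: "inj pos"
    using finite_imp_inj_to_nat_seg[of "UNIV :: 'd set"] by auto
  define e' where "e' = inv_into {..<n} e"
  have surj: "e ` {..<n} = UNIV" and inj: "inj_on e {..<n}"
    using e unfolding bij_betw_def by blast+
  have e'e: "e' (e i) = i" if "i < n" for i
    unfolding e'_def by (rule inv_into_f_f[OF inj]) (use that in simp)
  have e'n: "e' S < n" for S
    using inv_into_into[of S e "{..<n}"] unfolding e'_def surj by simp
  have ee': "e (e' S) = S" for S
    unfolding e'_def by (rule f_inv_into_f) (simp add: surj)
  define pm where "pm k i = e' (flip k (e i))" for k i
  define sg where "sg k i = flip_sign pos k (e i)" for k i
  have epm: "e (pm k i) = flip k (e i)" for k i by (simp add: pm_def ee')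
  show ?thesis
  proof (rule that)
    show "n \<ge> 1" unfolding n_def by (simp add: Suc_le_eq card_gt_0_iff)
    show "clifford_signs n pm sg"
      unfolding clifford_signs_def
    proof (intro conjI allI impI)
      fix k l :: 'd and i
      show "pm k i < n" by (simp add: pm_def e'n)
      show "pm k (pm k i) = i" if "i < n"
        using that by (simp add: pm_def[of k "pm k i"] epm flip_simps(1) e'e)
      show "pm k i \<noteq> i" using epm[of k i] flip_simps(2)[of k "e i"] by metis
      show "pm k (pm l i) = pm l (pm k i)"
        by (simp add: pm_def[of k "pm l i"] pm_def[of l "pm k i"] epm flip_simps(3)[of k l])
      show "sg k (pm k i) = sg k i" by (simp add: sg_def epm flip_sign_flip)
      show "sg k i * sg k i = 1" by (simp add: sg_def flip_sign_square)
      show "sg k (pm l i) * sg l (pm k i) = - (sg k i * sg l i)" if "k \<noteq> l"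
        by (simp add: sg_def epm flip_sign_anticommute[OF pos that])
    qed
  qed
qed

text \<open>One tuple \<open>X\<close> serves all \<open>L\<close>, \<rho> and \<open>p\<close> at
  once, so the quadratic bound may be chosen after \<open>X\<close>.\<close>

lemma ball_Wmax_witness:
  obtains n :: nat and X :: "'d::finite \<Rightarrow> complex mat"
  where "n \<ge> 1" "X \<in> Wmax_level n (cball 0 1)"
    "\<forall>L \<rho> p. X \<in> Wmin_level TYPE('i::infinite) n L \<longrightarrow> (\<forall>v\<in>L. (norm v)\<^sup>2 \<le> \<rho> + p \<bullet> v) \<longrightarrow>
       (real CARD('d))\<^sup>2 \<le> \<rho>"
proof -
  obtain n :: nat and pm :: "'d \<Rightarrow> nat \<Rightarrow> nat" and sg :: "'d \<Rightarrow> nat \<Rightarrow> real"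
    where n: "n \<ge> 1" and cl: "clifford_signs n pm sg"
    by (rule clifford_exists[where 'd='d])
  note pm = clifford_signs_perm[OF cl]
  note sg = clifford_signs_sign(1)[OF cl] clifford_signs_square[OF cl] clifford_signs_sign(2)[OF cl]
  define X where "X k = mat n n (\<lambda>(i, j). if j = pm k i then complex_of_real (sg k i) else 0)" for k
  define T where "T k = mat_op n (X k)" for k
  have swap: "j = pm k i \<longleftrightarrow> i = pm k j" if "i < n" "j < n" for i j k
    using pm(2) that by metis
  have "mat_adjoint (X k) = X k" for k
  proof (rule eq_matI)
    fix i j assume "i < dim_row (X k)" "j < dim_col (X k)"
    then have ij: "i < n" "j < n" by (simp_all add: X_def)
    have "mat_adjoint (X k) $$ (i, j) = cnj (X k $$ (j, i))"
      by (rule mat_adjoint_index[OF _ ij]) (simp add: X_def)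
    also have "\<dots> = X k $$ (i, j)"
      using ij swap[OF ij, of k] sg(1)[OF ij(2), of k] by (simp add: X_def)
    finally show "mat_adjoint (X k) $$ (i, j) = X k $$ (i, j)" .
  qed (simp_all add: mat_adjoint_def X_def)
  then have sa: "X \<in> sa_tuples n" by (simp add: sa_tuples_def X_def)
  have Tx: "T k x i = of_real (sg k i) * x (pm k i)" if "x \<in> ell2 {..<n}" "i < n" for k x i
    using that by (simp add: T_def mat_op_def X_def if_distrib[of "\<lambda>c. c * _"] pm(1) cong: if_cong)
  have Tb: "T k \<in> bounded_ops {..<n} {..<n}" for k unfolding T_def by (rule mat_op_mem)
  have T0: "T k x i = 0" if "x \<in> ell2 {..<n}" "\<not> i < n" for k x i
    using op_maps[OF Tb that(1)] that(2) by (simp add: ell2_finite_iff)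
  have TT: "T k (T l x) i = of_real (sg k i * sg l (pm k i)) * x (pm l (pm k i))" if "x \<in> ell2 {..<n}" "i < n" for k l x i
    using that by (simp add: Tx op_maps[OF Tb] pm(1))
  have "W1 {..<n} T \<subseteq> real_points (cball 0 1)"
  proof (rule clifford_W1)
    show "T k \<in> bounded_ops {..<n} {..<n}" for k by (rule Tb)
    show "op_adj {..<n} {..<n} (T k) = T k" for k unfolding T_def by (rule mat_op_adj[OF sa])
    show "T k (T k x) = x" if x: "x \<in> ell2 {..<n}" for k x
    proof
      fix i
      show "T k (T k x) i = x i"
      proof (cases "i < n")
        case True
        then show ?thesis by (simp only: TT[OF x True] sg(1) sg(2) pm(2)) simp
      next
        case False
        then show ?thesis using T0[OF op_maps[OF Tb x] False] x by (simp add: ell2_finite_iff)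
      qed
    qed
    show "T k (T l x) i = - T l (T k x) i" if "k \<noteq> l" and x: "x \<in> ell2 {..<n}" for k l x i
    proof (cases "i < n")
      case True
      have 1: "sg k (pm l i) * sg l (pm k i) = - (sg k i * sg l i)" by (rule sg(3)[OF True that(1)])
      have "sg k i * sg l (pm k i) = - (sg l i * sg k (pm l i))"
      proof -
        \<comment> \<open>Inserting the square of \<open>sg k (pm l i)\<close>, which is 1, exposes
          the product governed by the sign rule.\<close>
        have "sg k i * sg l (pm k i) = sg k i * (sg k (pm l i) * sg k (pm l i)) * sg l (pm k i)" by (simp add: sg(2))
        also have "\<dots> = sg k i * sg k (pm l i) * (sg k (pm l i) * sg l (pm k i))" by (simp only: mult_ac)
        also have "\<dots> = - ((sg k i * sg k i) * sg l i * sg k (pm l i))" unfolding 1 by (simp add: mult_ac)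
        finally show ?thesis by (simp add: sg(2))
      qed
      then show ?thesis
        by (simp only: TT[OF x True] pm(4)[OF True, of l k]) simp
    next
      case False
      then show ?thesis by (simp add: T0[OF op_maps[OF Tb x]])
    qed
  qed
  then have Xmax: "X \<in> Wmax_level n (cball 0 1)"
    using sa unfolding Wmax_level_def T_def by blast
  have "(real CARD('d))\<^sup>2 \<le> \<rho>"
    if min: "X \<in> Wmin_level TYPE('i::infinite) n L" and L: "\<And>v. v \<in> L \<Longrightarrow> (norm v)\<^sup>2 \<le> \<rho> + p \<bullet> v" for L \<rho> p
  proof -
    obtain J :: "'i set" and N where "normal_tuple J N" "dilates_to {..<n} T J N"
        "joint_spectrum J N \<subseteq> real_points L"
      using min unfolding Wmin_level_def T_def by blast
    then show ?thesis
      using L by (intro clifford_dilation_bound[where T=T, OF n cl Tx])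
  qed
  then show ?thesis using that[OF n Xmax] by blast
qed

section \<open>Cutting a vertex off the simplex, and the final argument\<close>

text \<open>Write \<open>x = u v + (1 - u) b\<close> with \<open>b\<close> in the face opposite
  \<open>v\<close>. Convexity of the squared norm along this segment has defect
  \<open>u (1 - u) |v - b|^2\<close>, and \<open>u = \<alpha> + a \<bullet> x\<close> is affine in
  \<open>x\<close>. Compactness keeps \<open>u \<le> m < 1\<close> on \<open>L\<close>, so the
  defect is at least \<open>c u\<close>, whose constant term \<open>c \<alpha>\<close> brings \<rho>
  below \<open>D^2\<close>.\<close>

lemma cut_simplex_quadratic_bound:
  fixes C :: "'a::euclidean_space set"
  assumes coord: "\<And>w. w \<in> C \<Longrightarrow> \<alpha> + a \<bullet> w = (if w = v then 1 else 0 :: real)"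
    and v: "v \<in> C" "C - {v} \<noteq> {}" and \<alpha>: "\<alpha> > 0" and D: "D > 0" "\<And>w. w \<in> C \<Longrightarrow> norm w = D"
    and L: "compact L" "L \<subseteq> convex hull C" "v \<notin> L"
  shows "\<exists>\<rho> p. \<rho> < D\<^sup>2 \<and> (\<forall>x\<in>L. (norm x)\<^sup>2 \<le> \<rho> + p \<bullet> x)"
proof (cases "L = {}")
  case True
  then show ?thesis using D by (intro exI[of _ 0]) auto
next
  case False
  have split: "\<exists>u b. 0 \<le> u \<and> u \<le> 1 \<and> b \<in> convex hull (C - {v}) \<and> x = u *\<^sub>R v + (1 - u) *\<^sub>R b \<and> \<alpha> + a \<bullet> x = u
      \<and> norm b \<le> D \<and> a \<bullet> (v - b) = 1" if "x \<in> L" for x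
  proof -
    have "x \<in> convex hull (insert v (C - {v}))" using that L(2) v(1) by (auto simp: insert_absorb)
    then obtain u t b where u: "0 \<le> u" "0 \<le> t" "u + t = 1" "b \<in> convex hull (C - {v})" "x = u *\<^sub>R v + t *\<^sub>R b"
      unfolding convex_hull_insert[OF v(2)] by blast
    have "convex hull (C - {v}) \<subseteq> {x. a \<bullet> x = - \<alpha>}"
    proof (rule hull_minimal)
      show "C - {v} \<subseteq> {x. a \<bullet> x = - \<alpha>}"
      proof
        fix w assume "w \<in> C - {v}"
        then have "\<alpha> + a \<bullet> w = 0" using coord[of w] by simp
        then show "w \<in> {x. a \<bullet> x = - \<alpha>}" by simp
      qed
    qed (rule convex_hyperplane)
    then have ab: "a \<bullet> b = - \<alpha>" using u(4) by auto
    have av: "a \<bullet> v = 1 - \<alpha>" using coord[OF v(1)] by simp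
    have "convex hull (C - {v}) \<subseteq> cball 0 D"
      by (rule hull_minimal) (use D in auto)
    then have "norm b \<le> D" using u(4) by auto
    moreover have t: "t = 1 - u" using u(3) by simp
    moreover have "\<alpha> + a \<bullet> x = u"
      unfolding u(5) t by (simp add: inner_add_right av ab algebra_simps)
    moreover have "a \<bullet> (v - b) = 1" by (simp add: inner_diff_right av ab)
    ultimately show ?thesis using u by (intro exI[of _ u] exI[of _ b]) auto
  qed
  obtain x0 where x0: "x0 \<in> L" "\<And>x. x \<in> L \<Longrightarrow> a \<bullet> x \<le> a \<bullet> x0"
    using continuous_attains_sup[OF L(1) False continuous_on_inner[OF continuous_on_const continuous_on_id], of a] by blast
  define m where "m = \<alpha> + a \<bullet> x0"
  have m: "m < 1"
  proof -
    obtain u b where u: "u \<le> 1" "x0 = u *\<^sub>R v + (1 - u) *\<^sub>R b" "m = u"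
      using split[OF x0(1)] by (auto simp: m_def)
    have "u \<noteq> 1" using u(2) x0(1) L(3) by auto
    then show ?thesis using u by simp
  qed
  have a0: "a \<noteq> 0" using split[OF x0(1)] by auto
  \<comment> \<open>\<open>1 - m\<close> bounds \<open>1 - u\<close> from below on \<open>L\<close>,
    and \<open>1 / |a|\<close> bounds \<open>|v - b|\<close> from below because
    \<open>a \<bullet> (v - b) = 1\<close>.\<close>
  define c where "c = (1 - m) / (norm a)\<^sup>2"
  have c: "c > 0" using m a0 by (simp add: c_def)
  have bound: "(norm x)\<^sup>2 \<le> D\<^sup>2 - c * (\<alpha> + a \<bullet> x)" if x: "x \<in> L" for x
  proof -
    obtain u b where u: "0 \<le> u" "u \<le> 1" "x = u *\<^sub>R v + (1 - u) *\<^sub>R b" "\<alpha> + a \<bullet> x = u" "norm b \<le> D" "a \<bullet> (v - b) = 1"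
      using split[OF x] by blast
    have um: "u \<le> m" using x0(2)[OF x] u(4) by (simp add: m_def)
    have "(norm x)\<^sup>2 = u * (norm v)\<^sup>2 + (1 - u) * (norm b)\<^sup>2 - u * (1 - u) * (norm (v - b))\<^sup>2"
      unfolding u(3) power2_norm_eq_inner
      by (simp add: inner_add_left inner_add_right inner_diff_left inner_diff_right inner_commute algebra_simps power2_eq_square)
    moreover have "(1 - u) * (norm b)\<^sup>2 \<le> (1 - u) * D\<^sup>2"
      using u by (intro mult_left_mono power_mono) auto
    moreover have "u * c \<le> u * (1 - u) * (norm (v - b))\<^sup>2"
    proof -
      have "1 \<le> norm a * norm (v - b)" using norm_cauchy_schwarz[of a "v - b"] u(6) by simp
      then have "1 / norm a \<le> norm (v - b)" using a0 by (simp add: field_simps)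
      then have "(1 / norm a)\<^sup>2 \<le> (norm (v - b))\<^sup>2" by (intro power_mono) auto
      then have "(1 - m) * (1 / norm a)\<^sup>2 \<le> (1 - u) * (norm (v - b))\<^sup>2"
        using um m by (intro mult_mono) auto
      then have "c \<le> (1 - u) * (norm (v - b))\<^sup>2" by (simp add: c_def power_divide)
      then show ?thesis using mult_left_mono[OF _ u(1)] by (simp add: mult.assoc)
    qed
    ultimately have "(norm x)\<^sup>2 \<le> u * D\<^sup>2 + (1 - u) * D\<^sup>2 - u * c"
      using D(2)[OF v(1)] by simp
    then show ?thesis unfolding u(4) by (simp add: algebra_simps)
  qed
  have "c * \<alpha> > 0" using c \<alpha> by simp
  then have "D\<^sup>2 - c * \<alpha> < D\<^sup>2" by linarith
  moreover have "\<forall>x\<in>L. (norm x)\<^sup>2 \<le> (D\<^sup>2 - c * \<alpha>) + (- c *\<^sub>R a) \<bullet> x"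
    using bound by (auto simp: algebra_simps)
  ultimately show ?thesis by blast
qed

text \<open>\<alpha> is the coordinate of the origin. The coordinate is nonnegative on the unit ball
  and equals \<open>\<alpha> - |a|\<close> at the unit vector opposite to \<open>a\<close>, hence
  \<open>\<alpha> \<ge> |a| > 0\<close>.\<close>

lemma barycentric_coordinate_pos:
  fixes a :: "'a::euclidean_space"
  assumes coord: "\<And>w. w \<in> C \<Longrightarrow> \<alpha> + a \<bullet> w = (if w = v then 1 else 0 :: real)"
    and v: "v \<in> C" "C - {v} \<noteq> {}" and ball: "cball 0 1 \<subseteq> convex hull C"
  shows "\<alpha> > 0"
proof -
  note nonneg = barycentric_coordinate_nonneg[OF coord]
  have a: "a \<noteq> 0"
  proof
    assume "a = 0"
    moreover obtain w where "w \<in> C" "w \<noteq> v" using v by blast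
    ultimately show False using coord[of v] coord[of w] v(1) by simp
  qed
  have "- (1 / norm a) *\<^sub>R a \<in> cball 0 1" using a by simp
  then have "0 \<le> \<alpha> + a \<bullet> (- (1 / norm a) *\<^sub>R a)" using ball by (intro nonneg) auto
  also have "a \<bullet> (- (1 / norm a) *\<^sub>R a) = - norm a"
    using a by (simp add: power2_norm_eq_inner[symmetric] power2_eq_square)
  finally have "norm a \<le> \<alpha>" by simp
  moreover have "0 < norm a" using a by simp
  ultimately show ?thesis by linarith
qed

theorem proposition8p5:
  fixes \<Delta> :: "(real ^ 'd::finite) set"
  assumes "int CARD('d) simplex \<Delta>"
    and "cball 0 1 \<subseteq> \<Delta>"
    and "\<forall>v. v extreme_point_of \<Delta> \<longrightarrow> v \<in> sphere 0 (real CARD('d))"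
  shows "\<Delta> \<in> minimal_dilation_hulls TYPE('i::infinite) (cball 0 1)"
proof -
  obtain C where ind: "\<not> affine_dependent C" and card: "int (card C) = int CARD('d) + 1" and \<Delta>: "\<Delta> = convex hull C"
    using assms(1) unfolding simplex_def by blast
  have card: "card C = Suc CARD('d)" using card by simp
  then have card': "card C = Suc DIM(real ^ 'd)" by simp
  have fin: "finite C" using aff_independent_finite[OF ind] .
  \<comment> \<open>By affine independence every point of \<open>C\<close> is an extreme point of
    the hull, so the hypothesis on vertices applies to it.\<close>
  have D: "norm w = real CARD('d)" if "w \<in> C" for w
    using assms(3) that extreme_point_of_convex_hull_affine_independent[OF ind] by (simp add: \<Delta>)
  have "X \<in> Wmin TYPE('i) \<Delta>" if "X \<in> Wmax (cball 0 1)" for X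
  proof -
    obtain n where n: "n \<ge> 1" "X \<in> Wmax_level n (cball 0 1)" using \<open>X \<in> Wmax _\<close> unfolding Wmax_def by auto
    have "X \<in> Wmin_level TYPE('i) n (convex hull C)"
    proof (rule simplex_dilation[OF ind card])
      show "X \<in> sa_tuples n" using n(2) by (simp add: Wmax_level_def)
      show "(\<chi> k. Re (ell2_inner (mat_op n (X k) x) x)) \<in> convex hull C"
        if "x \<in> ell2 {..<n}" "ell2_norm x = 1" for x
        using Wmax_level_vector[OF n(2) that] assms(2) \<Delta> by blast
    qed
    then show ?thesis using n(1) unfolding Wmin_def \<Delta> by auto
  qed
  then have hull: "\<Delta> \<in> dilation_hulls TYPE('i) (cball 0 1)"
    using assms(2) fin unfolding dilation_hulls_def
    by (auto simp: \<Delta> intro: finite_imp_compact_convex_hull convex_convex_hull)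
  have "L = \<Delta>" if L: "L \<in> dilation_hulls TYPE('i) (cball 0 1)" and sub: "L \<subseteq> \<Delta>" for L
  proof -
    have Lc: "compact L" "convex L" "Wmax (cball 0 1) \<subseteq> Wmin TYPE('i) L"
      using L unfolding dilation_hulls_def by auto
    obtain n :: nat and X :: "'d \<Rightarrow> complex mat" where n: "n \<ge> 1" and X: "X \<in> Wmax_level n (cball 0 1)"
      and far: "\<forall>L \<rho> p. X \<in> Wmin_level TYPE('i) n L \<longrightarrow> (\<forall>v\<in>L. (norm v)\<^sup>2 \<le> \<rho> + p \<bullet> v) \<longrightarrow>
         (real CARD('d))\<^sup>2 \<le> \<rho>"
      by (rule ball_Wmax_witness[where 'd='d and 'i='i], rule that)
    have "X \<in> Wmin TYPE('i) L" using X n Lc(3) unfolding Wmax_def by auto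
    then obtain m where m: "m \<ge> 1" "X \<in> Wmin_level TYPE('i) m L" unfolding Wmin_def by auto
    \<comment> \<open>\<open>Wmin\<close> is a union over levels; the size of the matrices
      identifies the level.\<close>
    have "m = n"
      using m(2) X unfolding Wmin_level_def Wmax_level_def sa_tuples_def carrier_mat_def by auto
    \<comment> \<open>\<open>L\<close> is convex, so containing every vertex is enough.\<close>
    have "C \<subseteq> L"
    proof
      fix v assume v: "v \<in> C"
      show "v \<in> L"
      proof (rule ccontr)
        assume vL: "v \<notin> L"
        have "C \<noteq> {v}" using card by auto
        then have ne: "C - {v} \<noteq> {}" using v by blast
        obtain \<alpha> a where coord: "\<And>w. w \<in> C \<Longrightarrow> \<alpha> + a \<bullet> w = (if w = v then 1 else 0 :: real)"
          using ne affine_coordinate_exists[OF ind v] by blast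
        have "\<exists>\<rho> p. \<rho> < (real CARD('d))\<^sup>2 \<and> (\<forall>x\<in>L. (norm x)\<^sup>2 \<le> \<rho> + p \<bullet> x)"
        proof (rule cut_simplex_quadratic_bound[OF coord v ne])
          show "\<alpha> > 0" using barycentric_coordinate_pos[OF coord v ne] assms(2) by (simp add: \<Delta>)
        qed (use D Lc sub vL in \<open>auto simp: \<Delta>\<close>)
        then obtain \<rho> p where \<rho>: "\<rho> < (real CARD('d))\<^sup>2" "\<And>x. x \<in> L \<Longrightarrow> (norm x)\<^sup>2 \<le> \<rho> + p \<bullet> x" by blast
        have "(real CARD('d))\<^sup>2 \<le> \<rho>"
          using far m(2) \<open>m = n\<close> \<rho>(2) by blast
        then show False using \<rho>(1) by simp
      qed
    qed
    then have "\<Delta> \<subseteq> L" unfolding \<Delta> using Lc(2) by (rule hull_minimal)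
    then show ?thesis using sub by blast
  qed
  then show ?thesis using hull unfolding minimal_dilation_hulls_def by blast
qed

end
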